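(* Let $I$ be a set. If $\mathbb F$ is a free $I$-sorted theory and $D$ is a cartesian natural system on $\mathbb F$, then $$H^i(\mathbb F;D)=0\quad\text{for } i>1,$$ where $H^*(\mathbb F;D)$ is the (Baues-Wirsching) cohomology of the category $\mathbb F$ with coefficients in the natural system $D$.
   Context: Theories. A (finite product) theory is a small category with finite products; a morphism of theories is a functor preserving finite products. For a set $I$, let $\mathbf{Fam}_I$ be the opposite of the category whose objects are maps $\{1,\dots,n\}\to I$, $n\ge 0$, and whose morphisms are maps of sets over $I$. Its objects are written $X_{i_1}\times\cdots\times X_{i_n}$ with $(i_1,\dots,i_n)\in I^n$, and they are indeed the products of the $X_{i_\nu}$ in $\mathbf{Fam}_I$. An $I$-sorted theory is a theory morphism $\mathbf{Fam}_I\to\mathbb A$ which is the identity on objects; $I$-sorted theories form a category $\mathbf{Th}_I$ (full subcategory of the category of theories under $\mathbf{Fam}_I$). The forgetful functor $\mathbf{Th}_I\to\prod_{n\ge0}\mathbf{Set}^{I^n\times I}$, sending $\mathbb A$ to the family of sets $\mathrm{Hom}_{\mathbb A}(X_{i_1}\times\cdots\times X_{i_n},X_i)$, has a left adjoint; theories in the image of this left adjoint are called free. Natural systems. For a category $\mathbf C$, the category of factorizations $\mathbf F\mathbf C$ has the morphisms $f:A\to B$ of $\mathbf C$ as objects; a morphism from $f:A\to B$ to $g:A'\to B'$ is a pair $(a:A'\to A,\ b:B\to B')$ with $g=bfa$. A natural system on $\mathbf C$ is a functor $D:\mathbf F\mathbf C\to\mathbf{Ab}$, $f\mapsto D_f$;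 the induced maps are written $D_f\to D_{bf}$, $\xi\mapsto b\xi$, and $D_f\to D_{fa}$, $\xi\mapsto\xi a$. $H^*(\mathbf C;D)$ is the cohomology of the cochain complex $C^n(\mathbf C;D)=\prod D_{a_1\cdots a_n}$, the product being over all composable strings $A_0\xleftarrow{a_1}A_1\leftarrow\cdots\xleftarrow{a_n}A_n$ in $\mathbf C$ (for $n=0$: $\prod_A D_{1_A}$), with $$d(\varphi)(a_1,\dots,a_{n+1})=a_1\varphi(a_2,\dots,a_{n+1})+\sum_{i=1}^n(-1)^i\varphi(a_1,\dots,a_ia_{i+1},\dots,a_{n+1})+(-1)^{n+1}\varphi(a_1,\dots,a_n)a_{n+1}.$$ A natural system $D$ on a theory $\mathbb A$ is cartesian if for any product diagram $p_k:X_1\times\cdots\times X_n\to X_k$, $k=1,\dots,n$ ($n\ge 0$), and any morphism $f:X\to X_1\times\cdots\times X_n$, the homomorphism $D_f\to D_{p_1f}\times\cdots\times D_{p_nf}$, $a\mapsto(p_1a,\dots,p_na)$, is an isomorphism. *)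

theory Defs
  imports "HOL-Algebra.FiniteProduct" "HOL-Algebra.Product_Groups"
begin

record ('o, 'a) cat =
  Obj :: "'o set"
  Arr :: "'a set"
  Dom :: "'a \<Rightarrow> 'o"
  Cod :: "'a \<Rightarrow> 'o"
  Ident :: "'o \<Rightarrow> 'a"
  Comp :: "'a \<Rightarrow> 'a \<Rightarrow> 'a"  (infixr \<open>\<cdot>\<index>\<close> 70)

definition Homset :: "('o, 'a) cat \<Rightarrow> 'o \<Rightarrow> 'o \<Rightarrow> 'a set" where
  "Homset C X Y = {f \<in> Arr C. Dom C f = X \<and> Cod C f = Y}"

definition category :: "('o, 'a) cat \<Rightarrow> bool" where
  "category C \<longleftrightarrow>
     (\<forall>f\<in>Arr C. Dom C f \<in> Obj C \<and> Cod C f \<in> Obj C) \<and>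
     (\<forall>X\<in>Obj C. Ident C X \<in> Homset C X X) \<and>
     (\<forall>f\<in>Arr C. \<forall>g\<in>Arr C. Dom C g = Cod C f \<longrightarrow>
        g \<cdot>\<^bsub>C\<^esub> f \<in> Homset C (Dom C f) (Cod C g)) \<and>
     (\<forall>f\<in>Arr C. f \<cdot>\<^bsub>C\<^esub> Ident C (Dom C f) = f \<and> Ident C (Cod C f) \<cdot>\<^bsub>C\<^esub> f = f) \<and>
     (\<forall>f\<in>Arr C. \<forall>g\<in>Arr C. \<forall>h\<in>Arr C. Dom C g = Cod C f \<longrightarrow> Dom C h = Cod C g \<longrightarrow>
        (h \<cdot>\<^bsub>C\<^esub> g) \<cdot>\<^bsub>C\<^esub> f = h \<cdot>\<^bsub>C\<^esub> (g \<cdot>\<^bsub>C\<^esub> f))"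

definition op_cat :: "('o, 'a) cat \<Rightarrow> ('o, 'a) cat" where
  "op_cat C = \<lparr>Obj = Obj C, Arr = Arr C, Dom = Cod C, Cod = Dom C,
     Ident = Ident C, Comp = (\<lambda>g f. f \<cdot>\<^bsub>C\<^esub> g)\<rparr>"

definition cat_functor ::
  "('o, 'a) cat \<Rightarrow> ('p, 'b) cat \<Rightarrow> ('o \<Rightarrow> 'p) \<Rightarrow> ('a \<Rightarrow> 'b) \<Rightarrow> bool" where
  "cat_functor C D Fo Fa \<longleftrightarrow>
     (\<forall>X\<in>Obj C. Fo X \<in> Obj D) \<and>
     (\<forall>f\<in>Arr C. Fa f \<in> Homset D (Fo (Dom C f)) (Fo (Cod C f))) \<and>
     (\<forall>X\<in>Obj C. Fa (Ident C X) = Ident D (Fo X)) \<and>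
     (\<forall>f\<in>Arr C. \<forall>g\<in>Arr C. Dom C g = Cod C f \<longrightarrow>
        Fa (g \<cdot>\<^bsub>C\<^esub> f) = Fa g \<cdot>\<^bsub>D\<^esub> Fa f)"

text \<open>The list \<open>ps\<close> contains the projections; the factors are their codomains.\<close>

definition product_diagram :: "('o, 'a) cat \<Rightarrow> 'o \<Rightarrow> 'a list \<Rightarrow> bool" where
  "product_diagram C P ps \<longleftrightarrow>
     P \<in> Obj C \<and>
     (\<forall>p\<in>set ps. p \<in> Arr C \<and> Dom C p = P) \<and>
     (\<forall>X\<in>Obj C. \<forall>fs. length fs = length ps \<longrightarrow>
        (\<forall>k<length ps. fs ! k \<in> Homset C X (Cod C (ps ! k))) \<longrightarrow>
        (\<exists>!h. h \<in> Homset C X P \<and> (\<forall>k<length ps. ps ! k \<cdot>\<^bsub>C\<^esub> h = fs ! k)))"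

definition fp_theory :: "('o, 'a) cat \<Rightarrow> bool" where
  "fp_theory C \<longleftrightarrow> category C \<and>
     (\<forall>Xs\<in>lists (Obj C). \<exists>P ps. product_diagram C P ps \<and> map (Cod C) ps = Xs)"

definition theory_morphism ::
  "('o, 'a) cat \<Rightarrow> ('p, 'b) cat \<Rightarrow> ('o \<Rightarrow> 'p) \<Rightarrow> ('a \<Rightarrow> 'b) \<Rightarrow> bool" where
  "theory_morphism C D Fo Fa \<longleftrightarrow> cat_functor C D Fo Fa \<and>
     (\<forall>P ps. product_diagram C P ps \<longrightarrow> product_diagram D (Fo P) (map Fa ps))"

text \<open>
  The category of maps \<open>{0..<n} \<rightarrow> I\<close> and maps of sets over \<open>I\<close>. An object is encoded
  as the list \<open>v\<close> of its values. An arrow \<open>(v, f, w)\<close> from \<open>v\<close> to \<open>w\<close> carries the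
  list \<open>f\<close> of values of the underlying map of index sets.
\<close>

definition finsets_over :: "'i set \<Rightarrow> ('i list, 'i list \<times> nat list \<times> 'i list) cat" where
  "finsets_over I = \<lparr>
     Obj = lists I,
     Arr = {(v, f, w). v \<in> lists I \<and> w \<in> lists I \<and> length f = length v \<and>
              (\<forall>k<length v. f ! k < length w \<and> w ! (f ! k) = v ! k)},
     Dom = (\<lambda>(v, f, w). v),
     Cod = (\<lambda>(v, f, w). w),
     Ident = (\<lambda>v. (v, [0..<length v], v)),
     Comp = (\<lambda>(v', g, w) (v, f, w'). (v, map (\<lambda>k. g ! k) f, w))\<rparr>"

definition Fam :: "'i set \<Rightarrow> ('i list, 'i list \<times> nat list \<times> 'i list) cat" where
  "Fam I = op_cat (finsets_over I)"

definition sorted_theory ::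
  "'i set \<Rightarrow> ('i list, 'a) cat \<Rightarrow> ('i list \<times> nat list \<times> 'i list \<Rightarrow> 'a) \<Rightarrow> bool" where
  "sorted_theory I A J \<longleftrightarrow>
     fp_theory A \<and> Obj A = Obj (Fam I) \<and> theory_morphism (Fam I) A (\<lambda>v. v) J"

text \<open>
  Being compatible with the structure maps from \<open>Fam I\<close>, a morphism of sorted theories is
  the identity on objects; hence only its action on arrows is recorded.
\<close>

definition sorted_theory_morphism ::
  "'i set \<Rightarrow>
   ('i list, 'a) cat \<Rightarrow> ('i list \<times> nat list \<times> 'i list \<Rightarrow> 'a) \<Rightarrow>
   ('i list, 'b) cat \<Rightarrow> ('i list \<times> nat list \<times> 'i list \<Rightarrow> 'b) \<Rightarrow> ('a \<Rightarrow> 'b) \<Rightarrow> bool" where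
  "sorted_theory_morphism I A J B K H \<longleftrightarrow>
     theory_morphism A B (\<lambda>v. v) H \<and> (\<forall>u\<in>Arr (Fam I). H (J u) = K u)"

text \<open>
  \<open>family_map I E A h\<close>: \<open>h\<close> is a map from the family of sets \<open>E w i\<close> to the underlying family
  of sets \<open>Hom(X\<^sub>w, X\<^sub>i)\<close> of the sorted theory \<open>A\<close>.
\<close>

definition family_map ::
  "'i set \<Rightarrow> ('i list \<Rightarrow> 'i \<Rightarrow> 'e set) \<Rightarrow> ('i list, 'a) cat \<Rightarrow>
   ('i list \<Rightarrow> 'i \<Rightarrow> 'e \<Rightarrow> 'a) \<Rightarrow> bool" where
  "family_map I E A h \<longleftrightarrow>
     (\<forall>w\<in>lists I. \<forall>i\<in>I. \<forall>e\<in>E w i. h w i e \<in> Homset A w [i])"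

text \<open>
  The sorted theory \<open>(F, J)\<close> is free: it is the value at the family \<open>E\<close> of the left adjoint
  of the forgetful functor, with unit \<open>\<eta>\<close>. The universal property ranges over the sorted
  theories whose arrows live in the type \<open>'a\<close> of the arrows of \<open>F\<close>. This type is always large
  enough. Suppose \<open>I\<close> is nonempty (for \<open>I = {}\<close> all sorted theories are terminal). The
  identities of \<open>F\<close> show that \<open>'a\<close> has at least \<open>max \<aleph>\<^sub>0 |I|\<close> elements, so the sorted theory
  of all functions between finite powers of a two-element set can be realised in \<open>'a\<close>; the
  universal property for it makes \<open>\<eta>\<close> injective. So \<open>'a\<close> has at least \<open>max \<aleph>\<^sub>0 |I| |E|\<close>
  elements, the theory of terms over \<open>E\<close> can be realised in \<open>'a\<close> too, and \<open>F\<close> is isomorphic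
  to it.
\<close>

definition free_sorted_theory ::
  "'i set \<Rightarrow> ('i list, 'a) cat \<Rightarrow> ('i list \<times> nat list \<times> 'i list \<Rightarrow> 'a) \<Rightarrow>
   ('i list \<Rightarrow> 'i \<Rightarrow> 'e set) \<Rightarrow> ('i list \<Rightarrow> 'i \<Rightarrow> 'e \<Rightarrow> 'a) \<Rightarrow> bool" where
  "free_sorted_theory I F J E \<eta> \<longleftrightarrow>
     sorted_theory I F J \<and> family_map I E F \<eta> \<and>
     (\<forall>(A :: ('i list, 'a) cat) K h. sorted_theory I A K \<longrightarrow> family_map I E A h \<longrightarrow>
        (\<exists>!H. H \<in> extensional (Arr F) \<and> sorted_theory_morphism I F J A K H \<and>
           (\<forall>w\<in>lists I. \<forall>i\<in>I. \<forall>e\<in>E w i. H (\<eta> w i e) = h w i e)))"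

text \<open>
  An arrow \<open>(f, a, b)\<close> of the category of factorizations is the pair \<open>(a, b)\<close> regarded as a
  morphism from \<open>f\<close> to \<open>b f a\<close>.
\<close>

definition factorizations :: "('o, 'a) cat \<Rightarrow> ('a, 'a \<times> 'a \<times> 'a) cat" where
  "factorizations C = \<lparr>
     Obj = Arr C,
     Arr = {(f, a, b). f \<in> Arr C \<and> a \<in> Arr C \<and> b \<in> Arr C \<and>
              Cod C a = Dom C f \<and> Dom C b = Cod C f},
     Dom = (\<lambda>(f, a, b). f),
     Cod = (\<lambda>(f, a, b). b \<cdot>\<^bsub>C\<^esub> f \<cdot>\<^bsub>C\<^esub> a),
     Ident = (\<lambda>f. (f, Ident C (Dom C f), Ident C (Cod C f))),
     Comp = (\<lambda>(g, a', b') (f, a, b). (f, a \<cdot>\<^bsub>C\<^esub> a', b' \<cdot>\<^bsub>C\<^esub> b))\<rparr>"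

text \<open>The abelian groups are written multiplicatively, as in the group theory library.\<close>

definition Ab_functor ::
  "('o, 'a) cat \<Rightarrow> ('o \<Rightarrow> 'd monoid) \<Rightarrow> ('a \<Rightarrow> 'd \<Rightarrow> 'd) \<Rightarrow> bool" where
  "Ab_functor C D T \<longleftrightarrow>
     (\<forall>X\<in>Obj C. comm_group (D X)) \<and>
     (\<forall>f\<in>Arr C. T f \<in> hom (D (Dom C f)) (D (Cod C f))) \<and>
     (\<forall>X\<in>Obj C. \<forall>x\<in>carrier (D X). T (Ident C X) x = x) \<and>
     (\<forall>f\<in>Arr C. \<forall>g\<in>Arr C. Dom C g = Cod C f \<longrightarrow>
        (\<forall>x\<in>carrier (D (Dom C f)). T (g \<cdot>\<^bsub>C\<^esub> f) x = T g (T f x)))"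

definition natural_system ::
  "('o, 'a) cat \<Rightarrow> ('a \<Rightarrow> 'd monoid) \<Rightarrow> ('a \<times> 'a \<times> 'a \<Rightarrow> 'd \<Rightarrow> 'd) \<Rightarrow> bool" where
  "natural_system C D T \<longleftrightarrow> Ab_functor (factorizations C) D T"

text \<open>The maps \<open>\<xi> \<mapsto> b \<xi>\<close> from \<open>D f\<close> to \<open>D (b f)\<close> and \<open>\<xi> \<mapsto> \<xi> a\<close> from \<open>D f\<close> to \<open>D (f a)\<close>.\<close>

definition left_act ::
  "('o, 'a) cat \<Rightarrow> ('a \<times> 'a \<times> 'a \<Rightarrow> 'd \<Rightarrow> 'd) \<Rightarrow> 'a \<Rightarrow> 'a \<Rightarrow> 'd \<Rightarrow> 'd" where
  "left_act C T b f = T (f, Ident C (Dom C f), b)"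

definition right_act ::
  "('o, 'a) cat \<Rightarrow> ('a \<times> 'a \<times> 'a \<Rightarrow> 'd \<Rightarrow> 'd) \<Rightarrow> 'a \<Rightarrow> 'a \<Rightarrow> 'd \<Rightarrow> 'd" where
  "right_act C T f a = T (f, a, Ident C (Cod C f))"

definition cartesian ::
  "('o, 'a) cat \<Rightarrow> ('a \<Rightarrow> 'd monoid) \<Rightarrow> ('a \<times> 'a \<times> 'a \<Rightarrow> 'd \<Rightarrow> 'd) \<Rightarrow> bool" where
  "cartesian C D T \<longleftrightarrow>
     (\<forall>P ps f. product_diagram C P ps \<longrightarrow> f \<in> Arr C \<longrightarrow> Cod C f = P \<longrightarrow>
        (\<lambda>x. \<lambda>k\<in>{..<length ps}. left_act C T (ps ! k) f x)
          \<in> iso (D f) (product_group {..<length ps} (\<lambda>k. D (ps ! k \<cdot>\<^bsub>C\<^esub> f))))"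

text \<open>
  A composable string \<open>A\<^sub>0 \<leftarrow> A\<^sub>1 \<leftarrow> \<dots> \<leftarrow> A\<^sub>n\<close> is encoded as the pair of \<open>A\<^sub>0\<close> and the list of
  its arrows, so that the strings of length \<open>0\<close> are the objects. The object \<open>A\<^sub>0\<close> is redundant
  if \<open>n > 0\<close>.
\<close>

fun composable :: "('o, 'a) cat \<Rightarrow> 'o \<Rightarrow> 'a list \<Rightarrow> bool" where
  "composable C A [] \<longleftrightarrow> A \<in> Obj C"
| "composable C A (a # as) \<longleftrightarrow> a \<in> Arr C \<and> Cod C a = A \<and> composable C (Dom C a) as"

definition strings :: "('o, 'a) cat \<Rightarrow> nat \<Rightarrow> ('o \<times> 'a list) set" where
  "strings C n = {(A, as). composable C A as \<and> length as = n}"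

fun composite :: "('o, 'a) cat \<Rightarrow> 'o \<times> 'a list \<Rightarrow> 'a" where
  "composite C (A, []) = Ident C A"
| "composite C (A, a # as) = a \<cdot>\<^bsub>C\<^esub> composite C (Dom C a, as)"

definition cochain_group ::
  "('o, 'a) cat \<Rightarrow> ('a \<Rightarrow> 'd monoid) \<Rightarrow> nat \<Rightarrow> ('o \<times> 'a list \<Rightarrow> 'd) monoid" where
  "cochain_group C D n = product_group (strings C n) (\<lambda>s. D (composite C s))"

definition drop_first :: "('o, 'a) cat \<Rightarrow> 'o \<times> 'a list \<Rightarrow> 'o \<times> 'a list" where
  "drop_first C = (\<lambda>(A, as). (Dom C (hd as), tl as))"

definition drop_last :: "'o \<times> 'a list \<Rightarrow> 'o \<times> 'a list" where
  "drop_last = (\<lambda>(A, as). (A, butlast as))"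

text \<open>
  The arrows of a string are counted from \<open>1\<close>, so \<open>merge C i\<close> composes \<open>as ! (i - 1)\<close> with
  \<open>as ! i\<close>; it is used for \<open>0 < i < length as\<close> only.
\<close>

definition merge :: "('o, 'a) cat \<Rightarrow> nat \<Rightarrow> 'o \<times> 'a list \<Rightarrow> 'o \<times> 'a list" where
  "merge C i = (\<lambda>(A, as).
     (A, take (i - 1) as @ [as ! (i - 1) \<cdot>\<^bsub>C\<^esub> as ! i] @ drop (i + 1) as))"

definition coboundary ::
  "('o, 'a) cat \<Rightarrow> ('a \<Rightarrow> 'd monoid) \<Rightarrow> ('a \<times> 'a \<times> 'a \<Rightarrow> 'd \<Rightarrow> 'd) \<Rightarrow> nat \<Rightarrow>
   ('o \<times> 'a list \<Rightarrow> 'd) \<Rightarrow> ('o \<times> 'a list \<Rightarrow> 'd)" where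
  "coboundary C D T n \<phi> = (\<lambda>s\<in>strings C (Suc n). let G = D (composite C s) in
       left_act C T (hd (snd s)) (composite C (drop_first C s)) (\<phi> (drop_first C s))
     \<otimes>\<^bsub>G\<^esub> (\<Otimes>\<^bsub>G\<^esub>i\<in>{1..n}. \<phi> (merge C i s) [^]\<^bsub>G\<^esub> ((- 1) ^ i :: int))
     \<otimes>\<^bsub>G\<^esub> right_act C T (composite C (drop_last s)) (last (snd s)) (\<phi> (drop_last s))
           [^]\<^bsub>G\<^esub> ((- 1) ^ (n + 1) :: int))"

definition cocycles ::
  "('o, 'a) cat \<Rightarrow> ('a \<Rightarrow> 'd monoid) \<Rightarrow> ('a \<times> 'a \<times> 'a \<Rightarrow> 'd \<Rightarrow> 'd) \<Rightarrow> nat \<Rightarrow>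
   ('o \<times> 'a list \<Rightarrow> 'd) set" where
  "cocycles C D T n =
     kernel (cochain_group C D n) (cochain_group C D (Suc n)) (coboundary C D T n)"

definition coboundaries ::
  "('o, 'a) cat \<Rightarrow> ('a \<Rightarrow> 'd monoid) \<Rightarrow> ('a \<times> 'a \<times> 'a \<Rightarrow> 'd \<Rightarrow> 'd) \<Rightarrow> nat \<Rightarrow>
   ('o \<times> 'a list \<Rightarrow> 'd) set" where
  "coboundaries C D T n = (case n of
       0 \<Rightarrow> {\<one>\<^bsub>cochain_group C D 0\<^esub>}
     | Suc m \<Rightarrow> coboundary C D T m ` carrier (cochain_group C D m))"

definition cohomology_group ::
  "('o, 'a) cat \<Rightarrow> ('a \<Rightarrow> 'd monoid) \<Rightarrow> ('a \<times> 'a \<times> 'a \<Rightarrow> 'd \<Rightarrow> 'd) \<Rightarrow> nat \<Rightarrow>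
   ('o \<times> 'a list \<Rightarrow> 'd) set monoid" where
  "cohomology_group C D T n =
     (cochain_group C D n)\<lparr>carrier := cocycles C D T n\<rparr> Mod coboundaries C D T n"

end

theory Submission
  imports Defs
begin

text \<open>
  The reason for the vanishing is that in a free theory every arrow into a single sort is built in
  exactly one way from projections and generators, while over a cartesian natural system an
  equation between elements over an arrow \<open>a\<close> into a product may be tested after composing with
  the projections. So a cochain can be prescribed by recursion along the structure of the first
  arrow of a string.

  \<^bold>\<open>Structure of free theories.\<close> An arrow \<open>f\<close> into a single sort is either a projection or of the
  form \<open>g \<cdot> t\<close> with \<open>g\<close> a generator, not both, and \<open>(g, t)\<close> is determined by \<open>f\<close>
  (\<open>arrow_cases\<close>, \<open>app_unique\<close>, \<open>app_neq_pr\<close>). This is Lambek's lemma for free theories. Formal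
  projections and formal pairs \<open>(g, t)\<close>, where \<open>t\<close> is a genuine arrow of the free theory \<open>F\<close>, form
  a theory of their own. The universal property maps \<open>F\<close> to it, and evaluation maps it back; the
  composite is the identity of \<open>F\<close>, again by the universal property. Using a pair \<open>(g, t)\<close> instead
  of a whole term keeps the theory so small that its arrows can be coded by arrows of \<open>F\<close>, which
  matters because the universal property is available for theories over one type only. A second
  use of the universal property, for the subtheory of those arrows for which the descent from
  \<open>g \<cdot> t\<close> to the components of \<open>t\<close> terminates, shows that it always does (\<open>wf_subterm_rel\<close>).

  \<^bold>\<open>Solving for a cochain.\<close> Let \<open>\<phi>\<close> be a cocycle of degree \<open>n \<ge> 2\<close>. In additive notation, subtract
  a coboundary so that \<open>\<phi>\<close> vanishes on strings whose first or second arrow is an identity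
  (\<open>normalise_cocycle\<close>). Call projections and generators basic. We look for \<open>\<psi>\<close> that vanishes on
  strings starting with a basic arrow. On a string \<open>(x, a, \<dots>)\<close> with \<open>x\<close> basic, the equation
  \<open>d \<psi> = \<phi>\<close> then reads \<open>x \<psi>(a, \<dots>) - \<psi>(x \<cdot> a, \<dots>) = \<phi>(x, a, \<dots>)\<close>, all other terms being zero. For
  a generator \<open>x\<close> it defines \<open>\<psi>\<close> on \<open>x \<cdot> a\<close> from \<open>\<psi>\<close> on \<open>a\<close>; for the projections it defines, by
  cartesianness, \<open>\<psi>\<close> on \<open>a\<close> from \<open>\<psi>\<close> on the components of \<open>a\<close>. This is a legitimate recursion
  by the first part, and normality of \<open>\<phi>\<close> makes it consistent with the requirement that \<open>\<psi>\<close>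
  vanishes on basic arrows (\<open>ex_solution_on_basic\<close>). The cocycle \<open>\<chi> = \<phi> - d \<psi>\<close> vanishes on strings
  starting with a basic arrow. Its cocycle identity gives \<open>\<chi>(x \<cdot> a, \<dots>) = x \<chi>(a, \<dots>)\<close> for basic \<open>x\<close>,
  and \<open>\<chi> = 0\<close> follows by induction along the same recursion (\<open>cocycle_eq_one_if_basic\<close>).

  For \<open>n = 1\<close> the argument breaks down because \<open>\<psi>\<close> would have no first arrow.
\<close>

section \<open>Categories and product diagrams\<close>

lemma HomsetI: "f \<in> Arr C \<Longrightarrow> Dom C f = X \<Longrightarrow> Cod C f = Y \<Longrightarrow> f \<in> Homset C X Y"
  by (simp add: Homset_def)

lemma HomsetD:
  assumes "f \<in> Homset C X Y"
  shows "f \<in> Arr C" "Dom C f = X" "Cod C f = Y"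
  using assms by (auto simp: Homset_def)

locale small_category =
  fixes C :: "('o, 'a) cat" (structure)
  assumes category: "category C"
begin

lemma dom_obj [simp]: "f \<in> Arr C \<Longrightarrow> Dom C f \<in> Obj C"
  and cod_obj [simp]: "f \<in> Arr C \<Longrightarrow> Cod C f \<in> Obj C"
  and ident_arr [simp]: "X \<in> Obj C \<Longrightarrow> Ident C X \<in> Arr C"
  and dom_ident [simp]: "X \<in> Obj C \<Longrightarrow> Dom C (Ident C X) = X"
  and cod_ident [simp]: "X \<in> Obj C \<Longrightarrow> Cod C (Ident C X) = X"
  and comp_arr [simp]: "f \<in> Arr C \<Longrightarrow> g \<in> Arr C \<Longrightarrow> Dom C g = Cod C f \<Longrightarrow> g \<cdot> f \<in> Arr C"
  and dom_comp [simp]: "f \<in> Arr C \<Longrightarrow> g \<in> Arr C \<Longrightarrow> Dom C g = Cod C f \<Longrightarrow> Dom C (g \<cdot> f) = Dom C f"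
  and cod_comp [simp]: "f \<in> Arr C \<Longrightarrow> g \<in> Arr C \<Longrightarrow> Dom C g = Cod C f \<Longrightarrow> Cod C (g \<cdot> f) = Cod C g"
  using category by (auto simp: category_def Homset_def)

lemma comp_ident [simp]: "f \<in> Arr C \<Longrightarrow> X = Dom C f \<Longrightarrow> f \<cdot> Ident C X = f"
  and ident_comp [simp]: "f \<in> Arr C \<Longrightarrow> X = Cod C f \<Longrightarrow> Ident C X \<cdot> f = f"
  and comp_assoc [simp]:
    "f \<in> Arr C \<Longrightarrow> g \<in> Arr C \<Longrightarrow> h \<in> Arr C \<Longrightarrow> Dom C g = Cod C f \<Longrightarrow> Dom C h = Cod C g \<Longrightarrow>
     (h \<cdot> g) \<cdot> f = h \<cdot> g \<cdot> f"
  using category by (auto simp: category_def)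

lemma product_diagram_along_iso:
  assumes q: "product_diagram C Q qs"
    and t: "t \<in> Homset C P Q" and t': "t' \<in> Homset C Q P"
    and inv: "t' \<cdot> t = Ident C P" "t \<cdot> t' = Ident C Q"
  shows "product_diagram C P (map (\<lambda>q. q \<cdot> t) qs)"
  unfolding product_diagram_def
proof (intro conjI ballI allI impI)
  note [simp] = HomsetD[OF t] HomsetD[OF t']
  have qa: "q \<in> Arr C \<and> Dom C q = Q" if "q \<in> set qs" for q
    using q that by (auto simp: product_diagram_def)
  show "P \<in> Obj C"
    using dom_obj[of t] by simp
  show "p \<in> Arr C" "Dom C p = P" if "p \<in> set (map (\<lambda>q. q \<cdot> t) qs)" for p
    using that qa by auto
  fix X fs
  assume X: "X \<in> Obj C" and len: "length fs = length (map (\<lambda>q. q \<cdot> t) qs)"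
    and fs: "\<forall>k<length (map (\<lambda>q. q \<cdot> t) qs). fs ! k \<in> Homset C X (Cod C (map (\<lambda>q. q \<cdot> t) qs ! k))"
  have "\<forall>k<length qs. fs ! k \<in> Homset C X (Cod C (qs ! k))"
    using fs qa by auto
  then have ex: "\<exists>!h. h \<in> Homset C X Q \<and> (\<forall>k<length qs. qs ! k \<cdot> h = fs ! k)"
    using q X len by (auto simp: product_diagram_def)
  then obtain h where h: "h \<in> Homset C X Q" "\<forall>k<length qs. qs ! k \<cdot> h = fs ! k"
    by blast
  note [simp] = HomsetD[OF h(1)]
  show "\<exists>!h. h \<in> Homset C X P \<and>
    (\<forall>k<length (map (\<lambda>q. q \<cdot> t) qs). map (\<lambda>q. q \<cdot> t) qs ! k \<cdot> h = fs ! k)"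
  proof (rule ex1I[of _ "t' \<cdot> h"])
    have "t \<cdot> t' \<cdot> h = h"
      using comp_assoc[of h t' t] inv by simp
    then show "t' \<cdot> h \<in> Homset C X P \<and>
      (\<forall>k<length (map (\<lambda>q. q \<cdot> t) qs). map (\<lambda>q. q \<cdot> t) qs ! k \<cdot> t' \<cdot> h = fs ! k)"
      using h qa by (auto intro!: HomsetI)
    fix g
    assume g: "g \<in> Homset C X P \<and>
      (\<forall>k<length (map (\<lambda>q. q \<cdot> t) qs). map (\<lambda>q. q \<cdot> t) qs ! k \<cdot> g = fs ! k)"
    then have [simp]: "g \<in> Arr C" "Dom C g = X" "Cod C g = P"
      by (auto dest: HomsetD)
    have "t \<cdot> g \<in> Homset C X Q \<and> (\<forall>k<length qs. qs ! k \<cdot> t \<cdot> g = fs ! k)"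
      using g qa by (auto intro!: HomsetI)
    then have "t \<cdot> g = h"
      using ex h by blast
    then show "g = t' \<cdot> h"
      using comp_assoc[of g t t'] inv by auto
  qed
qed

lemma product_diagram_iso:
  assumes p: "product_diagram C P ps" and q: "product_diagram C Q qs"
    and cod: "map (Cod C) ps = map (Cod C) qs"
  obtains t t' where "t \<in> Homset C P Q" "t' \<in> Homset C Q P"
    "t' \<cdot> t = Ident C P" "t \<cdot> t' = Ident C Q" "ps = map (\<lambda>q. q \<cdot> t) qs"
proof -
  have len: "length ps = length qs"
    using cod map_eq_imp_length_eq by blast
  have codk: "Cod C (ps ! k) = Cod C (qs ! k)" if "k < length qs" for k
    using that len cod by (metis nth_map)
  have pa: "ps ! k \<in> Arr C" "Dom C (ps ! k) = P" if "k < length qs" for k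
    using p that len by (auto simp: product_diagram_def)
  have qa: "qs ! k \<in> Arr C" "Dom C (qs ! k) = Q" if "k < length qs" for k
    using q that len by (auto simp: product_diagram_def)
  have PQ [simp]: "P \<in> Obj C" "Q \<in> Obj C"
    using p q by (auto simp: product_diagram_def)
  have pu: "\<exists>!h. h \<in> Homset C X P \<and> (\<forall>k<length qs. ps ! k \<cdot> h = fs ! k)"
    if "X \<in> Obj C" "length fs = length qs" "\<forall>k<length qs. fs ! k \<in> Homset C X (Cod C (qs ! k))"
    for X fs using p that len codk by (auto simp: product_diagram_def)
  have qu: "\<exists>!h. h \<in> Homset C X Q \<and> (\<forall>k<length qs. qs ! k \<cdot> h = fs ! k)"
    if "X \<in> Obj C" "length fs = length qs" "\<forall>k<length qs. fs ! k \<in> Homset C X (Cod C (qs ! k))"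
    for X fs using q that by (auto simp: product_diagram_def)
  have psH: "\<forall>k<length qs. ps ! k \<in> Homset C P (Cod C (qs ! k))"
    and qsH: "\<forall>k<length qs. qs ! k \<in> Homset C Q (Cod C (qs ! k))"
    using pa qa codk by (auto intro!: HomsetI)
  obtain t where t: "t \<in> Homset C P Q" "\<forall>k<length qs. qs ! k \<cdot> t = ps ! k"
    using qu[OF PQ(1) len psH] by blast
  obtain t' where t': "t' \<in> Homset C Q P" "\<forall>k<length qs. ps ! k \<cdot> t' = qs ! k"
    using pu[OF PQ(2) refl qsH] by blast
  note [simp] = HomsetD[OF t(1)] HomsetD[OF t'(1)]
  have "t' \<cdot> t \<in> Homset C P P \<and> (\<forall>k<length qs. ps ! k \<cdot> t' \<cdot> t = ps ! k)"
  proof (intro conjI allI impI HomsetI; simp?)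
    fix k assume k: "k < length qs"
    then show "ps ! k \<cdot> t' \<cdot> t = ps ! k"
      using comp_assoc[of t t' "ps ! k"] pa[OF k] t t' by simp
  qed
  moreover have "Ident C P \<in> Homset C P P \<and> (\<forall>k<length qs. ps ! k \<cdot> Ident C P = ps ! k)"
    using pa by (auto intro!: HomsetI)
  ultimately have i1: "t' \<cdot> t = Ident C P"
    using pu[OF PQ(1) len psH] by blast
  have "t \<cdot> t' \<in> Homset C Q Q \<and> (\<forall>k<length qs. qs ! k \<cdot> t \<cdot> t' = qs ! k)"
  proof (intro conjI allI impI HomsetI; simp?)
    fix k assume k: "k < length qs"
    then show "qs ! k \<cdot> t \<cdot> t' = qs ! k"
      using comp_assoc[of t' t "qs ! k"] qa[OF k] t t' by simp
  qed
  moreover have "Ident C Q \<in> Homset C Q Q \<and> (\<forall>k<length qs. qs ! k \<cdot> Ident C Q = qs ! k)"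
    using qa by (auto intro!: HomsetI)
  ultimately have i2: "t \<cdot> t' = Ident C Q"
    using qu[OF PQ(2) refl qsH] by blast
  have "ps = map (\<lambda>q. q \<cdot> t) qs"
    using t(2) len by (auto intro!: nth_equalityI)
  then show ?thesis
    using that t t' i1 i2 by blast
qed

end

lemma cat_functorD:
  assumes "cat_functor C D Fo Fa"
  shows "f \<in> Arr C \<Longrightarrow> Fa f \<in> Arr D"
    and "f \<in> Arr C \<Longrightarrow> Dom D (Fa f) = Fo (Dom C f)"
    and "f \<in> Arr C \<Longrightarrow> Cod D (Fa f) = Fo (Cod C f)"
    and "X \<in> Obj C \<Longrightarrow> Fa (Ident C X) = Ident D (Fo X)"
    and "f \<in> Arr C \<Longrightarrow> g \<in> Arr C \<Longrightarrow> Dom C g = Cod C f \<Longrightarrow>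
      Fa (g \<cdot>\<^bsub>C\<^esub> f) = Fa g \<cdot>\<^bsub>D\<^esub> Fa f"
  using assms by (auto simp: cat_functor_def Homset_def)

section \<open>Sorted theories\<close>

text \<open>The sequences of sorts are objects here, so membership in \<open>lists I\<close> is kept folded.\<close>

declare in_listsD [rule del] in_listsI [rule del]

lemma nth_in_lists [simp]: "w \<in> lists I \<Longrightarrow> k < length w \<Longrightarrow> w ! k \<in> I"
  by (simp add: in_lists_conv_set)

lemma Fam_simps [simp]:
  "Obj (Fam I) = lists I"
  "Arr (Fam I) = {(v, f, w). v \<in> lists I \<and> w \<in> lists I \<and> length f = length v \<and>
      (\<forall>k<length v. f ! k < length w \<and> w ! (f ! k) = v ! k)}"
  "Dom (Fam I) (v, f, w) = w"
  "Cod (Fam I) (v, f, w) = v"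
  "Ident (Fam I) v = (v, [0..<length v], v)"
  "(v, f, w) \<cdot>\<^bsub>Fam I\<^esub> (w', g, u) = (v, map (\<lambda>k. g ! k) f, u)"
  by (simp_all add: Fam_def op_cat_def finsets_over_def)

text \<open>
  The projection from \<open>w\<close> to its \<open>k\<close>-th factor. As \<open>Fam I\<close> is an opposite category, it is given by
  the map from a one-element set that picks \<open>k\<close>.
\<close>

definition Fam_proj :: "'i list \<Rightarrow> nat \<Rightarrow> 'i list \<times> nat list \<times> 'i list" where
  "Fam_proj w k = ([w ! k], [k], w)"

lemma Fam_proj_arr:
  "w \<in> lists I \<Longrightarrow> k < length w \<Longrightarrow> Fam_proj w k \<in> Arr (Fam I)"
  "Dom (Fam I) (Fam_proj w k) = w"
  "Cod (Fam I) (Fam_proj w k) = [w ! k]"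
  by (auto simp: Fam_proj_def)

lemma category_Fam: "category (Fam I)"
  unfolding category_def
  by (auto simp: Homset_def intro!: nth_equalityI simp: in_set_conv_nth)

lemma Fam_product:
  assumes w: "w \<in> lists I"
  shows "product_diagram (Fam I) w (map (Fam_proj w) [0..<length w])"
  unfolding product_diagram_def
proof (intro conjI ballI allI impI)
  show "w \<in> Obj (Fam I)"
    using w by simp
  show "p \<in> Arr (Fam I)" "Dom (Fam I) p = w"
    if "p \<in> set (map (Fam_proj w) [0..<length w])" for p
    using that w Fam_proj_arr(1)[OF w] Fam_proj_arr(2) by (auto simp del: Fam_simps)
  fix X fs
  let ?ps = "map (Fam_proj w) [0..<length w]"
  assume "X \<in> Obj (Fam I)" "length fs = length ?ps"
    and "\<forall>k<length ?ps. fs ! k \<in> Homset (Fam I) X (Cod (Fam I) (?ps ! k))"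
  then have len: "length fs = length w" and X: "X \<in> lists I"
    and fsH: "\<forall>k<length w. fs ! k \<in> Homset (Fam I) X [w ! k]"
    by (auto simp: Fam_proj_def)
  have fs: "\<exists>l<length X. fs ! k = ([w ! k], [l], X) \<and> X ! l = w ! k" if k: "k < length w" for k
  proof -
    obtain u f x where e: "fs ! k = (u, f, x)"
      by (metis prod_cases3)
    have "(u, f, x) \<in> Homset (Fam I) X [w ! k]"
      using fsH k e by auto
    then have "u = [w ! k]" "x = X" "length f = 1" "f ! 0 < length X" "X ! (f ! 0) = w ! k"
      by (auto simp: Homset_def)
    then show ?thesis
      using e by (auto simp: length_Suc_conv)
  qed
  define l where "l k = (SOME l. l < length X \<and> fs ! k = ([w ! k], [l], X) \<and> X ! l = w ! k)" for k
  have l: "l k < length X \<and> fs ! k = ([w ! k], [l k], X) \<and> X ! l k = w ! k" if "k < length w" for k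
    unfolding l_def using someI_ex[OF fs[OF that]] by blast
  show "\<exists>!h. h \<in> Homset (Fam I) X w \<and> (\<forall>k<length ?ps. ?ps ! k \<cdot>\<^bsub>Fam I\<^esub> h = fs ! k)"
  proof (rule ex1I[of _ "(w, map l [0..<length w], X)"])
    show "(w, map l [0..<length w], X) \<in> Homset (Fam I) X w \<and>
      (\<forall>k<length ?ps. ?ps ! k \<cdot>\<^bsub>Fam I\<^esub> (w, map l [0..<length w], X) = fs ! k)"
      using l X w by (auto simp: Homset_def Fam_proj_def)
    fix h
    assume h: "h \<in> Homset (Fam I) X w \<and> (\<forall>k<length ?ps. ?ps ! k \<cdot>\<^bsub>Fam I\<^esub> h = fs ! k)"
    obtain u f x where e: "h = (u, f, x)"
      by (metis prod_cases3)
    have e2: "h = (w, f, X)" "length f = length w"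
      using h unfolding e by (auto simp: Homset_def)
    have "f ! k = l k" if k: "k < length w" for k
    proof -
      have "?ps ! k \<cdot>\<^bsub>Fam I\<^esub> h = fs ! k"
        using h k by simp
      then show ?thesis
        using l[OF k] k e2 by (simp add: Fam_proj_def)
    qed
    then show "h = (w, map l [0..<length w], X)"
      using e2 by (auto intro!: nth_equalityI)
  qed
qed

text \<open>
  The product of the objects in the list \<open>Xs\<close> is their concatenation; the \<open>j\<close>-th projection
  selects the \<open>j\<close>-th block of indices.
\<close>

definition block_start :: "'i list list \<Rightarrow> nat \<Rightarrow> nat" where
  "block_start Xs j = length (concat (take j Xs))"

definition block_proj :: "'i list list \<Rightarrow> nat \<Rightarrow> 'i list \<times> nat list \<times> 'i list" where
  "block_proj Xs j =
     (Xs ! j, [block_start Xs j..<block_start Xs j + length (Xs ! j)], concat Xs)"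

lemma concat_block:
  assumes "j < length Xs" "l < length (Xs ! j)"
  shows "block_start Xs j + l < length (concat Xs)"
    and "concat Xs ! (block_start Xs j + l) = Xs ! j ! l"
proof -
  have "concat Xs = concat (take j Xs) @ Xs ! j @ concat (drop (Suc j) Xs)"
    by (metis concat.simps(2) concat_append id_take_nth_drop assms(1))
  then show "block_start Xs j + l < length (concat Xs)"
    and "concat Xs ! (block_start Xs j + l) = Xs ! j ! l"
    using assms(2) by (simp_all add: block_start_def nth_append)
qed

lemma concat_index_cases:
  assumes "k < length (concat Xs)"
  obtains j l where "j < length Xs" "l < length (Xs ! j)" "k = block_start Xs j + l"
proof -
  have "\<exists>j l. j < length Xs \<and> l < length (Xs ! j) \<and> k = block_start Xs j + l"
    using assms
  proof (induction Xs arbitrary: k)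
    case (Cons X Xs)
    show ?case
    proof (cases "k < length X")
      case True
      then show ?thesis
        by (intro exI[of _ 0] exI[of _ k]) (simp add: block_start_def)
    next
      case False
      then have "k - length X < length (concat Xs)"
        using Cons.prems by simp
      then obtain j l where "j < length Xs" "l < length (Xs ! j)"
        "k - length X = block_start Xs j + l"
        using Cons.IH by blast
      then show ?thesis
        using False by (intro exI[of _ "Suc j"] exI[of _ l]) (simp add: block_start_def)
    qed
  qed simp
  then show ?thesis
    using that by blast
qed

lemma block_start_cong:
  assumes "map length Xs = map length Ys"
  shows "block_start Xs j = block_start Ys j"
  using assms by (simp add: block_start_def length_concat flip: take_map)

lemma block_proj_arr:
  assumes "Xs \<in> lists (lists I)" "j < length Xs"
  shows "block_proj Xs j \<in> Arr (Fam I)"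
    and "Dom (Fam I) (block_proj Xs j) = concat Xs" "Cod (Fam I) (block_proj Xs j) = Xs ! j"
proof -
  have "Xs ! j \<in> lists I"
    using assms by simp
  moreover have "concat Xs \<in> lists I"
    using assms by (auto simp: in_lists_conv_set)
  ultimately show "block_proj Xs j \<in> Arr (Fam I)"
    using concat_block[OF assms(2)] by (simp add: block_proj_def)
qed (simp_all add: block_proj_def)

text \<open>
  A working form of \<open>sorted_theory\<close>: instead of preservation of all product diagrams, only those
  that exhibit \<open>w\<close> as the product of its single sorts are required. The two notions agree, see
  \<open>sorted_theory\<close> and \<open>sorted_category_if_sorted_theory\<close> below; this one is far easier to
  establish for the theories constructed later.
\<close>

locale sorted_category = small_category A
  for A :: "('i list, 'a) cat" (structure) +
  fixes I :: "'i set" and K :: "'i list \<times> nat list \<times> 'i list \<Rightarrow> 'a"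
  assumes Obj [simp]: "Obj A = lists I"
    and K_functor: "cat_functor (Fam I) A (\<lambda>v. v) K"
    and K_product: "w \<in> lists I \<Longrightarrow> product_diagram A w (map (K \<circ> Fam_proj w) [0..<length w])"
begin

lemma dom_in_lists [simp]: "f \<in> Arr A \<Longrightarrow> Dom A f \<in> lists I"
  and cod_in_lists [simp]: "f \<in> Arr A \<Longrightarrow> Cod A f \<in> lists I"
  using dom_obj[of f] cod_obj[of f] by simp_all

definition pr :: "'i list \<Rightarrow> nat \<Rightarrow> 'a" where
  "pr w k = K (Fam_proj w k)"

lemma pr [simp]:
  assumes "w \<in> lists I" "k < length w"
  shows "pr w k \<in> Arr A" "Dom A (pr w k) = w" "Cod A (pr w k) = [w ! k]"
  unfolding pr_def
  using cat_functorD(1-3)[OF K_functor Fam_proj_arr(1)[OF assms]] Fam_proj_arr(2,3) by metis+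

lemma pr_product: "w \<in> lists I \<Longrightarrow> product_diagram A w (map (pr w) [0..<length w])"
  using K_product[of w] by (simp add: pr_def[abs_def] comp_def)

lemma tuple_ex1:
  assumes "X \<in> lists I" "w \<in> lists I" "\<And>k. k < length w \<Longrightarrow> fs k \<in> Homset A X [w ! k]"
  shows "\<exists>!h. h \<in> Homset A X w \<and> (\<forall>k<length w. pr w k \<cdot> h = fs k)"
proof -
  have *: "\<exists>!h. h \<in> Homset A X w \<and> (\<forall>k<length (map (pr w) [0..<length w]).
      map (pr w) [0..<length w] ! k \<cdot> h = map fs [0..<length w] ! k)"
    using pr_product[OF assms(2)] assms
    unfolding product_diagram_def
    by (elim conjE, drule_tac x = X in bspec, simp, drule_tac x = "map fs [0..<length w]" in spec)
       simp
  then show ?thesis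
    by simp
qed

definition tuple :: "'i list \<Rightarrow> 'i list \<Rightarrow> (nat \<Rightarrow> 'a) \<Rightarrow> 'a" where
  "tuple X w fs = (THE h. h \<in> Homset A X w \<and> (\<forall>k<length w. pr w k \<cdot> h = fs k))"

lemma tuple:
  assumes "X \<in> lists I" "w \<in> lists I" "\<And>k. k < length w \<Longrightarrow> fs k \<in> Homset A X [w ! k]"
  shows "tuple X w fs \<in> Homset A X w" "k < length w \<Longrightarrow> pr w k \<cdot> tuple X w fs = fs k"
  using theI'[OF tuple_ex1[of X w fs, OF assms]] by (auto simp: tuple_def)

lemma arr_eqI:
  assumes f: "f \<in> Homset A X w" and g: "g \<in> Homset A X w"
    and eq: "\<And>k. k < length w \<Longrightarrow> pr w k \<cdot> f = pr w k \<cdot> g"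
  shows "f = g"
proof -
  note [simp] = HomsetD[OF f] HomsetD[OF g]
  have X: "X \<in> lists I" and w: "w \<in> lists I"
    using dom_obj[of f] cod_obj[of f] by simp_all
  have "\<And>k. k < length w \<Longrightarrow> pr w k \<cdot> f \<in> Homset A X [w ! k]"
    using w by (auto intro!: HomsetI)
  from tuple_ex1[OF X w this] show ?thesis
    using f g eq by metis
qed

lemma pr_K:
  assumes "(v, f, w) \<in> Arr (Fam I)" "k < length v"
  shows "pr v k \<cdot> K (v, f, w) = pr w (f ! k)"
proof -
  have "K (Fam_proj v k \<cdot>\<^bsub>Fam I\<^esub> (v, f, w)) = K (Fam_proj v k) \<cdot> K (v, f, w)"
    using assms by (intro cat_functorD(5)[OF K_functor]) (auto simp: Fam_proj_def)
  then show ?thesis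
    using assms by (simp add: pr_def Fam_proj_def)
qed

lemma pr_single: "i \<in> I \<Longrightarrow> pr [i] 0 = Ident A [i]"
  using cat_functorD(4)[OF K_functor, of "[i]"] by (simp add: pr_def Fam_proj_def)

text \<open>
  Arrows into the concatenation and families of arrows into the blocks have the same components
  at the single sorts; only the indexing differs.
\<close>

lemma block_product:
  assumes Xs: "Xs \<in> lists (lists I)"
  shows "product_diagram A (concat Xs) (map (K \<circ> block_proj Xs) [0..<length Xs])"
  unfolding product_diagram_def
proof (intro conjI ballI allI impI)
  let ?qs = "map (K \<circ> block_proj Xs) [0..<length Xs]"
  have c: "concat Xs \<in> lists I"
    using Xs by (auto simp: in_lists_conv_set)
  then show "concat Xs \<in> Obj A"
    by simp
  have qH: "K (block_proj Xs j) \<in> Homset A (concat Xs) (Xs ! j)" if "j < length Xs" for j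
    using cat_functorD(1-3)[OF K_functor block_proj_arr(1)[OF Xs that]] block_proj_arr[OF Xs that]
    by (auto intro: HomsetI)
  show "q \<in> Arr A" "Dom A q = concat Xs" if "q \<in> set ?qs" for q
    using that HomsetD[OF qH] by auto
  have Xj: "Xs ! j \<in> lists I" if "j < length Xs" for j
    using Xs that by simp
  have pq: "pr (Xs ! j) l \<cdot> K (block_proj Xs j) = pr (concat Xs) (block_start Xs j + l)"
    if "j < length Xs" "l < length (Xs ! j)" for j l
    using pr_K[of "Xs ! j" _ "concat Xs" l] block_proj_arr(1)[OF Xs that(1)] that
    by (simp add: block_proj_def)
  fix X fs
  assume "X \<in> Obj A" "length fs = length ?qs"
    and "\<forall>j<length ?qs. fs ! j \<in> Homset A X (Cod A (?qs ! j))"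
  then have X: "X \<in> lists I" and len: "length fs = length Xs"
    and fs: "\<And>j. j < length Xs \<Longrightarrow> fs ! j \<in> Homset A X (Xs ! j)"
    using HomsetD(3)[OF qH] by auto
  define gs where
    "gs = map (\<lambda>j. map (\<lambda>l. pr (Xs ! j) l \<cdot> fs ! j) [0..<length (Xs ! j)]) [0..<length Xs]"
  have ml: "map length gs = map length Xs"
    by (rule nth_equalityI) (auto simp: gs_def)
  have gs: "concat gs ! (block_start Xs j + l) = pr (Xs ! j) l \<cdot> fs ! j"
    if "j < length Xs" "l < length (Xs ! j)" for j l
    using concat_block(2)[of j gs l] that block_start_cong[OF ml, of j] by (simp add: gs_def)
  have "concat gs ! k \<in> Homset A X [concat Xs ! k]" if "k < length (concat Xs)" for k
  proof -
    obtain j l where jl: "j < length Xs" "l < length (Xs ! j)" "k = block_start Xs j + l"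
      using \<open>k < length (concat Xs)\<close> by (rule concat_index_cases)
    then show ?thesis
      using gs[OF jl(1,2)] concat_block(2)[OF jl(1,2)] HomsetD[OF fs[OF jl(1)]] Xj[OF jl(1)]
      by (auto intro!: HomsetI)
  qed
  then have h: "tuple X (concat Xs) (\<lambda>k. concat gs ! k) \<in> Homset A X (concat Xs)"
    "\<And>k. k < length (concat Xs) \<Longrightarrow>
      pr (concat Xs) k \<cdot> tuple X (concat Xs) (\<lambda>k. concat gs ! k) = concat gs ! k"
    using tuple[OF X c, of "\<lambda>k. concat gs ! k"] by blast+
  show "\<exists>!h. h \<in> Homset A X (concat Xs) \<and> (\<forall>j<length ?qs. ?qs ! j \<cdot> h = fs ! j)"
  proof (rule ex1I[of _ "tuple X (concat Xs) (\<lambda>k. concat gs ! k)"], intro conjI allI impI)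
    let ?h = "tuple X (concat Xs) (\<lambda>k. concat gs ! k)"
    show hH: "?h \<in> Homset A X (concat Xs)"
      by (rule h)
    fix j assume "j < length ?qs"
    then have j: "j < length Xs"
      by simp
    note [simp] = HomsetD[OF hH] HomsetD[OF qH[OF j]] HomsetD[OF fs[OF j]]
    have "K (block_proj Xs j) \<cdot> ?h = fs ! j"
    proof (rule arr_eqI[OF _ fs[OF j]])
      show "K (block_proj Xs j) \<cdot> ?h \<in> Homset A X (Xs ! j)"
        by (auto intro!: HomsetI)
      fix l assume l: "l < length (Xs ! j)"
      have "pr (Xs ! j) l \<cdot> K (block_proj Xs j) \<cdot> ?h = (pr (Xs ! j) l \<cdot> K (block_proj Xs j)) \<cdot> ?h"
        using l Xj[OF j] by simp
      then show "pr (Xs ! j) l \<cdot> K (block_proj Xs j) \<cdot> ?h = pr (Xs ! j) l \<cdot> fs ! j"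
        using pq[OF j l] h(2)[OF concat_block(1)[OF j l]] gs[OF j l] by simp
    qed
    then show "?qs ! j \<cdot> ?h = fs ! j"
      using j by simp
  next
    fix g assume g: "g \<in> Homset A X (concat Xs) \<and> (\<forall>j<length ?qs. ?qs ! j \<cdot> g = fs ! j)"
    then have gj: "K (block_proj Xs j) \<cdot> g = fs ! j" if "j < length Xs" for j
      using that by auto
    have gH: "g \<in> Homset A X (concat Xs)"
      using g by blast
    note [simp] = HomsetD[OF gH]
    show "g = tuple X (concat Xs) (\<lambda>k. concat gs ! k)"
    proof (rule arr_eqI[OF gH h(1)])
      fix k assume k: "k < length (concat Xs)"
      then obtain j l where jl: "j < length Xs" "l < length (Xs ! j)" "k = block_start Xs j + l"
        by (rule concat_index_cases)
      have "pr (concat Xs) k \<cdot> g = (pr (Xs ! j) l \<cdot> K (block_proj Xs j)) \<cdot> g"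
        using pq[OF jl(1,2)] jl(3) by simp
      also have "\<dots> = pr (Xs ! j) l \<cdot> K (block_proj Xs j) \<cdot> g"
        using HomsetD[OF qH[OF jl(1)]] Xj[OF jl(1)] jl(2) by simp
      finally show "pr (concat Xs) k \<cdot> g =
          pr (concat Xs) k \<cdot> tuple X (concat Xs) (\<lambda>k. concat gs ! k)"
        using gj[OF jl(1)] gs[OF jl(1,2)] h(2)[OF k] jl(3) by simp
    qed
  qed
qed

end

text \<open>
  \<open>Fam I\<close> is the initial sorted theory. As an instance of the locale it lets structure maps be
  treated as functors between two such categories.
\<close>

lemma sorted_category_Fam: "sorted_category (Fam I) I (\<lambda>u. u)"
proof
  show "category (Fam I)"
    by (rule category_Fam)
  show "cat_functor (Fam I) (Fam I) (\<lambda>v. v) (\<lambda>u. u)"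
    by (auto simp: cat_functor_def Homset_def)
  show "product_diagram (Fam I) w (map ((\<lambda>u. u) \<circ> Fam_proj w) [0..<length w])"
    if "w \<in> lists I" for w
    using Fam_product[OF that] by (simp add: comp_def)
qed simp

text \<open>
  Any product diagram in the source is isomorphic to one whose projections come from
  \<open>Fam I\<close>, and a functor under \<open>Fam I\<close> preserves the latter.
\<close>

lemma theory_morphism_under_Fam:
  assumes A: "sorted_category A I J" and B: "sorted_category B I K"
    and H: "cat_functor A B (\<lambda>v. v) H"
    and HJ: "\<And>u. u \<in> Arr (Fam I) \<Longrightarrow> H (J u) = K u"
  shows "theory_morphism A B (\<lambda>v. v) H"
  unfolding theory_morphism_def
proof (intro conjI allI impI H)
  interpret A: sorted_category A I J by (rule A)
  interpret B: sorted_category B I K by (rule B)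
  fix P ps assume p: "product_diagram A P ps"
  define Xs where "Xs = map (Cod A) ps"
  have pa: "p \<in> Arr A" if "p \<in> set ps" for p
    using p that by (auto simp: product_diagram_def)
  then have "\<And>p. p \<in> set ps \<Longrightarrow> Cod A p \<in> lists I"
    using A.cod_obj A.Obj by blast
  then have Xs: "Xs \<in> lists (lists I)"
    by (auto simp: Xs_def in_lists_conv_set)
  define qs where "qs = map (J \<circ> block_proj Xs) [0..<length Xs]"
  have q: "product_diagram A (concat Xs) qs"
    unfolding qs_def by (rule A.block_product[OF Xs])
  have Hq: "map H qs = map (K \<circ> block_proj Xs) [0..<length Xs]"
    using HJ block_proj_arr(1)[OF Xs] by (auto simp: qs_def)
  have "map (Cod A) qs = Xs"
    using block_proj_arr[OF Xs] cat_functorD(3)[OF A.K_functor]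
    by (intro nth_equalityI) (auto simp: qs_def)
  then have "map (Cod A) ps = map (Cod A) qs"
    by (simp add: Xs_def)
  then obtain t t' where t: "t \<in> Homset A P (concat Xs)" "t' \<in> Homset A (concat Xs) P"
    "t' \<cdot>\<^bsub>A\<^esub> t = Ident A P" "t \<cdot>\<^bsub>A\<^esub> t' = Ident A (concat Xs)" "ps = map (\<lambda>q. q \<cdot>\<^bsub>A\<^esub> t) qs"
    using A.product_diagram_iso[OF p q] by metis
  note tD = HomsetD[OF t(1)] HomsetD[OF t(2)]
  have PO: "P \<in> Obj A" "concat Xs \<in> Obj A"
    using tD A.dom_obj A.cod_obj by metis+
  note HD = cat_functorD[OF H]
  have "product_diagram B P (map (\<lambda>q. q \<cdot>\<^bsub>B\<^esub> H t) (map H qs))"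
  proof (rule B.product_diagram_along_iso)
    show "product_diagram B (concat Xs) (map H qs)"
      unfolding Hq by (rule B.block_product[OF Xs])
    show "H t \<in> Homset B P (concat Xs)" "H t' \<in> Homset B (concat Xs) P"
      using HD(1-3) tD by (auto intro!: HomsetI)
    show "H t' \<cdot>\<^bsub>B\<^esub> H t = Ident B P" "H t \<cdot>\<^bsub>B\<^esub> H t' = Ident B (concat Xs)"
      using HD(4)[OF PO(1)] HD(4)[OF PO(2)] HD(5)[of t t'] HD(5)[of t' t] t tD by simp_all
  qed
  moreover have "map (\<lambda>q. q \<cdot>\<^bsub>B\<^esub> H t) (map H qs) = map H ps"
  proof -
    have "H (q \<cdot>\<^bsub>A\<^esub> t) = H q \<cdot>\<^bsub>B\<^esub> H t" if "q \<in> set qs" for q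
      using q that tD by (intro HD(5)) (auto simp: product_diagram_def)
    then show ?thesis
      by (simp add: t(5))
  qed
  ultimately show "product_diagram B P (map H ps)"
    by simp
qed

lemma (in sorted_category) sorted_theory: "sorted_theory I A K"
  unfolding sorted_theory_def fp_theory_def
proof (intro conjI ballI)
  show "category A"
    by (rule category)
  show "Obj A = Obj (Fam I)"
    by simp
  show "theory_morphism (Fam I) A (\<lambda>v. v) K"
    by (rule theory_morphism_under_Fam[OF sorted_category_Fam sorted_category_axioms K_functor])
       simp
  fix Xs assume Xs: "Xs \<in> lists (Obj A)"
  then have Xs': "Xs \<in> lists (lists I)"
    by simp
  have "map (Cod A) (map (K \<circ> block_proj Xs) [0..<length Xs]) = Xs"
    using block_proj_arr[OF Xs'] cat_functorD(3)[OF K_functor]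
    by (intro nth_equalityI) auto
  then show "\<exists>P ps. product_diagram A P ps \<and> map (Cod A) ps = Xs"
    using block_product[OF Xs'] by blast
qed

lemma sorted_category_if_sorted_theory:
  assumes "sorted_theory I A K"
  shows "sorted_category A I K"
proof
  show "category A" "Obj A = lists I" and "cat_functor (Fam I) A (\<lambda>v. v) K"
    using assms by (auto simp: sorted_theory_def fp_theory_def theory_morphism_def)
  show "product_diagram A w (map (K \<circ> Fam_proj w) [0..<length w])" if "w \<in> lists I" for w
    using assms Fam_product[OF that]
    by (auto simp: sorted_theory_def theory_morphism_def simp flip: map_map)
qed

\<comment> \<open>From here on, arrows of \<open>Fam I\<close> are no longer taken apart by default.\<close>
declare Fam_simps(2) [simp del]

section \<open>Free theories\<close>

text \<open>
  The universal property of a free theory only speaks of theories with arrows in one fixed type.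
  Renaming along an injective map \<open>c\<close> brings the theories constructed below into that type.
\<close>

definition rename_arrows :: "('b \<Rightarrow> 'a) \<Rightarrow> ('o, 'b) cat \<Rightarrow> ('o, 'a) cat" where
  "rename_arrows c B = (let r = inv_into (Arr B) c in
     \<lparr>Obj = Obj B, Arr = c ` Arr B, Dom = (\<lambda>x. Dom B (r x)), Cod = (\<lambda>x. Cod B (r x)),
      Ident = (\<lambda>X. c (Ident B X)), Comp = (\<lambda>y x. c (r y \<cdot>\<^bsub>B\<^esub> r x))\<rparr>)"

context
  fixes c :: "'b \<Rightarrow> 'a" and B :: "('i list, 'b) cat" and I and K
  assumes inj: "inj_on c (Arr B)" and B: "sorted_category B I K"
begin

interpretation B: sorted_category B I K
  by (rule B)

lemma rename_simps:
  "Obj (rename_arrows c B) = lists I"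
  "Arr (rename_arrows c B) = c ` Arr B"
  "Ident (rename_arrows c B) X = c (Ident B X)"
  "f \<in> Arr B \<Longrightarrow> Dom (rename_arrows c B) (c f) = Dom B f"
  "f \<in> Arr B \<Longrightarrow> Cod (rename_arrows c B) (c f) = Cod B f"
  "f \<in> Arr B \<Longrightarrow> g \<in> Arr B \<Longrightarrow> c g \<cdot>\<^bsub>rename_arrows c B\<^esub> c f = c (g \<cdot>\<^bsub>B\<^esub> f)"
  using inj by (simp_all add: rename_arrows_def Let_def)

lemma rename_Homset:
  "y \<in> Homset (rename_arrows c B) X Y \<longleftrightarrow> (\<exists>f\<in>Homset B X Y. y = c f)"
  by (auto simp: Homset_def rename_simps)

lemma sorted_category_rename_arrows: "sorted_category (rename_arrows c B) I (c \<circ> K)"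
proof
  show "category (rename_arrows c B)"
    unfolding category_def
    by (auto simp: rename_simps Homset_def)
  show "Obj (rename_arrows c B) = lists I"
    by (rule rename_simps)
  show "cat_functor (Fam I) (rename_arrows c B) (\<lambda>v. v) (c \<circ> K)"
    using B.K_functor unfolding cat_functor_def
    by (auto simp: rename_simps Homset_def)
  fix w assume w: "w \<in> lists I"
  show "product_diagram (rename_arrows c B) w (map (c \<circ> K \<circ> Fam_proj w) [0..<length w])"
    unfolding product_diagram_def
  proof (intro conjI ballI allI impI)
    let ?ps = "map (c \<circ> K \<circ> Fam_proj w) [0..<length w]"
    have ps: "?ps ! k = c (B.pr w k)" if "k < length w" for k
      using that by (simp add: B.pr_def)
    show "w \<in> Obj (rename_arrows c B)"
      using w by (simp add: rename_simps)
    show "p \<in> Arr (rename_arrows c B)" "Dom (rename_arrows c B) p = w" if "p \<in> set ?ps" for p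
    proof -
      obtain k where "k < length w" "p = c (B.pr w k)"
        using \<open>p \<in> set ?ps\<close> by (auto simp: B.pr_def)
      then show "p \<in> Arr (rename_arrows c B)" "Dom (rename_arrows c B) p = w"
        using w by (simp_all add: rename_simps)
    qed
    fix X fs
    assume "X \<in> Obj (rename_arrows c B)" "length fs = length ?ps" and
      fs: "\<forall>k<length ?ps. fs ! k \<in> Homset (rename_arrows c B) X (Cod (rename_arrows c B) (?ps ! k))"
    then have X: "X \<in> lists I" and len: "length fs = length w"
      by (simp_all add: rename_simps)
    have "\<forall>k<length w. \<exists>f\<in>Homset B X [w ! k]. fs ! k = c f"
    proof (intro allI impI)
      fix k assume k: "k < length w"
      show "\<exists>f\<in>Homset B X [w ! k]. fs ! k = c f"
        using fs[rule_format, of k] k w unfolding rename_Homset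
        by (simp add: rename_simps flip: B.pr_def)
    qed
    then obtain gs where gs: "\<And>k. k < length w \<Longrightarrow> gs k \<in> Homset B X [w ! k] \<and> fs ! k = c (gs k)"
      by metis
    have ex: "\<exists>!h. h \<in> Homset B X w \<and> (\<forall>k<length w. B.pr w k \<cdot>\<^bsub>B\<^esub> h = gs k)"
      using gs by (intro B.tuple_ex1[OF X w]) blast
    have iff: "(\<forall>k<length ?ps. ?ps ! k \<cdot>\<^bsub>rename_arrows c B\<^esub> c f = fs ! k) \<longleftrightarrow>
        (\<forall>k<length w. B.pr w k \<cdot>\<^bsub>B\<^esub> f = gs k)" if f: "f \<in> Homset B X w" for f
    proof -
      have "c (B.pr w k \<cdot>\<^bsub>B\<^esub> f) = c (gs k) \<longleftrightarrow> B.pr w k \<cdot>\<^bsub>B\<^esub> f = gs k" if "k < length w" for k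
        using inj_on_eq_iff[OF inj] HomsetD[OF f] HomsetD[OF gs[THEN conjunct1, OF that]] that w
        by simp
      then show ?thesis
        using gs HomsetD[OF f] w by (simp add: rename_simps flip: B.pr_def)
    qed
    show "\<exists>!h. h \<in> Homset (rename_arrows c B) X w \<and>
        (\<forall>k<length ?ps. ?ps ! k \<cdot>\<^bsub>rename_arrows c B\<^esub> h = fs ! k)"
    proof -
      obtain h where h: "h \<in> Homset B X w" "\<forall>k<length w. B.pr w k \<cdot>\<^bsub>B\<^esub> h = gs k"
        using ex by blast
      show ?thesis
      proof (rule ex1I[of _ "c h"])
        show "c h \<in> Homset (rename_arrows c B) X w \<and>
          (\<forall>k<length ?ps. ?ps ! k \<cdot>\<^bsub>rename_arrows c B\<^esub> c h = fs ! k)"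
          unfolding iff[OF h(1)] rename_Homset using h by blast
        fix y assume y: "y \<in> Homset (rename_arrows c B) X w \<and>
          (\<forall>k<length ?ps. ?ps ! k \<cdot>\<^bsub>rename_arrows c B\<^esub> y = fs ! k)"
        then obtain f where f: "f \<in> Homset B X w" "y = c f"
          unfolding rename_Homset by blast
        then have "\<forall>k<length w. B.pr w k \<cdot>\<^bsub>B\<^esub> f = gs k"
          using y iff[OF f(1)] by blast
        then show "y = c h"
          using ex f h by blast
      qed
    qed
  qed
qed

end

locale free_theory =
  fixes I :: "'i set"
    and F :: "('i list, 'a) cat" (structure)
    and J :: "'i list \<times> nat list \<times> 'i list \<Rightarrow> 'a"
    and E :: "'i list \<Rightarrow> 'i \<Rightarrow> 'e set"
    and \<eta> :: "'i list \<Rightarrow> 'i \<Rightarrow> 'e \<Rightarrow> 'a"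
  assumes free: "free_sorted_theory I F J E \<eta>"

sublocale free_theory \<subseteq> sorted_category F I J
  using free sorted_category_if_sorted_theory by (auto simp: free_sorted_theory_def)

context free_theory
begin

definition generator :: "'a \<Rightarrow> bool" where
  "generator g \<longleftrightarrow> (\<exists>w\<in>lists I. \<exists>i\<in>I. \<exists>e\<in>E w i. g = \<eta> w i e)"

lemma eta_Hom: "w \<in> lists I \<Longrightarrow> i \<in> I \<Longrightarrow> e \<in> E w i \<Longrightarrow> \<eta> w i e \<in> Homset F w [i]"
  using free by (auto simp: free_sorted_theory_def family_map_def)

lemma generatorE:
  assumes "generator g"
  obtains i where "i \<in> I" "g \<in> Arr F" "Dom F g \<in> lists I" "Cod F g = [i]"
  using assms HomsetD[OF eta_Hom] by (metis generator_def)

lemma generator_arr [simp]: "generator g \<Longrightarrow> g \<in> Arr F"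
  by (erule generatorE)

text \<open>
  The existence part of the universal property, with a codomain over any type whose arrows can be
  coded: extend to the renamed theory and undo the renaming.
\<close>

lemma free_extension:
  fixes B :: "('i list, 'b) cat" and c :: "'b \<Rightarrow> 'a"
  assumes B: "sorted_category B I K" and c: "inj_on c (Arr B)" and h: "family_map I E B h"
  obtains H where "cat_functor F B (\<lambda>v. v) H" "\<And>u. u \<in> Arr (Fam I) \<Longrightarrow> H (J u) = K u"
    "\<And>w i e. w \<in> lists I \<Longrightarrow> i \<in> I \<Longrightarrow> e \<in> E w i \<Longrightarrow> H (\<eta> w i e) = h w i e"
proof -
  interpret B: sorted_category B I K by (rule B)
  let ?A = "rename_arrows c B"
  note A = sorted_category_rename_arrows[OF c B] and simps = rename_simps[OF c B]
  have "family_map I E ?A (\<lambda>w i e. c (h w i e))"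
    using h by (auto simp: family_map_def rename_Homset[OF c B])
  then obtain H where H: "sorted_theory_morphism I F J ?A (c \<circ> K) H"
    and H\<eta>: "\<forall>w\<in>lists I. \<forall>i\<in>I. \<forall>e\<in>E w i. H (\<eta> w i e) = c (h w i e)"
    using free sorted_category.sorted_theory[OF A] unfolding free_sorted_theory_def by blast
  define r where "r = inv_into (Arr B) c"
  have r: "r (c f) = f" if "f \<in> Arr B" for f
    using that c by (simp add: r_def)
  have Hf: "cat_functor F ?A (\<lambda>v. v) H"
    using H by (simp add: sorted_theory_morphism_def theory_morphism_def)
  have rH: "r (H f) \<in> Arr B" "H f = c (r (H f))" if "f \<in> Arr F" for f
  proof -
    have "H f \<in> c ` Arr B"
      using cat_functorD(1)[OF Hf that] simps(2) by simp
    then show "r (H f) \<in> Arr B" "H f = c (r (H f))"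
      by (simp_all add: r_def inv_into_into f_inv_into_f)
  qed
  show ?thesis
  proof (rule that[of "r \<circ> H"])
    show "cat_functor F B (\<lambda>v. v) (r \<circ> H)"
      unfolding cat_functor_def
    proof (intro conjI ballI impI)
      show "(r \<circ> H) f \<in> Homset B (Dom F f) (Cod F f)" if "f \<in> Arr F" for f
        using rH[OF that] cat_functorD(2,3)[OF Hf that] simps(4,5)[OF rH(1)[OF that]]
        by (auto intro!: HomsetI)
      show "(r \<circ> H) (Ident F X) = Ident B X" if "X \<in> Obj F" for X
        using cat_functorD(4)[OF Hf that] that by (simp add: simps r)
      show "(r \<circ> H) (g \<cdot> f) = (r \<circ> H) g \<cdot>\<^bsub>B\<^esub> (r \<circ> H) f"
        if f: "f \<in> Arr F" and g: "g \<in> Arr F" and d: "Dom F g = Cod F f" for f g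
      proof -
        have "H (g \<cdot> f) = c (r (H g) \<cdot>\<^bsub>B\<^esub> r (H f))"
          using cat_functorD(5)[OF Hf f g d] rH[OF f] rH[OF g] simps(6) by metis
        moreover have "Dom B (r (H g)) = Cod B (r (H f))"
          using cat_functorD(2,3)[OF Hf] f g d simps(4,5) rH by metis
        ultimately show ?thesis
          using rH[OF f] rH[OF g] by (simp add: r)
      qed
    qed simp
    show "(r \<circ> H) (J u) = K u" if "u \<in> Arr (Fam I)" for u
      using H that cat_functorD(1)[OF B.K_functor that]
      by (simp add: sorted_theory_morphism_def r)
    show "(r \<circ> H) (\<eta> w i e) = h w i e" if "w \<in> lists I" "i \<in> I" "e \<in> E w i" for w i e
    proof -
      have "h w i e \<in> Arr B"
        using h that by (auto simp: family_map_def dest: HomsetD)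
      then show ?thesis
        using H\<eta> that by (simp add: r)
    qed
  qed
qed

text \<open>
  The uniqueness part of the universal property, applied to \<open>H\<close> and to the identity. Preservation
  of products is automatic by \<open>theory_morphism_under_Fam\<close>.
\<close>

lemma endofunctor_eq_id:
  assumes H: "cat_functor F F (\<lambda>v. v) H" and HJ: "\<And>u. u \<in> Arr (Fam I) \<Longrightarrow> H (J u) = J u"
    and H\<eta>: "\<And>w i e. w \<in> lists I \<Longrightarrow> i \<in> I \<Longrightarrow> e \<in> E w i \<Longrightarrow> H (\<eta> w i e) = \<eta> w i e"
    and f: "f \<in> Arr F"
  shows "H f = f"
proof -
  define M where "M = (\<lambda>H. H \<in> extensional (Arr F) \<and> sorted_theory_morphism I F J F J H \<and>
    (\<forall>w\<in>lists I. \<forall>i\<in>I. \<forall>e\<in>E w i. H (\<eta> w i e) = \<eta> w i e))"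
  have ex1: "\<exists>!H. M H"
    using free unfolding free_sorted_theory_def M_def by blast
  have M: "M (restrict G (Arr F))"
    if G: "cat_functor F F (\<lambda>v. v) G" and GJ: "\<And>u. u \<in> Arr (Fam I) \<Longrightarrow> G (J u) = J u"
    and G\<eta>: "\<And>w i e. w \<in> lists I \<Longrightarrow> i \<in> I \<Longrightarrow> e \<in> E w i \<Longrightarrow> G (\<eta> w i e) = \<eta> w i e" for G
  proof -
    have "cat_functor F F (\<lambda>v. v) (restrict G (Arr F))"
      using G by (auto simp: cat_functor_def)
    moreover have "restrict G (Arr F) (J u) = J u" if "u \<in> Arr (Fam I)" for u
      using GJ[OF that] cat_functorD(1)[OF K_functor that] by simp
    ultimately have "sorted_theory_morphism I F J F J (restrict G (Arr F))"
      using theory_morphism_under_Fam[OF sorted_category_axioms sorted_category_axioms]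
      by (simp add: sorted_theory_morphism_def)
    then show ?thesis
      using G\<eta> HomsetD(1)[OF eta_Hom] by (simp add: M_def)
  qed
  have "cat_functor F F (\<lambda>v. v) (\<lambda>f. f)"
    by (auto simp: cat_functor_def Homset_def)
  then have "M (restrict (\<lambda>f. f) (Arr F))"
    by (rule M) simp_all
  moreover have "M (restrict H (Arr F))"
    using H HJ H\<eta> by (rule M)
  ultimately have "restrict H (Arr F) f = restrict (\<lambda>f. f) (Arr F) f"
    using ex1 by metis
  then show ?thesis
    using f by simp
qed

text \<open>
  The arrows all of whose components satisfy \<open>Q\<close> form a subtheory containing the generators. The
  universal property retracts the whole theory onto it.
\<close>

lemma generation_induct [consumes 3, case_names proj gen comp]:
  assumes f: "f \<in> Arr F" and i: "i \<in> I" and cod: "Cod F f = [i]"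
    and proj: "\<And>w k. w \<in> lists I \<Longrightarrow> k < length w \<Longrightarrow> Q (pr w k)"
    and gen: "\<And>g. generator g \<Longrightarrow> Q g"
    and comp: "\<And>f s i. f \<in> Arr F \<Longrightarrow> Cod F f = [i] \<Longrightarrow> i \<in> I \<Longrightarrow> s \<in> Arr F \<Longrightarrow> Cod F s = Dom F f \<Longrightarrow>
      Q f \<Longrightarrow> (\<And>k. k < length (Dom F f) \<Longrightarrow> Q (pr (Dom F f) k \<cdot> s)) \<Longrightarrow> Q (f \<cdot> s)"
  shows "Q f"
proof -
  define S where "S = {a \<in> Arr F. \<forall>k<length (Cod F a). Q (pr (Cod F a) k \<cdot> a)}"
  define A where "A = F\<lparr>Arr := S\<rparr>"
  have [simp]: "Obj A = lists I" "Arr A = S" "Dom A = Dom F" "Cod A = Cod F" "Ident A = Ident F"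
    "Comp A = Comp F"
    by (simp_all add: A_def)
  have SA: "a \<in> Arr F" if "a \<in> S" for a
    using that by (simp add: S_def)
  have single: "a \<in> S \<longleftrightarrow> Q a" if "a \<in> Arr F" "Cod F a = [i]" "i \<in> I" for a i
    using that by (simp add: S_def pr_single)
  have J_arr: "J u \<in> S" if "u \<in> Arr (Fam I)" for u
  proof -
    obtain v ks w where u: "u = (v, ks, w)"
      by (metis prod_cases3)
    have "J u \<in> Arr F" "Cod F (J u) = v"
      using cat_functorD(1,3)[OF K_functor that] u by simp_all
    then show ?thesis
      using pr_K[of v ks w] that proj u by (auto simp: S_def Fam_simps(2))
  qed
  have comp_S: "b \<cdot> a \<in> S" if a: "a \<in> S" and b: "b \<in> S" and d: "Dom F b = Cod F a" for a b
  proof -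
    note [simp] = SA[OF a] SA[OF b] d
    have "Q (pr (Cod F b) k \<cdot> b \<cdot> a)" if k: "k < length (Cod F b)" for k
    proof -
      have "Q ((pr (Cod F b) k \<cdot> b) \<cdot> a)"
        using a b k by - (rule comp[of _ "Cod F b ! k"], auto simp: S_def)
      then show ?thesis
        using k by simp
    qed
    then show ?thesis
      by (simp add: S_def)
  qed
  have id_S: "Ident F w \<in> S" if "w \<in> lists I" for w
    using that proj by (simp add: S_def)
  have A: "sorted_category A I J"
  proof
    show "category A"
      unfolding category_def
    proof (intro conjI ballI impI)
      show "b \<cdot>\<^bsub>A\<^esub> a \<in> Homset A (Dom A a) (Cod A b)"
        if "a \<in> Arr A" "b \<in> Arr A" "Dom A b = Cod A a" for a b
        using that comp_S SA by (simp add: Homset_def)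
    qed (use id_S SA in \<open>simp_all add: Homset_def\<close>)
    show "cat_functor (Fam I) A (\<lambda>v. v) J"
      using K_functor J_arr unfolding cat_functor_def
      by (auto simp: Homset_def)
    fix w assume w: "w \<in> lists I"
    show "product_diagram A w (map (J \<circ> Fam_proj w) [0..<length w])"
      unfolding product_diagram_def
    proof (intro conjI ballI allI impI)
      let ?ps = "map (J \<circ> Fam_proj w) [0..<length w]"
      have ps: "?ps ! k = pr w k" if "k < length w" for k
        using that by (simp add: pr_def)
      show "w \<in> Obj A"
        using w by simp
      show "p \<in> Arr A" "Dom A p = w" if "p \<in> set ?ps" for p
      proof -
        obtain k where "k < length w" "p = J (Fam_proj w k)"
          using \<open>p \<in> set ?ps\<close> by auto
        then show "p \<in> Arr A" "Dom A p = w"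
          using w J_arr Fam_proj_arr(1)[OF w] pr(2)[OF w] by (simp_all add: pr_def)
      qed
      fix X fs
      assume "X \<in> Obj A" "length fs = length ?ps"
        and "\<forall>k<length ?ps. fs ! k \<in> Homset A X (Cod A (?ps ! k))"
      then have X: "X \<in> lists I" and fs: "\<And>k. k < length w \<Longrightarrow> fs ! k \<in> Homset A X [w ! k]"
        using w by (simp_all add: ps del: nth_map)
      have fsF: "fs ! k \<in> Homset F X [w ! k]" and fsQ: "Q (fs ! k)" if "k < length w" for k
        using HomsetD[OF fs[OF that]] SA single[of "fs ! k" "w ! k"] w that
        by (simp_all add: Homset_def)
      from tuple_ex1[OF X w fsF]
      have ex: "\<exists>!h. h \<in> Homset F X w \<and> (\<forall>k<length w. pr w k \<cdot> h = fs ! k)"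
        by blast
      moreover have "h \<in> Homset A X w \<longleftrightarrow> h \<in> Homset F X w"
        if "\<forall>k<length w. pr w k \<cdot> h = fs ! k" for h
        using that fsQ by (auto simp: Homset_def S_def)
      ultimately have "\<exists>!h. h \<in> Homset A X w \<and> (\<forall>k<length w. pr w k \<cdot> h = fs ! k)"
        by metis
      then show "\<exists>!h. h \<in> Homset A X w \<and> (\<forall>k<length ?ps. ?ps ! k \<cdot>\<^bsub>A\<^esub> h = fs ! k)"
        by (simp add: ps del: nth_map)
    qed
  qed (simp_all)
  have "family_map I E A \<eta>"
    unfolding family_map_def
  proof (intro ballI)
    fix w i e assume "w \<in> lists I" "i \<in> I" "e \<in> E w i"
    then have "\<eta> w i e \<in> Homset F w [i]" "generator (\<eta> w i e)"
      using eta_Hom by (auto simp: generator_def)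
    then show "\<eta> w i e \<in> Homset A w [i]"
      using single \<open>i \<in> I\<close> gen by (simp add: Homset_def)
  qed
  then obtain H where H: "cat_functor F A (\<lambda>v. v) H" "\<And>u. u \<in> Arr (Fam I) \<Longrightarrow> H (J u) = J u"
    "\<And>w i e. w \<in> lists I \<Longrightarrow> i \<in> I \<Longrightarrow> e \<in> E w i \<Longrightarrow> H (\<eta> w i e) = \<eta> w i e"
    using free_extension[OF A, of "\<lambda>f. f" \<eta>] by (metis inj_on_id2)
  have "cat_functor F F (\<lambda>v. v) H"
    using H(1) SA by (auto simp: cat_functor_def Homset_def)
  then have "H f = f"
    using H(2,3) f by (rule endofunctor_eq_id)
  then show ?thesis
    using cat_functorD(1)[OF H(1) f] single[OF f cod i] by simp
qed

end

section \<open>Unique decomposition of arrows\<close>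

lemma inj_pair_infinite:
  assumes "infinite (UNIV :: 'a set)"
  obtains p :: "'a \<times> 'a \<Rightarrow> 'a" where "inj p"
proof -
  have "(card_of (UNIV \<times> UNIV :: ('a \<times> 'a) set), card_of (UNIV :: 'a set)) \<in> ordIso"
    using card_of_Times_same_infinite[OF assms] by simp
  then obtain p :: "'a \<times> 'a \<Rightarrow> 'a" where "bij_betw p (UNIV \<times> UNIV) UNIV"
    using card_of_ordIso by blast
  then show ?thesis
    using that by (auto simp: bij_betw_def)
qed

text \<open>
  The marks \<open>\<nu> 0\<close> and \<open>\<nu> 1\<close> tell the empty list from the others, so that injectivity of the
  pairing function \<open>p\<close> carries over to lists.
\<close>

fun code_list :: "('a \<times> 'a \<Rightarrow> 'a) \<Rightarrow> (nat \<Rightarrow> 'a) \<Rightarrow> ('b \<Rightarrow> 'a) \<Rightarrow> 'b list \<Rightarrow> 'a" where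
  "code_list p \<nu> c [] = p (\<nu> 0, \<nu> 0)"
| "code_list p \<nu> c (x # xs) = p (\<nu> 1, p (c x, code_list p \<nu> c xs))"

lemma inj_code_list:
  assumes "inj p" "inj \<nu>" "inj c"
  shows "inj (code_list p \<nu> c)"
proof (rule injI)
  fix xs ys
  assume "code_list p \<nu> c xs = code_list p \<nu> c ys"
  then show "xs = ys"
  proof (induction xs arbitrary: ys)
    case Nil
    then show ?case
      using assms by (cases ys) (auto simp: inj_eq)
  next
    case (Cons x xs)
    then show ?case
      using assms by (cases ys) (auto simp: inj_eq)
  qed
qed

context free_theory
begin

text \<open>
  Terms with only the outermost symbol made explicit: in \<open>Inr (g, t)\<close>, which stands for \<open>g\<close>
  applied to \<open>t\<close>, the second entry is an arrow of \<open>F\<close> and not a tuple of terms.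
\<close>

definition terms :: "'i list \<Rightarrow> 'i \<Rightarrow> (nat + 'a \<times> 'a) set" where
  "terms w i = {Inl k |k. k < length w \<and> w ! k = i} \<union>
     {Inr (g, t) |g t. generator g \<and> Cod F g = [i] \<and> t \<in> Homset F w (Dom F g)}"

fun term_val :: "'i list \<Rightarrow> nat + 'a \<times> 'a \<Rightarrow> 'a" where
  "term_val w (Inl k) = pr w k"
| "term_val w (Inr (g, t)) = g \<cdot> t"

definition terms_val :: "'i list \<times> (nat + 'a \<times> 'a) list \<times> 'i list \<Rightarrow> 'a" where
  "terms_val = (\<lambda>(v, xs, w). tuple v w (\<lambda>k. term_val v (xs ! k)))"

text \<open>
  Substitution into \<open>Inr (g, t)\<close> composes \<open>t\<close> with the value of the substituted terms. So below
  the outermost symbol it only depends on values, and associativity comes down to that of \<open>F\<close>.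
\<close>

fun term_subst :: "'i list \<times> (nat + 'a \<times> 'a) list \<times> 'i list \<Rightarrow> nat + 'a \<times> 'a \<Rightarrow> nat + 'a \<times> 'a"
  where
  "term_subst s (Inl k) = fst (snd s) ! k"
| "term_subst s (Inr (g, t)) = Inr (g, t \<cdot> terms_val s)"

definition term_cat :: "('i list, 'i list \<times> (nat + 'a \<times> 'a) list \<times> 'i list) cat" where
  "term_cat = \<lparr>
     Obj = lists I,
     Arr = {(v, xs, w). v \<in> lists I \<and> w \<in> lists I \<and> length xs = length w \<and>
              (\<forall>k<length w. xs ! k \<in> terms v (w ! k))},
     Dom = (\<lambda>(v, xs, w). v),
     Cod = (\<lambda>(v, xs, w). w),
     Ident = (\<lambda>w. (w, map Inl [0..<length w], w)),
     Comp = (\<lambda>(w, xs, u) s. (fst s, map (term_subst s) xs, u))\<rparr>"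

lemma term_cat_simps [simp]:
  "Obj term_cat = lists I"
  "Dom term_cat (v, xs, w) = v"
  "Cod term_cat (v, xs, w) = w"
  "Ident term_cat w = (w, map Inl [0..<length w], w)"
  "(w, xs, u) \<cdot>\<^bsub>term_cat\<^esub> s = (fst s, map (term_subst s) xs, u)"
  by (simp_all add: term_cat_def)

lemma term_cat_Arr:
  "(v, xs, w) \<in> Arr term_cat \<longleftrightarrow> v \<in> lists I \<and> w \<in> lists I \<and> length xs = length w \<and>
     (\<forall>k<length w. xs ! k \<in> terms v (w ! k))"
  by (simp add: term_cat_def)

lemma term_cat_Homset:
  "s \<in> Homset term_cat v w \<longleftrightarrow> v \<in> lists I \<and> w \<in> lists I \<and> (\<exists>xs. s = (v, xs, w) \<and>
     length xs = length w \<and> (\<forall>k<length w. xs ! k \<in> terms v (w ! k)))"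
  by (cases s) (auto simp: Homset_def term_cat_Arr)

lemma term_val_Hom:
  assumes "x \<in> terms v i" "v \<in> lists I"
  shows "term_val v x \<in> Homset F v [i]"
  using assms
  by (auto simp: terms_def Homset_def)

lemma terms_val:
  assumes "(v, xs, w) \<in> Arr term_cat"
  shows "terms_val (v, xs, w) \<in> Homset F v w"
    and "k < length w \<Longrightarrow> pr w k \<cdot> terms_val (v, xs, w) = term_val v (xs ! k)"
  using assms tuple[of v w "\<lambda>k. term_val v (xs ! k)"] term_val_Hom
  by (auto simp: terms_val_def term_cat_Arr)

lemma terms_val_Hom: "a \<in> Homset term_cat v w \<Longrightarrow> terms_val a \<in> Homset F v w"
  using terms_val(1) by (cases a) (auto simp: Homset_def)

lemma term_subst:
  assumes x: "x \<in> terms w i" and s: "s \<in> Homset term_cat v w"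
  shows "term_subst s x \<in> terms v i"
    and "term_val v (term_subst s x) = term_val w x \<cdot> terms_val s"
proof -
  obtain ys where ys: "s = (v, ys, w)" "(v, ys, w) \<in> Arr term_cat"
    using s by (cases s) (auto simp: Homset_def)
  note sv = terms_val[OF ys(2)] and [simp] = HomsetD[OF terms_val(1)[OF ys(2)]]
  show "term_subst s x \<in> terms v i"
  proof (cases x)
    case (Inl k)
    then show ?thesis
      using x ys by (auto simp: terms_def term_cat_Arr)
  next
    case (Inr p)
    then show ?thesis
      using x ys(1) by (cases p) (auto simp: terms_def Homset_def)
  qed
  show "term_val v (term_subst s x) = term_val w x \<cdot> terms_val s"
  proof (cases x)
    case (Inl k)
    then show ?thesis
      using x ys(1) sv(2)[of k] by (auto simp: terms_def)
  next
    case (Inr p)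
    then obtain g t where "x = Inr (g, t)" "generator g" "t \<in> Arr F" "Dom F t = w" "Cod F t = Dom F g"
      using x by (auto simp: terms_def Homset_def)
    then show ?thesis
      using ys(1) by simp
  qed
qed

lemma terms_val_comp:
  assumes a: "a \<in> Homset term_cat w u" and s: "s \<in> Homset term_cat v w"
  shows "a \<cdot>\<^bsub>term_cat\<^esub> s \<in> Homset term_cat v u"
    and "terms_val (a \<cdot>\<^bsub>term_cat\<^esub> s) = terms_val a \<cdot> terms_val s"
proof -
  obtain xs ys where xs: "a = (w, xs, u)" "(w, xs, u) \<in> Arr term_cat"
    and ys: "s = (v, ys, w)" "(v, ys, w) \<in> Arr term_cat"
    using a s by (cases a, cases s) (auto simp: Homset_def)
  have xk: "xs ! k \<in> terms w (u ! k)" if "k < length u" for k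
    using xs(2) that by (simp add: term_cat_Arr)
  have len: "length xs = length u" and u: "u \<in> lists I" and v: "v \<in> lists I"
    using xs(2) ys(2) by (simp_all add: term_cat_Arr)
  show *: "a \<cdot>\<^bsub>term_cat\<^esub> s \<in> Homset term_cat v u"
    using term_subst(1)[OF xk s] xs ys len u v by (simp add: term_cat_Homset)
  then have arr: "(v, map (term_subst s) xs, u) \<in> Arr term_cat"
    using xs(1) ys(1) by (auto simp: Homset_def)
  note [simp] = HomsetD[OF terms_val(1)[OF xs(2)]] HomsetD[OF terms_val(1)[OF ys(2)]]
  have "terms_val (v, map (term_subst s) xs, u) = terms_val (w, xs, u) \<cdot> terms_val (v, ys, w)"
  proof (rule arr_eqI)
    show "terms_val (v, map (term_subst s) xs, u) \<in> Homset F v u"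
      by (rule terms_val(1)[OF arr])
    show "terms_val (w, xs, u) \<cdot> terms_val (v, ys, w) \<in> Homset F v u"
      by (simp add: Homset_def)
    fix k assume k: "k < length u"
    have "pr u k \<cdot> terms_val (w, xs, u) \<cdot> terms_val (v, ys, w) =
        (pr u k \<cdot> terms_val (w, xs, u)) \<cdot> terms_val (v, ys, w)"
      using k u by simp
    then show "pr u k \<cdot> terms_val (v, map (term_subst s) xs, u) =
        pr u k \<cdot> terms_val (w, xs, u) \<cdot> terms_val (v, ys, w)"
      using terms_val(2)[OF arr k] terms_val(2)[OF xs(2) k] term_subst(2)[OF xk[OF k] s] k len ys(1)
      by simp
  qed
  then show "terms_val (a \<cdot>\<^bsub>term_cat\<^esub> s) = terms_val a \<cdot> terms_val s"
    using xs(1) ys(1) by simp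
qed

lemma terms_val_vars:
  assumes "(v, f, w) \<in> Arr (Fam I)"
  shows "(w, map Inl f, v) \<in> Homset term_cat w v" "terms_val (w, map Inl f, v) = J (v, f, w)"
proof -
  show *: "(w, map Inl f, v) \<in> Homset term_cat w v"
    using assms by (auto simp: term_cat_Homset Fam_simps(2) terms_def)
  show "terms_val (w, map Inl f, v) = J (v, f, w)"
  proof (rule arr_eqI[of _ w v])
    show "terms_val (w, map Inl f, v) \<in> Homset F w v"
      by (rule terms_val(1)) (rule HomsetD(1)[OF *])
    show "J (v, f, w) \<in> Homset F w v"
      using cat_functorD(1-3)[OF K_functor assms] by (auto simp: Homset_def)
    show "pr v k \<cdot> terms_val (w, map Inl f, v) = pr v k \<cdot> J (v, f, w)" if "k < length v" for k
      using terms_val(2)[OF HomsetD(1)[OF *] that] pr_K[OF assms that] assms that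
      by (simp add: Fam_simps(2))
  qed
qed

lemma terms_val_ident:
  assumes "w \<in> lists I"
  shows "Ident term_cat w \<in> Homset term_cat w w" "terms_val (Ident term_cat w) = Ident F w"
proof -
  have "(w, [0..<length w], w) \<in> Arr (Fam I)"
    using assms by (simp add: Fam_simps(2))
  from terms_val_vars[OF this]
  show "Ident term_cat w \<in> Homset term_cat w w" "terms_val (Ident term_cat w) = Ident F w"
    using cat_functorD(4)[OF K_functor, of w] assms by simp_all
qed

lemma term_subst_comp:
  assumes x: "x \<in> terms u i" and a: "a \<in> Homset term_cat w u" and s: "s \<in> Homset term_cat v w"
  shows "term_subst s (term_subst a x) = term_subst (a \<cdot>\<^bsub>term_cat\<^esub> s) x"
proof (cases x)
  case (Inl k)
  then show ?thesis
    using x a by (auto simp: terms_def term_cat_Homset)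
next
  case (Inr p)
  obtain g t where p: "p = (g, t)"
    by force
  have "t \<in> Homset F u (Dom F g)"
    using x Inr p by (auto simp: terms_def)
  moreover have "terms_val a \<in> Homset F w u" "terms_val s \<in> Homset F v w"
    using a s terms_val_Hom by blast+
  ultimately have "(t \<cdot> terms_val a) \<cdot> terms_val s = t \<cdot> terms_val a \<cdot> terms_val s"
    by (auto simp: Homset_def)
  then show ?thesis
    using Inr p terms_val_comp(2)[OF a s] by simp
qed

lemma term_subst_ident:
  assumes "x \<in> terms w i" "w \<in> lists I"
  shows "term_subst (Ident term_cat w) x = x"
  using assms terms_val_ident(2)[OF assms(2)] by (auto simp: terms_def Homset_def)

definition term_J :: "'i list \<times> nat list \<times> 'i list \<Rightarrow> 'i list \<times> (nat + 'a \<times> 'a) list \<times> 'i list" where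
  "term_J = (\<lambda>(v, f, w). (w, map Inl f, v))"

lemma category_term_cat: "category term_cat"
  unfolding category_def
proof (intro conjI ballI impI)
  show "Dom term_cat a \<in> Obj term_cat" "Cod term_cat a \<in> Obj term_cat" if "a \<in> Arr term_cat" for a
    using that by (cases a; simp add: term_cat_Arr)+
  show "Ident term_cat w \<in> Homset term_cat w w" if "w \<in> Obj term_cat" for w
    using that terms_val_ident(1) by simp
  show "b \<cdot>\<^bsub>term_cat\<^esub> a \<in> Homset term_cat (Dom term_cat a) (Cod term_cat b)"
    if "a \<in> Arr term_cat" "b \<in> Arr term_cat" "Dom term_cat b = Cod term_cat a" for a b
    using that by (intro terms_val_comp(1)) (auto simp: Homset_def)
  show "a \<cdot>\<^bsub>term_cat\<^esub> Ident term_cat (Dom term_cat a) = a" if "a \<in> Arr term_cat" for a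
  proof -
    obtain v xs w where a: "a = (v, xs, w)" "(v, xs, w) \<in> Arr term_cat"
      using \<open>a \<in> Arr term_cat\<close> by (metis prod_cases3)
    then have "map (term_subst (Ident term_cat v)) xs = xs"
      using term_subst_ident by (intro nth_equalityI) (auto simp: term_cat_Arr simp del: term_cat_simps)
    then show ?thesis
      using a by simp
  qed
  show "Ident term_cat (Cod term_cat a) \<cdot>\<^bsub>term_cat\<^esub> a = a" if "a \<in> Arr term_cat" for a
  proof -
    obtain v xs w where a: "a = (v, xs, w)" "(v, xs, w) \<in> Arr term_cat"
      using \<open>a \<in> Arr term_cat\<close> by (metis prod_cases3)
    then show ?thesis
      by (auto simp: term_cat_Arr intro!: nth_equalityI)
  qed
  show "(c \<cdot>\<^bsub>term_cat\<^esub> b) \<cdot>\<^bsub>term_cat\<^esub> a = c \<cdot>\<^bsub>term_cat\<^esub> b \<cdot>\<^bsub>term_cat\<^esub> a"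
    if "a \<in> Arr term_cat" "b \<in> Arr term_cat" "c \<in> Arr term_cat"
      "Dom term_cat b = Cod term_cat a" "Dom term_cat c = Cod term_cat b" for a b c
  proof -
    obtain u xs w where c: "c = (u, xs, w)" "(u, xs, w) \<in> Arr term_cat"
      using \<open>c \<in> Arr term_cat\<close> by (metis prod_cases3)
    have b: "b \<in> Homset term_cat (Dom term_cat b) u" and
      a: "a \<in> Homset term_cat (Dom term_cat a) (Dom term_cat b)"
      using that c by (auto simp: Homset_def)
    have "fst (b \<cdot>\<^bsub>term_cat\<^esub> a) = fst a"
      by (cases b) simp
    moreover have "term_subst a (term_subst b x) = term_subst (b \<cdot>\<^bsub>term_cat\<^esub> a) x"
      if "x \<in> set xs" for x
    proof -
      obtain k where "x \<in> terms u (w ! k)"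
        using \<open>x \<in> set xs\<close> c(2) by (auto simp: term_cat_Arr in_set_conv_nth)
      then show ?thesis
        by (rule term_subst_comp[OF _ b a])
    qed
    ultimately show ?thesis
      using c(1) by simp
  qed
qed

lemma sorted_category_term_cat: "sorted_category term_cat I term_J"
proof
  show "category term_cat"
    by (rule category_term_cat)
  show "cat_functor (Fam I) term_cat (\<lambda>v. v) term_J"
    unfolding cat_functor_def
  proof (intro conjI ballI impI)
    show "term_J u \<in> Homset term_cat (Dom (Fam I) u) (Cod (Fam I) u)" if "u \<in> Arr (Fam I)" for u
      using that terms_val_vars(1) by (cases u) (auto simp: term_J_def)
    show "term_J (Ident (Fam I) X) = Ident term_cat X" for X
      by (simp add: term_J_def)
    fix u t assume u: "u \<in> Arr (Fam I)" and t: "t \<in> Arr (Fam I)"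
      and d: "Dom (Fam I) t = Cod (Fam I) u"
    obtain v f w v' f' w' where "u = (v, f, w)" "t = (v', f', w')"
      by (metis prod_cases3)
    then show "term_J (t \<cdot>\<^bsub>Fam I\<^esub> u) = term_J t \<cdot>\<^bsub>term_cat\<^esub> term_J u"
      using u t d by (auto simp: term_J_def Fam_simps(2) in_set_conv_nth)
  qed simp
  fix w assume w: "w \<in> lists I"
  show "product_diagram term_cat w (map (term_J \<circ> Fam_proj w) [0..<length w])"
    unfolding product_diagram_def
  proof (intro conjI ballI allI impI)
    let ?ps = "map (term_J \<circ> Fam_proj w) [0..<length w]"
    have ps: "?ps ! k = (w, [Inl k], [w ! k])" if "k < length w" for k
      using that by (simp add: term_J_def Fam_proj_def)
    show "w \<in> Obj term_cat"
      using w by simp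
    show "p \<in> Arr term_cat" "Dom term_cat p = w" if "p \<in> set ?ps" for p
      using that w by (auto simp: term_J_def Fam_proj_def term_cat_Arr terms_def)
    fix X fs
    assume "X \<in> Obj term_cat" "length fs = length ?ps"
      and "\<forall>k<length ?ps. fs ! k \<in> Homset term_cat X (Cod term_cat (?ps ! k))"
    then have X: "X \<in> lists I"
      and fs: "\<And>k. k < length w \<Longrightarrow> fs ! k \<in> Homset term_cat X [w ! k]"
      by (simp_all add: ps del: nth_map)
    have "\<forall>k<length w. \<exists>x. fs ! k = (X, [x], [w ! k]) \<and> x \<in> terms X (w ! k)"
      using fs by (fastforce simp: term_cat_Homset length_Suc_conv)
    then obtain x where x: "\<And>k. k < length w \<Longrightarrow> fs ! k = (X, [x k], [w ! k]) \<and> x k \<in> terms X (w ! k)"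
      by metis
    show "\<exists>!h. h \<in> Homset term_cat X w \<and> (\<forall>k<length ?ps. ?ps ! k \<cdot>\<^bsub>term_cat\<^esub> h = fs ! k)"
    proof (rule ex1I[of _ "(X, map x [0..<length w], w)"])
      show "(X, map x [0..<length w], w) \<in> Homset term_cat X w \<and>
        (\<forall>k<length ?ps. ?ps ! k \<cdot>\<^bsub>term_cat\<^esub> (X, map x [0..<length w], w) = fs ! k)"
        using x X w by (auto simp: term_J_def Fam_proj_def term_cat_Homset)
      fix h assume h: "h \<in> Homset term_cat X w \<and> (\<forall>k<length ?ps. ?ps ! k \<cdot>\<^bsub>term_cat\<^esub> h = fs ! k)"
      then obtain ys where ys: "h = (X, ys, w)" "length ys = length w"
        by (auto simp: term_cat_Homset)
      have "ys ! k = x k" if "k < length w" for k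
        using h that x[OF that] ys by (auto simp: ps simp del: nth_map)
      then show "h = (X, map x [0..<length w], w)"
        using ys by (auto intro!: nth_equalityI)
    qed
  qed
qed simp

text \<open>
  The identities of \<open>F\<close> code the objects and, at the powers of one sort, the natural numbers. So the
  type of arrows of \<open>F\<close> is infinite, pairs of its elements can be coded in it, and with them lists.
\<close>

lemma term_cat_embeds:
  assumes "I \<noteq> {}"
  obtains c :: "'i list \<times> (nat + 'a \<times> 'a) list \<times> 'i list \<Rightarrow> 'a" where "inj_on c (Arr term_cat)"
proof -
  obtain i where i: "i \<in> I"
    using assms by blast
  have Ident_eq: "Ident F v = Ident F w \<longleftrightarrow> v = w" if "v \<in> lists I" "w \<in> lists I" for v w
    using that dom_ident by (metis Obj)
  define \<nu> where "\<nu> n = Ident F (replicate n i)" for n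
  have \<nu>: "inj \<nu>"
  proof (rule injI)
    fix m n assume "\<nu> m = \<nu> n"
    then have "replicate m i = replicate n i"
      using i by (simp add: \<nu>_def Ident_eq in_lists_conv_set)
    then show "m = n"
      by (metis length_replicate)
  qed
  then have "infinite (UNIV :: 'a set)"
    using finite_imageD[of \<nu> UNIV] infinite_UNIV_nat finite_subset[of "range \<nu>" UNIV] by auto
  then obtain p :: "'a \<times> 'a \<Rightarrow> 'a" where p: "inj p"
    by (rule inj_pair_infinite)
  define d where "d x = (case x of Inl k \<Rightarrow> p (\<nu> 0, \<nu> k) | Inr y \<Rightarrow> p (\<nu> 1, p y))" for x
  have d: "inj d"
    by (rule injI) (auto simp: d_def inj_eq[OF p] inj_eq[OF \<nu>] split: sum.splits)
  have l: "inj (code_list p \<nu> d)"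
    by (rule inj_code_list[OF p \<nu> d])
  define c where "c = (\<lambda>(v, xs, w). p (Ident F v, p (code_list p \<nu> d xs, Ident F w)))"
  have "inj_on c (Arr term_cat)"
    by (rule inj_onI) (auto simp: c_def inj_eq[OF p] inj_eq[OF l] term_cat_Arr Ident_eq)
  then show ?thesis
    by (rule that)
qed

text \<open>
  The universal property gives a functor \<open>H\<close> from \<open>F\<close> to the theory of terms, and evaluating the
  terms \<open>H f\<close> returns \<open>f\<close>. So every arrow is the value of its term. Conversely \<open>H\<close> sends \<open>g \<cdot> t\<close> to
  the term \<open>Inr (g, t)\<close>, since substituting into \<open>Inr (g, Ident)\<close> composes with the value of
  \<open>H t\<close>, which is \<open>t\<close>. This makes the term of an arrow unique.
\<close>

lemma ex_term_functor:
  assumes "I \<noteq> {}"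
  shows "\<exists>H. cat_functor F term_cat (\<lambda>v. v) H \<and> (\<forall>f\<in>Arr F. terms_val (H f) = f) \<and>
    (\<forall>w\<in>lists I. \<forall>k<length w. H (pr w k) = (w, [Inl k], [w ! k])) \<and>
    (\<forall>g t. generator g \<longrightarrow> t \<in> Arr F \<longrightarrow> Cod F t = Dom F g \<longrightarrow>
       H (g \<cdot> t) = (Dom F t, [Inr (g, t)], Cod F g))"
proof -
  obtain c :: "'i list \<times> (nat + 'a \<times> 'a) list \<times> 'i list \<Rightarrow> 'a" where c: "inj_on c (Arr term_cat)"
    using term_cat_embeds[OF assms] .
  define h :: "'i list \<Rightarrow> 'i \<Rightarrow> 'e \<Rightarrow> 'i list \<times> (nat + 'a \<times> 'a) list \<times> 'i list"
    where "h w i e = (w, [Inr (\<eta> w i e, Ident F w)], [i])" for w i e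
  have hT: "h w i e \<in> Homset term_cat w [i]" and hv: "terms_val (h w i e) = \<eta> w i e"
    if w: "w \<in> lists I" and i: "i \<in> I" and e: "e \<in> E w i" for w i e
  proof -
    have g: "generator (\<eta> w i e)"
      using that by (auto simp: generator_def)
    note \<eta> = HomsetD[OF eta_Hom[OF that]]
    have "Ident F w \<in> Homset F w w"
      using w by (simp add: Homset_def)
    then show *: "h w i e \<in> Homset term_cat w [i]"
      using g \<eta> w i by (simp add: h_def term_cat_Homset terms_def)
    then have **: "(w, [Inr (\<eta> w i e, Ident F w)], [i]) \<in> Arr term_cat"
      by (simp add: h_def Homset_def)
    show "terms_val (h w i e) = \<eta> w i e"
      using terms_val(2)[OF **, of 0] HomsetD[OF terms_val_Hom[OF *]] \<eta> w i
      by (simp add: h_def pr_single)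
  qed
  have "family_map I E term_cat h"
    using hT by (simp add: family_map_def)
  then obtain H where H: "cat_functor F term_cat (\<lambda>v. v) H"
    and HJ: "\<And>u. u \<in> Arr (Fam I) \<Longrightarrow> H (J u) = term_J u"
    and H\<eta>: "\<And>w i e. w \<in> lists I \<Longrightarrow> i \<in> I \<Longrightarrow> e \<in> E w i \<Longrightarrow> H (\<eta> w i e) = h w i e"
    using free_extension[OF sorted_category_term_cat c] by blast
  have HH: "H f \<in> Homset term_cat (Dom F f) (Cod F f)" if "f \<in> Arr F" for f
    using cat_functorD(1-3)[OF H that] by (simp add: Homset_def)
  have val: "terms_val (H f) = f" if f: "f \<in> Arr F" for f
  proof (rule endofunctor_eq_id[of "\<lambda>f. terms_val (H f)", OF _ _ _ f])
    show "cat_functor F F (\<lambda>v. v) (\<lambda>f. terms_val (H f))"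
      unfolding cat_functor_def
    proof (intro conjI ballI impI)
      show "terms_val (H f) \<in> Homset F (Dom F f) (Cod F f)" if "f \<in> Arr F" for f
        using terms_val_Hom HH that by blast
      show "terms_val (H (Ident F X)) = Ident F X" if "X \<in> Obj F" for X
        using cat_functorD(4)[OF H that] terms_val_ident(2) that by simp
      show "terms_val (H (g \<cdot> f)) = terms_val (H g) \<cdot> terms_val (H f)"
        if "f \<in> Arr F" "g \<in> Arr F" "Dom F g = Cod F f" for f g
        using cat_functorD(5)[OF H that] terms_val_comp(2) HH[OF that(1)] HH[OF that(2)] that(3)
        by metis
    qed simp
    show "terms_val (H (J u)) = J u" if "u \<in> Arr (Fam I)" for u
      using HJ[OF that] that terms_val_vars(2) by (cases u) (simp add: term_J_def)
    show "terms_val (H (\<eta> w i e)) = \<eta> w i e" if "w \<in> lists I" "i \<in> I" "e \<in> E w i" for w i e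
      using H\<eta>[OF that] hv[OF that] by simp
  qed
  show ?thesis
  proof (intro exI[of _ H] conjI H ballI allI impI)
    show "terms_val (H f) = f" if "f \<in> Arr F" for f
      by (rule val[OF that])
    show "H (pr w k) = (w, [Inl k], [w ! k])" if "w \<in> lists I" "k < length w" for w k
      using HJ[OF Fam_proj_arr(1)[OF that]] by (simp add: pr_def term_J_def Fam_proj_def)
    show "H (g \<cdot> t) = (Dom F t, [Inr (g, t)], Cod F g)"
      if g: "generator g" and t: "t \<in> Arr F" "Cod F t = Dom F g" for g t
    proof -
      obtain w i e where we: "w \<in> lists I" "i \<in> I" "e \<in> E w i" "g = \<eta> w i e"
        using g by (auto simp: generator_def)
      note \<eta> = HomsetD[OF eta_Hom[OF we(1-3)]]
      have "H g = (Dom F g, [Inr (g, Ident F (Dom F g))], Cod F g)"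
        using H\<eta>[OF we(1-3)] \<eta> we(4) by (simp add: h_def)
      moreover have "fst (H t) = Dom F t"
        using HH[OF t(1)] by (auto simp: term_cat_Homset)
      ultimately show ?thesis
        using cat_functorD(5)[OF H t(1), of g] \<eta> we(4) t val[OF t(1)] by simp
    qed
  qed
qed

definition term_of :: "'a \<Rightarrow> 'i list \<times> (nat + 'a \<times> 'a) list \<times> 'i list" where
  "term_of = (SOME H. cat_functor F term_cat (\<lambda>v. v) H \<and> (\<forall>f\<in>Arr F. terms_val (H f) = f) \<and>
    (\<forall>w\<in>lists I. \<forall>k<length w. H (pr w k) = (w, [Inl k], [w ! k])) \<and>
    (\<forall>g t. generator g \<longrightarrow> t \<in> Arr F \<longrightarrow> Cod F t = Dom F g \<longrightarrow>
       H (g \<cdot> t) = (Dom F t, [Inr (g, t)], Cod F g)))"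

lemma term_of:
  assumes "I \<noteq> {}"
  shows "cat_functor F term_cat (\<lambda>v. v) term_of"
    and "f \<in> Arr F \<Longrightarrow> terms_val (term_of f) = f"
    and "w \<in> lists I \<Longrightarrow> k < length w \<Longrightarrow> term_of (pr w k) = (w, [Inl k], [w ! k])"
    and "generator g \<Longrightarrow> t \<in> Arr F \<Longrightarrow> Cod F t = Dom F g \<Longrightarrow>
       term_of (g \<cdot> t) = (Dom F t, [Inr (g, t)], Cod F g)"
  using someI_ex[OF ex_term_functor[OF assms]] unfolding term_of_def by blast+

text \<open>An arrow is the value of its term, and there are two kinds of terms.\<close>

lemma arrow_cases:
  assumes "f \<in> Arr F" "Cod F f = [i]"
  obtains (proj) w k where "w \<in> lists I" "k < length w" "f = pr w k" "Dom F f = w" "w ! k = i"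
    | (app) g t where "generator g" "t \<in> Arr F" "Cod F t = Dom F g" "f = g \<cdot> t"
proof -
  have i: "i \<in> I"
    using cod_in_lists[OF assms(1)] assms(2) by simp
  then have I: "I \<noteq> {}"
    by blast
  have "term_of f \<in> Homset term_cat (Dom F f) [i]"
    using cat_functorD(1-3)[OF term_of(1)[OF I] assms(1)] assms(2) by (simp add: Homset_def)
  then obtain xs where xs: "term_of f = (Dom F f, xs, [i])" "length xs = 1"
    "xs ! 0 \<in> terms (Dom F f) i" and arr: "term_of f \<in> Arr term_cat"
    by (auto simp: term_cat_Homset term_cat_Arr)
  then obtain x where "xs = [x]"
    by (auto simp: length_Suc_conv)
  with xs arr have x: "term_of f = (Dom F f, [x], [i])" "x \<in> terms (Dom F f) i"
    "(Dom F f, [x], [i]) \<in> Arr term_cat"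
    by simp_all
  have fx: "f = term_val (Dom F f) x"
    using term_of(2)[OF I assms(1)] terms_val(2)[OF x(3), of 0] assms i
    by (simp add: x(1) pr_single)
  show ?thesis
  proof (cases x)
    case (Inl k)
    show ?thesis
      by (rule proj[of "Dom F f" k])
        (use x(2) Inl fx dom_in_lists[OF assms(1)] in \<open>auto simp: terms_def\<close>)
  next
    case (Inr p)
    show ?thesis
      by (rule app[of "fst p" "snd p"])
        (use x(2) Inr fx in \<open>auto simp: terms_def Homset_def\<close>)
  qed
qed

lemma app_unique:
  assumes g: "generator g" "generator g'" and t: "t \<in> Arr F" "Cod F t = Dom F g"
    and t': "t' \<in> Arr F" "Cod F t' = Dom F g'" and eq: "g \<cdot> t = g' \<cdot> t'"
  shows "g = g'" "t = t'"
proof -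
  have "I \<noteq> {}"
    using g(1) by (auto simp: generator_def)
  have "term_of (g \<cdot> t) = (Dom F t, [Inr (g, t)], Cod F g)"
    by (rule term_of(4)[OF \<open>I \<noteq> {}\<close> g(1) t])
  moreover have "term_of (g \<cdot> t) = (Dom F t', [Inr (g', t')], Cod F g')"
    unfolding eq by (rule term_of(4)[OF \<open>I \<noteq> {}\<close> g(2) t'])
  ultimately show "g = g'" "t = t'"
    by simp_all
qed

lemma app_neq_pr:
  assumes g: "generator g" and t: "t \<in> Arr F" "Cod F t = Dom F g"
    and w: "w \<in> lists I" "k < length w"
  shows "g \<cdot> t \<noteq> pr w k"
proof -
  have "I \<noteq> {}"
    using g by (auto simp: generator_def)
  then have "term_of (g \<cdot> t) \<noteq> term_of (pr w k)"
    unfolding term_of(4)[OF \<open>I \<noteq> {}\<close> g t] term_of(3)[OF \<open>I \<noteq> {}\<close> w] by simp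
  then show ?thesis
    by metis
qed

text \<open>The recursive calls in the description of the cochains: from \<open>g \<cdot> t\<close> to the components of \<open>t\<close>.\<close>

definition subterm_rel :: "('a \<times> 'a) set" where
  "subterm_rel = {(pr (Dom F g) k \<cdot> t, g \<cdot> t) |g k t.
     generator g \<and> t \<in> Arr F \<and> Cod F t = Dom F g \<and> k < length (Dom F g)}"

lemma subterm_relI:
  "generator g \<Longrightarrow> t \<in> Arr F \<Longrightarrow> Cod F t = Dom F g \<Longrightarrow> k < length (Dom F g) \<Longrightarrow>
    (pr (Dom F g) k \<cdot> t, g \<cdot> t) \<in> subterm_rel"
  unfolding subterm_rel_def by blast

lemma subterm_relD:
  assumes "(x, g \<cdot> t) \<in> subterm_rel" "generator g" "t \<in> Arr F" "Cod F t = Dom F g"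
  obtains k where "k < length (Dom F g)" "x = pr (Dom F g) k \<cdot> t"
proof -
  obtain g' k t' where gt: "generator g'" "t' \<in> Arr F" "Cod F t' = Dom F g'" "k < length (Dom F g')"
    and eq: "x = pr (Dom F g') k \<cdot> t'" "g \<cdot> t = g' \<cdot> t'"
    using assms(1) unfolding subterm_rel_def by blast
  have "g = g'" "t = t'"
    using app_unique[OF assms(2) gt(1) assms(3,4) gt(2,3) eq(2)] by blast+
  then show ?thesis
    using that gt(4) eq(1) by blast
qed

text \<open>
  By \<open>generation_induct\<close> it is enough that the accessible arrows contain the projections and the
  generators and are closed under substitution. The last point is an induction on accessibility:
  the predecessors of \<open>(g \<cdot> t) \<cdot> s\<close> are the components of \<open>t\<close>, with \<open>s\<close> substituted.
\<close>

lemma wf_subterm_rel: "wf subterm_rel"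
proof (rule acc_wfI, rule allI)
  have acc_pr: "pr w k \<in> Wellfounded.acc subterm_rel" if "w \<in> lists I" "k < length w" for w k
  proof (rule accI)
    fix y assume "(y, pr w k) \<in> subterm_rel"
    then show "y \<in> Wellfounded.acc subterm_rel"
      using app_neq_pr that unfolding subterm_rel_def by force
  qed
  have subst: "f \<cdot> s \<in> Wellfounded.acc subterm_rel"
    if f: "f \<in> Wellfounded.acc subterm_rel" and "f \<in> Arr F" "Cod F f = [i]" "s \<in> Arr F" "Cod F s = Dom F f"
      "\<And>k. k < length (Dom F f) \<Longrightarrow> pr (Dom F f) k \<cdot> s \<in> Wellfounded.acc subterm_rel" for f s i
    using that
  proof (induction f arbitrary: i rule: acc_induct_rule)
    case (1 f)
    show ?case
      using 1(3,4)
    proof (cases rule: arrow_cases)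
      case (proj w k)
      then show ?thesis
        using 1(7) by simp
    next
      case (app g t)
      have [simp]: "g \<in> Arr F" "Dom F f = Dom F t"
        using app by (auto elim: generatorE)
      note [simp] = app(2,3) 1(5,6)
      show ?thesis
      proof (rule accI)
        fix y assume "(y, f \<cdot> s) \<in> subterm_rel"
        then have "(y, g \<cdot> t \<cdot> s) \<in> subterm_rel"
          by (simp add: app(4))
        then obtain k where k: "k < length (Dom F g)" "y = pr (Dom F g) k \<cdot> t \<cdot> s"
          by (rule subterm_relD) (use app in auto)
        have "(pr (Dom F g) k \<cdot> t, f) \<in> subterm_rel"
          unfolding app(4) using app(1-3) k(1) by (rule subterm_relI)
        then have "(pr (Dom F g) k \<cdot> t) \<cdot> s \<in> Wellfounded.acc subterm_rel"
          using k(1) 1(7) by - (rule 1(2)[where i = "Dom F g ! k"], simp_all)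
        then show "y \<in> Wellfounded.acc subterm_rel"
          using k by simp
      qed
    qed
  qed
  have gen: "g \<in> Wellfounded.acc subterm_rel" if g: "generator g" for g
  proof (rule accI)
    fix y assume y: "(y, g) \<in> subterm_rel"
    have [simp]: "g \<in> Arr F"
      using g by (auto elim: generatorE)
    have "(y, g \<cdot> Ident F (Dom F g)) \<in> subterm_rel"
      using y by simp
    then obtain k where "k < length (Dom F g)" "y = pr (Dom F g) k \<cdot> Ident F (Dom F g)"
      by (rule subterm_relD) (use g in auto)
    then show "y \<in> Wellfounded.acc subterm_rel"
      using acc_pr by simp
  qed
  fix f
  show "f \<in> Wellfounded.acc subterm_rel"
  proof (cases "\<exists>g t. generator g \<and> t \<in> Arr F \<and> Cod F t = Dom F g \<and> f = g \<cdot> t")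
    case True
    then obtain g t where gt: "generator g" "t \<in> Arr F" "Cod F t = Dom F g" "f = g \<cdot> t"
      by blast
    obtain i where i: "i \<in> I" "Cod F g = [i]"
      using gt(1) by (rule generatorE)
    have f: "f \<in> Arr F" "Cod F f = [i]"
      using gt i by simp_all
    show ?thesis
    proof (rule generation_induct[OF f(1) i(1) f(2)])
      fix f s i
      assume fs: "f \<in> Arr F" "Cod F f = [i]" "s \<in> Arr F" "Cod F s = Dom F f"
        and f: "f \<in> Wellfounded.acc subterm_rel"
        and s: "\<And>k. k < length (Dom F f) \<Longrightarrow> pr (Dom F f) k \<cdot> s \<in> Wellfounded.acc subterm_rel"
      show "f \<cdot> s \<in> Wellfounded.acc subterm_rel"
        by (rule subst[OF f fs s])
    qed (fact acc_pr gen)+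
  next
    case False
    then have "(y, f) \<notin> subterm_rel" for y
      unfolding subterm_rel_def by blast
    then show ?thesis
      by (blast intro: accI)
  qed
qed

end

section \<open>The cochain complex of a natural system\<close>

lemma (in comm_monoid) finprod_Times:
  assumes "finite A" "finite B" "\<And>i j. i \<in> A \<Longrightarrow> j \<in> B \<Longrightarrow> f i j \<in> carrier G"
  shows "(\<Otimes>i\<in>A. \<Otimes>j\<in>B. f i j) = finprod G (\<lambda>(i, j). f i j) (A \<times> B)"
proof -
  have "(\<Otimes>i\<in>A. \<Otimes>j\<in>B. f i j) = (\<Otimes>i\<in>A. finprod G (\<lambda>(i, j). f i j) ({i} \<times> B))"
  proof (rule finprod_cong')
    fix i assume i: "i \<in> A"
    have "{i} \<times> B = Pair i ` B"
      by blast
    moreover have "finprod G (\<lambda>(i, j). f i j) (Pair i ` B) = (\<Otimes>j\<in>B. f i j)"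
      using assms(3)[OF i] by (subst finprod_reindex) (auto simp: inj_on_def)
    ultimately show "(\<Otimes>j\<in>B. f i j) = (finprod G (\<lambda>(i, j). f i j) ({i} \<times> B))"
      by simp
  qed (use assms in \<open>auto intro!: finprod_closed\<close>)
  also have "\<dots> = finprod G (\<lambda>(i, j). f i j) (\<Union>i\<in>A. {i} \<times> B)"
    using assms by (intro finprod_UN_disjoint[symmetric]) (auto simp: pairwise_def disjnt_def)
  also have "(\<Union>i\<in>A. {i} \<times> B) = A \<times> B"
    by blast
  finally show ?thesis .
qed

lemma (in comm_group) finprod_int_pow:
  assumes "\<And>i. i \<in> A \<Longrightarrow> f i \<in> carrier G"
  shows "(\<Otimes>i\<in>A. f i) [^] (k :: int) = (\<Otimes>i\<in>A. f i [^] k)"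
  using assms
  by (induction A rule: infinite_finite_induct) (auto simp: int_pow_distrib Pi_iff)

lemma hom_finprod:
  assumes "h \<in> hom G H" "comm_group G" "comm_group H" "\<And>i. i \<in> A \<Longrightarrow> f i \<in> carrier G"
  shows "h (finprod G f A) = finprod H (\<lambda>i. h (f i)) A"
proof -
  interpret G: comm_group G by (rule assms(2))
  interpret H: comm_group H by (rule assms(3))
  have one: "h \<one>\<^bsub>G\<^esub> = \<one>\<^bsub>H\<^esub>"
    by (rule hom_one[OF assms(1)]) unfold_locales
  show ?thesis
    using assms(4)
  proof (induction A rule: infinite_finite_induct)
    case (insert i A)
    then show ?case
      using hom_mult[OF assms(1)] hom_in_carrier[OF assms(1)] by (simp add: Pi_iff)
  qed (simp_all add: one)
qed

text \<open>
  The cancellation behind \<open>d \<circ> d = 0\<close>: the terms with \<open>j < i\<close> are, up to the sign, those with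
  \<open>i \<le> j\<close>, in the order \<open>(i, j) \<mapsto> (j + 1, i)\<close>.
\<close>

lemma (in comm_group) alternating_double_product:
  assumes y: "\<And>i j. i \<le> Suc n \<Longrightarrow> j \<le> n \<Longrightarrow> y i j \<in> carrier G"
    and swap: "\<And>i j. j < i \<Longrightarrow> i \<le> Suc n \<Longrightarrow> y i j = y j (i - 1)"
  shows "(\<Otimes>i\<in>{..Suc n}. (\<Otimes>j\<in>{..n}. y i j [^] ((- 1) ^ j :: int)) [^] ((- 1) ^ i :: int)) = \<one>"
proof -
  define z where "z = (\<lambda>(i, j). y i j [^] ((- 1) ^ (i + j) :: int))"
  have z: "z (i, j) \<in> carrier G" if "i \<le> Suc n" "j \<le> n" for i j
    using y that by (simp add: z_def)
  define L where "L = {(i, j). j \<le> n \<and> i \<le> j}"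
  define \<tau> where "\<tau> = (\<lambda>(i, j). (Suc j, i :: nat))"
  have LU: "L \<subseteq> {..Suc n} \<times> {..n}"
    by (auto simp: L_def)
  then have fin: "finite L"
    by (rule finite_subset) simp
  have U: "{..Suc n} \<times> {..n} = L \<union> \<tau> ` L"
  proof (intro equalityI subsetI)
    fix p assume p: "p \<in> {..Suc n} \<times> {..n}"
    obtain i j where ij: "p = (i, j)"
      by force
    show "p \<in> L \<union> \<tau> ` L"
    proof (cases "i \<le> j")
      case True
      then show ?thesis
        using p ij by (auto simp: L_def)
    next
      case False
      then have "p = \<tau> (j, i - 1)" "(j, i - 1) \<in> L"
        using p ij by (auto simp: L_def \<tau>_def)
      then show ?thesis
        by blast
    qed
  qed (auto simp: L_def \<tau>_def)
  have zL: "z \<in> L \<rightarrow> carrier G" and zT: "z \<in> \<tau> ` L \<rightarrow> carrier G"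
    using z by (auto simp: L_def \<tau>_def)
  have "(\<Otimes>i\<in>{..Suc n}. (\<Otimes>j\<in>{..n}. y i j [^] ((- 1) ^ j :: int)) [^] ((- 1) ^ i :: int)) =
      (\<Otimes>i\<in>{..Suc n}. \<Otimes>j\<in>{..n}. z (i, j))"
  proof (rule finprod_cong')
    fix i assume i: "i \<in> {..Suc n}"
    have "(\<Otimes>j\<in>{..n}. y i j [^] ((- 1) ^ j :: int)) [^] ((- 1) ^ i :: int) =
        (\<Otimes>j\<in>{..n}. (y i j [^] ((- 1) ^ j :: int)) [^] ((- 1) ^ i :: int))"
      using y i by (intro finprod_int_pow) auto
    also have "\<dots> = (\<Otimes>j\<in>{..n}. z (i, j))"
      using y i
      by (intro finprod_cong') (auto simp: z_def int_pow_pow power_add mult.commute)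
    finally show "(\<Otimes>j\<in>{..n}. y i j [^] ((- 1) ^ j :: int)) [^] ((- 1) ^ i :: int) =
        (\<Otimes>j\<in>{..n}. z (i, j))" .
  qed (use z in \<open>auto intro!: finprod_closed\<close>)
  also have "\<dots> = finprod G (\<lambda>(i, j). z (i, j)) ({..Suc n} \<times> {..n})"
    using z by (intro finprod_Times) auto
  also have "\<dots> = finprod G z (L \<union> \<tau> ` L)"
    by (simp add: U)
  also have "\<dots> = finprod G z L \<otimes> finprod G z (\<tau> ` L)"
    using fin zL zT by (intro finprod_Un_disjoint) (auto simp: L_def \<tau>_def)
  also have "finprod G z (\<tau> ` L) = finprod G (\<lambda>p. z (\<tau> p)) L"
    using zT by (intro finprod_reindex) (auto simp: inj_on_def \<tau>_def)
  also have "\<dots> = finprod G (\<lambda>p. inv (z p)) L"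
  proof (rule finprod_cong')
    fix p assume p: "p \<in> L"
    obtain i j where ij: "p = (i, j)" "i \<le> j" "j \<le> n"
      using p by (auto simp: L_def)
    then have "y (Suc j) i = y i j"
      using swap[of i "Suc j"] by simp
    then show "z (\<tau> p) = inv (z p)"
      using ij y by (simp add: z_def \<tau>_def int_pow_neg add.commute)
  qed (use zL in auto)
  also have "finprod G z L \<otimes> \<dots> = finprod G (\<lambda>p. z p \<otimes> inv (z p)) L"
    using zL by (intro finprod_multf[symmetric]) auto
  also have "\<dots> = \<one>"
    by (intro finprod_one_eqI r_inv funcset_mem[OF zL])
  finally show ?thesis .
qed

text \<open>
  \<open>merge\<close> by recursion on the string, so that the identities between iterated faces are proved by
  induction.
\<close>

fun merge_list :: "('o, 'a) cat \<Rightarrow> nat \<Rightarrow> 'a list \<Rightarrow> 'a list" where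
  "merge_list C (Suc 0) (a # b # as) = (a \<cdot>\<^bsub>C\<^esub> b) # as"
| "merge_list C (Suc (Suc i)) (a # as) = a # merge_list C (Suc i) as"
| "merge_list C _ as = as"

lemma merge_eq_merge_list:
  assumes "0 < i" "i < length as"
  shows "merge C i (A, as) = (A, merge_list C i as)"
proof -
  have "take (i - 1) as @ [as ! (i - 1) \<cdot>\<^bsub>C\<^esub> as ! i] @ drop (i + 1) as = merge_list C i as"
    using assms
  proof (induction C i as rule: merge_list.induct)
    case (2 C i a as)
    then show ?case
      by (cases i) simp_all
  qed simp_all
  then show ?thesis
    by (simp add: merge_def)
qed

lemma length_merge_list [simp]:
  "0 < i \<Longrightarrow> i < length as \<Longrightarrow> length (merge_list C i as) = length as - 1"
  by (induction C i as rule: merge_list.induct) auto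

lemma butlast_merge_list:
  "0 < i \<Longrightarrow> Suc i < length as \<Longrightarrow> butlast (merge_list C i as) = merge_list C i (butlast as)"
  "0 < i \<Longrightarrow> Suc i < length as \<Longrightarrow> last (merge_list C i as) = last as"
proof (induction C i as rule: merge_list.induct)
  case (2 C i a as)
  { case 1
    with 2 have "merge_list C (Suc i) as \<noteq> []"
      by (auto simp flip: length_0_conv)
    with 1 2 show ?case by auto
  next
    case 2
    with "2.IH" have "merge_list C (Suc i) as \<noteq> []"
      by (auto simp flip: length_0_conv)
    with 2 "2.IH" show ?case by auto
  }
qed auto

lemma last_merge_list:
  "length as = Suc (Suc n) \<Longrightarrow> butlast (merge_list C (Suc n) as) = butlast (butlast as)"
  "length as = Suc (Suc n) \<Longrightarrow>
    last (merge_list C (Suc n) as) = last (butlast as) \<cdot>\<^bsub>C\<^esub> last as"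
proof (induction n arbitrary: as)
  case (Suc n)
  { case 1
    then obtain a as' where "as = a # as'" "length as' = Suc (Suc n)"
      by (auto simp: length_Suc_conv)
    then show ?case
      using Suc(1)[of as'] length_merge_list[of "Suc n" as' C]
      by (auto simp flip: length_0_conv)
  next
    case 2
    then obtain a as' where "as = a # as'" "length as' = Suc (Suc n)"
      by (auto simp: length_Suc_conv)
    then show ?case
      using Suc(2)[of as'] length_merge_list[of "Suc n" as' C]
      by (auto simp flip: length_0_conv)
  }
qed (auto simp: length_Suc_conv)

context small_category
begin

lemma composite_arr [simp]:
  "composable C A as \<Longrightarrow> composite C (A, as) \<in> Arr C"
  "composable C A as \<Longrightarrow> Cod C (composite C (A, as)) = A"
  by (induction as arbitrary: A) auto

lemma composable_snoc:
  "composable C A (as @ [a]) \<longleftrightarrow>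
     composable C A as \<and> a \<in> Arr C \<and> Cod C a = Dom C (composite C (A, as))"
proof (induction as arbitrary: A)
  case (Cons b as)
  then show ?case
    by (simp cong: conj_cong)
qed auto

lemma composite_snoc:
  "composable C A (as @ [a]) \<Longrightarrow> composite C (A, as @ [a]) = composite C (A, as) \<cdot> a"
proof (induction as arbitrary: A)
  case (Cons b as)
  then show ?case
    by (simp add: composable_snoc)
qed auto

lemma composable_merge_list:
  assumes "composable C A as" "0 < i" "i < length as"
  shows "composable C A (merge_list C i as)"
    and "composite C (A, merge_list C i as) = composite C (A, as)"
proof -
  have "composable C A (merge_list C i as) \<and> composite C (A, merge_list C i as) = composite C (A, as)"
    using assms
  proof (induction as arbitrary: A i)
    case (Cons a as)
    then obtain b bs where as: "as = b # bs"
      by (cases as) auto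
    consider "i = Suc 0" | k where "i = Suc (Suc k)"
      using Cons.prems(2) by (metis gr0_implies_Suc nat.exhaust)
    then show ?case
    proof cases
      case 1
      then show ?thesis
        using Cons.prems(1) as by simp
    next
      case 2
      then show ?thesis
        using Cons.prems Cons.IH[of "Dom C a" "Suc k"] by simp
    qed
  qed simp
  then show "composable C A (merge_list C i as)"
    and "composite C (A, merge_list C i as) = composite C (A, as)"
    by simp_all
qed

lemma merge_merge_list:
  assumes "0 < j" "j < i" "i < length as" "composable C A as"
  shows "merge_list C j (merge_list C i as) = merge_list C (i - 1) (merge_list C j as)"
  using assms
proof (induction as arbitrary: A i j)
  case (Cons a as)
  then obtain b as' where as: "as = b # as'"
    by (cases as) auto
  obtain i' where i: "i = Suc (Suc i')"
    using le_Suc_ex[of 2 i] Cons.prems(1,2) by auto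
  show ?case
  proof (cases j)
    case (Suc j')
    show ?thesis
    proof (cases j')
      case 0
      show ?thesis
      proof (cases i')
        case 0
        with Cons.prems as obtain c as'' where "as' = c # as''"
          by (cases as') (auto simp: i)
        then show ?thesis
          using Cons.prems as 0 \<open>j' = 0\<close> Suc by (simp add: i)
      next
        case (Suc k)
        with \<open>j' = 0\<close> \<open>j = Suc j'\<close> Cons.prems as show ?thesis
          by (simp add: i)
      qed
    next
      case (Suc k)
      with \<open>j = Suc j'\<close> i Cons.prems Cons.IH[of "Suc k" "Suc i'" "Dom C a"] show ?thesis
        by (cases i') auto
    qed
  qed (use Cons.prems in simp)
qed simp

end

lemma stringsE:
  assumes "s \<in> strings C n"
  obtains A as where "s = (A, as)" "composable C A as" "length as = n"
  using assms by (auto simp: strings_def)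

context small_category
begin

lemma drop_first_string:
  assumes "s \<in> strings C (Suc n)"
  shows "drop_first C s \<in> strings C n" "hd (snd s) \<in> Arr C"
    and "Dom C (hd (snd s)) = Cod C (composite C (drop_first C s))"
    and "composite C s = hd (snd s) \<cdot> composite C (drop_first C s)"
  using assms by (auto simp: strings_def drop_first_def length_Suc_conv)

lemma drop_last_string:
  assumes "s \<in> strings C (Suc n)"
  shows "drop_last s \<in> strings C n" "last (snd s) \<in> Arr C"
    and "Cod C (last (snd s)) = Dom C (composite C (drop_last s))"
    and "composite C s = composite C (drop_last s) \<cdot> last (snd s)"
proof -
  obtain A as where s: "s = (A, as)" "composable C A as" "length as = Suc n"
    using assms by (rule stringsE)
  then obtain as' a where as: "as = as' @ [a]"
    by (metis length_Suc_conv_rev)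
  show "drop_last s \<in> strings C n" "last (snd s) \<in> Arr C"
    and "Cod C (last (snd s)) = Dom C (composite C (drop_last s))"
    and "composite C s = composite C (drop_last s) \<cdot> last (snd s)"
    using s as composite_snoc by (auto simp: strings_def drop_last_def composable_snoc)
qed

lemma merge_string:
  assumes "s \<in> strings C (Suc n)" "0 < i" "i \<le> n"
  shows "merge C i s \<in> strings C n" "composite C (merge C i s) = composite C s"
proof -
  obtain A as where s: "s = (A, as)" "composable C A as" "length as = Suc n"
    using assms(1) by (rule stringsE)
  then show "merge C i s \<in> strings C n" "composite C (merge C i s) = composite C s"
    using composable_merge_list[of A as i] assms
    by (simp_all add: merge_eq_merge_list strings_def)
qed

lemma composite_string [simp]: "s \<in> strings C n \<Longrightarrow> composite C s \<in> Arr C"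
  by (auto simp: strings_def)

end

locale natural_system_on = small_category C
  for C :: "('o, 'a) cat" (structure) +
  fixes D :: "'a \<Rightarrow> 'd monoid" and T :: "'a \<times> 'a \<times> 'a \<Rightarrow> 'd \<Rightarrow> 'd"
  assumes natural_system: "natural_system C D T"
begin

lemma ab: "f \<in> Arr C \<Longrightarrow> comm_group (D f)"
  using natural_system by (simp add: natural_system_def Ab_functor_def factorizations_def)

lemma T_hom:
  "f \<in> Arr C \<Longrightarrow> a \<in> Arr C \<Longrightarrow> b \<in> Arr C \<Longrightarrow> Cod C a = Dom C f \<Longrightarrow> Dom C b = Cod C f \<Longrightarrow>
    T (f, a, b) \<in> hom (D f) (D (b \<cdot> f \<cdot> a))"
  using natural_system
  unfolding natural_system_def Ab_functor_def
  by (elim conjE, drule_tac x = "(f, a, b)" in bspec) (auto simp: factorizations_def)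

lemma T_ident:
  "f \<in> Arr C \<Longrightarrow> x \<in> carrier (D f) \<Longrightarrow> T (f, Ident C (Dom C f), Ident C (Cod C f)) x = x"
  using natural_system by (simp add: natural_system_def Ab_functor_def factorizations_def)

lemma T_comp:
  assumes "f \<in> Arr C" "a \<in> Arr C" "b \<in> Arr C" "Cod C a = Dom C f" "Dom C b = Cod C f"
    and "a' \<in> Arr C" "b' \<in> Arr C" "Cod C a' = Dom C a" "Dom C b' = Cod C b" "x \<in> carrier (D f)"
  shows "T (f, a \<cdot> a', b' \<cdot> b) x = T (b \<cdot> f \<cdot> a, a', b') (T (f, a, b) x)"
proof -
  let ?FC = "factorizations C"
  have *: "\<forall>u\<in>Arr ?FC. \<forall>v\<in>Arr ?FC. Dom ?FC v = Cod ?FC u \<longrightarrow>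
    (\<forall>x\<in>carrier (D (Dom ?FC u)). T (v \<cdot>\<^bsub>?FC\<^esub> u) x = T v (T u x))"
    using natural_system unfolding natural_system_def Ab_functor_def by blast
  have u: "(f, a, b) \<in> Arr ?FC" and v: "(b \<cdot> f \<cdot> a, a', b') \<in> Arr ?FC"
    and d: "Dom ?FC (b \<cdot> f \<cdot> a, a', b') = Cod ?FC (f, a, b)" "x \<in> carrier (D (Dom ?FC (f, a, b)))"
    using assms by (simp_all add: factorizations_def)
  show ?thesis
    using *[rule_format, OF u v d] by (simp add: factorizations_def)
qed

abbreviation lact where "lact \<equiv> left_act C T"
abbreviation ract where "ract \<equiv> right_act C T"

lemma lact_hom: "f \<in> Arr C \<Longrightarrow> b \<in> Arr C \<Longrightarrow> Dom C b = Cod C f \<Longrightarrow> lact b f \<in> hom (D f) (D (b \<cdot> f))"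
  using T_hom[of f "Ident C (Dom C f)" b] by (simp add: left_act_def)

lemma ract_hom: "f \<in> Arr C \<Longrightarrow> a \<in> Arr C \<Longrightarrow> Cod C a = Dom C f \<Longrightarrow> ract f a \<in> hom (D f) (D (f \<cdot> a))"
  using T_hom[of f a "Ident C (Cod C f)"] by (simp add: right_act_def)

lemma lact_ident: "f \<in> Arr C \<Longrightarrow> x \<in> carrier (D f) \<Longrightarrow> lact (Ident C (Cod C f)) f x = x"
  by (simp add: left_act_def T_ident)

lemma lact_comp:
  "f \<in> Arr C \<Longrightarrow> b \<in> Arr C \<Longrightarrow> c \<in> Arr C \<Longrightarrow> Dom C b = Cod C f \<Longrightarrow> Dom C c = Cod C b \<Longrightarrow>
    x \<in> carrier (D f) \<Longrightarrow> lact (c \<cdot> b) f x = lact c (b \<cdot> f) (lact b f x)"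
  using T_comp[of f "Ident C (Dom C f)" b "Ident C (Dom C f)" c x] by (simp add: left_act_def)

lemma ract_comp:
  "f \<in> Arr C \<Longrightarrow> a \<in> Arr C \<Longrightarrow> a' \<in> Arr C \<Longrightarrow> Cod C a = Dom C f \<Longrightarrow> Cod C a' = Dom C a \<Longrightarrow>
    x \<in> carrier (D f) \<Longrightarrow> ract f (a \<cdot> a') x = ract (f \<cdot> a) a' (ract f a x)"
  using T_comp[of f a "Ident C (Cod C f)" a' "Ident C (Cod C f)" x] by (simp add: right_act_def)

lemma lact_ract:
  "f \<in> Arr C \<Longrightarrow> a \<in> Arr C \<Longrightarrow> b \<in> Arr C \<Longrightarrow> Cod C a = Dom C f \<Longrightarrow> Dom C b = Cod C f \<Longrightarrow>
    x \<in> carrier (D f) \<Longrightarrow> lact b (f \<cdot> a) (ract f a x) = ract (b \<cdot> f) a (lact b f x)"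
  using T_comp[of f a "Ident C (Cod C f)" "Ident C (Dom C a)" b x]
    T_comp[of f "Ident C (Dom C f)" b a "Ident C (Cod C b)" x]
  by (simp add: left_act_def right_act_def)

abbreviation cochains :: "nat \<Rightarrow> ('o \<times> 'a list \<Rightarrow> 'd) set" where
  "cochains n \<equiv> carrier (cochain_group C D n)"

lemma cochain_closed:
  "\<phi> \<in> cochains n \<Longrightarrow> s \<in> strings C n \<Longrightarrow> \<phi> s \<in> carrier (D (composite C s))"
  by (auto simp: cochain_group_def)

lemma group_cochain: "group (cochain_group C D n)"
  unfolding cochain_group_def
  using ab by (intro product_group) (auto simp: comm_group_def)

lemma cochain_eqI:
  assumes "\<phi> \<in> cochains n" "\<psi> \<in> cochains n" "\<And>s. s \<in> strings C n \<Longrightarrow> \<phi> s = \<psi> s"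
  shows "\<phi> = \<psi>"
  using assms by (auto simp: cochain_group_def intro: PiE_ext)

text \<open>
  The coboundary is the alternating product of \<open>n + 2\<close> cofaces. Giving the three kinds of factors
  one name turns \<open>d \<circ> d = 0\<close> into the cosimplicial identity \<open>coface_coface\<close>.
\<close>

definition coface :: "nat \<Rightarrow> nat \<Rightarrow> ('o \<times> 'a list \<Rightarrow> 'd) \<Rightarrow> 'o \<times> 'a list \<Rightarrow> 'd" where
  "coface n i \<phi> s =
     (if i = 0 then lact (hd (snd s)) (composite C (drop_first C s)) (\<phi> (drop_first C s))
      else if i = Suc n then ract (composite C (drop_last s)) (last (snd s)) (\<phi> (drop_last s))
      else \<phi> (merge C i s))"

text \<open>
  All cofaces have the same shape: evaluate at a face of the string and apply a homomorphism. For
  the inner faces this homomorphism is the identity, since composing two neighbours does not change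
  the composite of the string.
\<close>

lemma coface_as_hom:
  assumes s: "s \<in> strings C (Suc n)" and i: "i \<le> Suc n"
  obtains h s' where "s' \<in> strings C n" "h \<in> hom (D (composite C s')) (D (composite C s))"
    "\<And>\<phi>. coface n i \<phi> s = h (\<phi> s')"
proof -
  note f = drop_first_string[OF s] and l = drop_last_string[OF s] and m = merge_string[OF s, of i]
  consider "i = 0" | "i = Suc n" | "0 < i" "i \<le> n"
    using i by linarith
  then show ?thesis
  proof cases
    case 1
    show ?thesis
      by (rule that[OF f(1) lact_hom[OF composite_string[OF f(1)] f(2,3), folded f(4)]])
         (simp add: coface_def 1)
  next
    case 2
    show ?thesis
      by (rule that[OF l(1) ract_hom[OF composite_string[OF l(1)] l(2,3), folded l(4)]])
         (simp add: coface_def 2)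
  next
    case 3
    show ?thesis
      by (rule that[of "merge C i s" "\<lambda>x. x"]) (use 3 m in \<open>simp_all add: coface_def hom_def\<close>)
  qed
qed

lemma coface_closed:
  assumes "\<And>s. s \<in> strings C n \<Longrightarrow> \<phi> s \<in> carrier (D (composite C s))"
    and "s \<in> strings C (Suc n)" "i \<le> Suc n"
  shows "coface n i \<phi> s \<in> carrier (D (composite C s))"
  using coface_as_hom[OF assms(2,3)] assms(1) hom_in_carrier by metis

lemma coface_mult:
  assumes "\<phi> \<in> cochains n" "\<psi> \<in> cochains n" and "s \<in> strings C (Suc n)" "i \<le> Suc n"
  shows "coface n i (\<phi> \<otimes>\<^bsub>cochain_group C D n\<^esub> \<psi>) s =
    coface n i \<phi> s \<otimes>\<^bsub>D (composite C s)\<^esub> coface n i \<psi> s"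
proof -
  obtain h s' where h: "s' \<in> strings C n" "h \<in> hom (D (composite C s')) (D (composite C s))"
    "\<And>\<phi>. coface n i \<phi> s = h (\<phi> s')"
    using coface_as_hom[OF assms(3,4)] by metis
  then show ?thesis
    using hom_mult[OF h(2)] cochain_closed[OF assms(1) h(1)] cochain_closed[OF assms(2) h(1)]
    by (simp add: cochain_group_def)
qed

lemma coboundary_eq:
  assumes \<phi>: "\<phi> \<in> cochains n" and s: "s \<in> strings C (Suc n)"
  shows "coboundary C D T n \<phi> s =
    (\<Otimes>\<^bsub>D (composite C s)\<^esub>i\<in>{..Suc n}. coface n i \<phi> s [^]\<^bsub>D (composite C s)\<^esub> ((- 1) ^ i :: int))"
proof -
  interpret G: comm_group "D (composite C s)"
    by (rule ab) (simp add: composite_string[OF s])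
  let ?G = "D (composite C s)"
  let ?t = "\<lambda>i. coface n i \<phi> s [^]\<^bsub>?G\<^esub> ((- 1) ^ i :: int)"
  have c: "coface n i \<phi> s \<in> carrier ?G" if "i \<le> Suc n" for i
    using coface_closed[OF cochain_closed[OF \<phi>] s that] .
  have "finprod ?G ?t {..Suc n} = ?t 0 \<otimes>\<^bsub>?G\<^esub> finprod ?G ?t {1..n} \<otimes>\<^bsub>?G\<^esub> ?t (Suc n)"
  proof -
    have "finprod ?G ?t {..Suc n} = ?t (Suc n) \<otimes>\<^bsub>?G\<^esub> finprod ?G ?t {..n}"
      using c by (intro G.finprod_Suc) auto
    moreover have "finprod ?G ?t {..n} = ?t 0 \<otimes>\<^bsub>?G\<^esub> finprod ?G ?t {1..n}"
    proof -
      have "{..n} = insert 0 {1..n}"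
        by auto
      then show ?thesis
        using c by simp
    qed
    ultimately show ?thesis
      using c by (simp add: G.m_comm G.finprod_closed)
  qed
  moreover have "finprod ?G ?t {1..n} =
      (\<Otimes>\<^bsub>?G\<^esub>i\<in>{1..n}. \<phi> (merge C i s) [^]\<^bsub>?G\<^esub> ((- 1) ^ i :: int))"
  proof (rule G.finprod_cong')
    show "(\<lambda>i. \<phi> (merge C i s) [^]\<^bsub>?G\<^esub> ((- 1) ^ i :: int)) \<in> {1..n} \<rightarrow> carrier ?G"
      using cochain_closed[OF \<phi> merge_string(1)[OF s]] merge_string(2)[OF s] by auto
  qed (auto simp: coface_def)
  moreover have "?t 0 = coface n 0 \<phi> s"
    using c[of 0] by simp
  ultimately show ?thesis
    using s by (simp add: coboundary_def Let_def coface_def)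
qed

lemma coboundary_closed:
  assumes \<phi>: "\<phi> \<in> cochains n"
  shows "coboundary C D T n \<phi> \<in> cochains (Suc n)"
proof -
  have "coboundary C D T n \<phi> s \<in> carrier (D (composite C s))" if s: "s \<in> strings C (Suc n)" for s
  proof -
    interpret G: comm_group "D (composite C s)"
      by (rule ab) (simp add: composite_string[OF s])
    show ?thesis
      unfolding coboundary_eq[OF \<phi> s]
      using coface_closed[OF cochain_closed[OF \<phi>] s] by (intro G.finprod_closed) auto
  qed
  then show ?thesis
    by (auto simp: cochain_group_def coboundary_def Let_def)
qed

lemma coboundary_hom: "coboundary C D T n \<in> hom (cochain_group C D n) (cochain_group C D (Suc n))"
proof (rule homI)
  show "coboundary C D T n \<phi> \<in> cochains (Suc n)" if "\<phi> \<in> cochains n" for \<phi>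
    using that by (rule coboundary_closed)
  fix \<phi> \<psi> assume \<phi>: "\<phi> \<in> cochains n" and \<psi>: "\<psi> \<in> cochains n"
  let ?d = "coboundary C D T n"
  interpret N: group "cochain_group C D n" by (rule group_cochain)
  interpret N': group "cochain_group C D (Suc n)" by (rule group_cochain)
  show "?d (\<phi> \<otimes>\<^bsub>cochain_group C D n\<^esub> \<psi>) = ?d \<phi> \<otimes>\<^bsub>cochain_group C D (Suc n)\<^esub> ?d \<psi>"
  proof (rule cochain_eqI)
    show "?d (\<phi> \<otimes>\<^bsub>cochain_group C D n\<^esub> \<psi>) \<in> cochains (Suc n)"
      using \<phi> \<psi> by (intro coboundary_closed N.m_closed)
    show "?d \<phi> \<otimes>\<^bsub>cochain_group C D (Suc n)\<^esub> ?d \<psi> \<in> cochains (Suc n)"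
      using \<phi> \<psi> by (intro coboundary_closed N'.m_closed)
    fix s assume s: "s \<in> strings C (Suc n)"
    interpret G: comm_group "D (composite C s)"
      by (rule ab) (simp add: composite_string[OF s])
    let ?G = "D (composite C s)"
    note c = coface_closed[OF cochain_closed[OF \<phi>] s] coface_closed[OF cochain_closed[OF \<psi>] s]
    have "?d (\<phi> \<otimes>\<^bsub>cochain_group C D n\<^esub> \<psi>) s =
      (\<Otimes>\<^bsub>?G\<^esub>i\<in>{..Suc n}. coface n i \<phi> s [^]\<^bsub>?G\<^esub> ((- 1) ^ i :: int) \<otimes>\<^bsub>?G\<^esub>
         coface n i \<psi> s [^]\<^bsub>?G\<^esub> ((- 1) ^ i :: int))"
      unfolding coboundary_eq[OF N.m_closed[OF \<phi> \<psi>] s]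
      using c by (intro G.finprod_cong') (auto simp: coface_mult[OF \<phi> \<psi> s] G.int_pow_distrib)
    also have "\<dots> = ?d \<phi> s \<otimes>\<^bsub>?G\<^esub> ?d \<psi> s"
      unfolding coboundary_eq[OF \<phi> s] coboundary_eq[OF \<psi> s]
      using c by (intro G.finprod_multf) auto
    finally show "?d (\<phi> \<otimes>\<^bsub>cochain_group C D n\<^esub> \<psi>) s =
        (?d \<phi> \<otimes>\<^bsub>cochain_group C D (Suc n)\<^esub> ?d \<psi>) s"
      using s by (simp add: cochain_group_def)
  qed
qed

text \<open>
  The inner faces commute by associativity. Where the first or the last arrow is involved, the
  identity expresses that the left and the right action are functorial and commute.
\<close>

lemma coface_coface:
  assumes \<phi>: "\<phi> \<in> cochains n" and s: "s \<in> strings C (Suc (Suc n))"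
    and ji: "j < i" "i \<le> Suc (Suc n)"
  shows "coface (Suc n) i (coface n j \<phi>) s = coface (Suc n) j (coface n (i - 1) \<phi>) s"
proof -
  obtain A as where sA: "s = (A, as)" "composable C A as" "length as = Suc (Suc n)"
    using s by (rule stringsE)
  then obtain a b bs where as: "as = a # b # bs"
    by (auto simp: length_Suc_conv)
  note f = drop_first_string[OF s] and l = drop_last_string[OF s]
  note ff = drop_first_string[OF f(1)] and fl = drop_last_string[OF f(1)]
    and lf = drop_first_string[OF l(1)] and ll = drop_last_string[OF l(1)]
  have comm: "drop_first C (drop_last s) = drop_last (drop_first C s)"
    using sA as by (simp add: drop_first_def drop_last_def)
  have hdl: "hd (snd (drop_last s)) = hd (snd s)" and lastf: "last (snd (drop_first C s)) = last (snd s)"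
    using sA as by (simp_all add: drop_first_def drop_last_def)
  consider (a) "j = 0" "i = 1" | (b) "j = 0" "1 < i" "i \<le> Suc n" | (c) "j = 0" "i = Suc (Suc n)"
    | (d) "0 < j" "i \<le> Suc n" | (e) "0 < j" "j < Suc n" "i = Suc (Suc n)"
    | (f) "j = Suc n" "i = Suc (Suc n)"
    using ji by linarith
  then show ?thesis
  proof cases
    case a
    have ab: "a \<in> Arr C" "b \<in> Arr C" "Cod C b = Dom C a" "composable C (Dom C b) bs"
      "length bs = n"
      using sA as by auto
    then have "\<phi> (Dom C b, bs) \<in> carrier (D (composite C (Dom C b, bs)))"
      by (intro cochain_closed[OF \<phi>]) (simp add: strings_def)
    then have "lact (a \<cdot> b) (composite C (Dom C b, bs)) (\<phi> (Dom C b, bs)) =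
      lact a (b \<cdot> composite C (Dom C b, bs)) (lact b (composite C (Dom C b, bs)) (\<phi> (Dom C b, bs)))"
      using ab by (intro lact_comp) simp_all
    moreover have "merge C 1 s = (A, (a \<cdot> b) # bs)"
      using sA as by (simp add: merge_def)
    ultimately show ?thesis
      using a ab(1-3) sA(1) as by (simp add: coface_def drop_first_def)
  next
    case b
    then obtain k where k: "i = Suc (Suc k)"
      using le_Suc_ex[of 2 i] by auto
    have "merge C i s = (A, a # merge_list C (Suc k) (b # bs))"
      "merge C (Suc k) (drop_first C s) = (Dom C a, merge_list C (Suc k) (b # bs))"
      using sA as b k by (simp_all add: merge_eq_merge_list drop_first_def)
    moreover have "composite C (Dom C a, merge_list C (Suc k) (b # bs)) = composite C (Dom C a, b # bs)"
      using sA as b k by (intro composable_merge_list) auto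
    ultimately show ?thesis
      using b sA as k by (simp add: coface_def drop_first_def)
  next
    case c
    let ?e = "drop_last (drop_first C s)"
    have "composite C (drop_first C s) = composite C ?e \<cdot> last (snd s)"
      "composite C (drop_last s) = hd (snd s) \<cdot> composite C ?e"
      using fl(4) lf(4) by (simp_all only: comm hdl lastf)
    moreover have "lact (hd (snd s)) (composite C ?e \<cdot> last (snd s))
        (ract (composite C ?e) (last (snd s)) (\<phi> ?e)) =
      ract (hd (snd s) \<cdot> composite C ?e) (last (snd s)) (lact (hd (snd s)) (composite C ?e) (\<phi> ?e))"
    proof (rule lact_ract)
      show "Cod C (last (snd s)) = Dom C (composite C ?e)"
        using fl(3) by (simp only: lastf)
      show "Dom C (hd (snd s)) = Cod C (composite C ?e)"
        using lf(3) by (simp only: comm hdl)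
    qed (use f(2) l(2) fl(1) cochain_closed[OF \<phi> fl(1)] in auto)
    ultimately show ?thesis
      using c by (simp add: coface_def comm hdl lastf)
  next
    case d
    then have "merge C j (merge C i s) = merge C (i - 1) (merge C j s)"
      using sA ji merge_merge_list[of j i as A] by (simp add: merge_eq_merge_list)
    moreover have "i \<noteq> 0" "j \<noteq> 0" "i - 1 \<noteq> 0" "i - 1 \<noteq> Suc n" "i \<noteq> Suc (Suc n)" "j \<noteq> Suc n"
      "j \<noteq> Suc (Suc n)"
      using d ji by simp_all
    ultimately show ?thesis
      by (simp only: coface_def if_False)
  next
    case e
    have "merge C j (drop_last s) = drop_last (merge C j s)" "last (snd (merge C j s)) = last (snd s)"
      using sA e butlast_merge_list[of j as C] by (simp_all add: merge_eq_merge_list drop_last_def)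
    then show ?thesis
      using e merge_string(2)[OF l(1), of j] by (simp add: coface_def)
  next
    case f
    have "drop_last (merge C (Suc n) s) = drop_last (drop_last s)"
      "last (snd (merge C (Suc n) s)) = last (snd (drop_last s)) \<cdot> last (snd s)"
      using sA last_merge_list[of as n C] by (simp_all add: merge_eq_merge_list drop_last_def)
    then show ?thesis
      using f ract_comp[of "composite C (drop_last (drop_last s))" "last (snd (drop_last s))"
          "last (snd s)" "\<phi> (drop_last (drop_last s))"] cochain_closed[OF \<phi> ll(1)] l ll
      by (simp add: coface_def)
  qed
qed

lemma coface_coboundary:
  assumes \<phi>: "\<phi> \<in> cochains n" and s: "s \<in> strings C (Suc (Suc n))" and i: "i \<le> Suc (Suc n)"
  shows "coface (Suc n) i (coboundary C D T n \<phi>) s = (\<Otimes>\<^bsub>D (composite C s)\<^esub>j\<in>{..Suc n}.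
    coface (Suc n) i (coface n j \<phi>) s [^]\<^bsub>D (composite C s)\<^esub> ((- 1) ^ j :: int))"
proof -
  obtain h s' where s': "s' \<in> strings C (Suc n)"
    and h: "h \<in> hom (D (composite C s')) (D (composite C s))"
    and coface: "\<And>\<phi>. coface (Suc n) i \<phi> s = h (\<phi> s')"
    using coface_as_hom[OF s i] by metis
  interpret G: comm_group "D (composite C s)"
    by (rule ab) (simp add: composite_string[OF s])
  interpret G': comm_group "D (composite C s')"
    by (rule ab) (simp add: composite_string[OF s'])
  have c: "coface n j \<phi> s' \<in> carrier (D (composite C s'))" if "j \<le> Suc n" for j
    using coface_closed[OF cochain_closed[OF \<phi>] s' that] .
  have "h (coboundary C D T n \<phi> s') = (\<Otimes>\<^bsub>D (composite C s)\<^esub>j\<in>{..Suc n}.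
      h (coface n j \<phi> s' [^]\<^bsub>D (composite C s')\<^esub> ((- 1) ^ j :: int)))"
    unfolding coboundary_eq[OF \<phi> s']
    using c by (intro hom_finprod[OF h]) (auto intro: G.comm_group_axioms G'.comm_group_axioms)
  also have "\<dots> = (\<Otimes>\<^bsub>D (composite C s)\<^esub>j\<in>{..Suc n}.
      h (coface n j \<phi> s') [^]\<^bsub>D (composite C s)\<^esub> ((- 1) ^ j :: int))"
    using c hom_int_pow[OF h] hom_in_carrier[OF h]
    by (intro G.finprod_cong') (auto simp: G.is_group G'.is_group)
  finally show ?thesis
    by (simp add: coface)
qed

lemma coboundary_coboundary:
  assumes \<phi>: "\<phi> \<in> cochains n"
  shows "coboundary C D T (Suc n) (coboundary C D T n \<phi>) = \<one>\<^bsub>cochain_group C D (Suc (Suc n))\<^esub>"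
proof (rule cochain_eqI)
  interpret N: group "cochain_group C D (Suc (Suc n))" by (rule group_cochain)
  note d\<phi> = coboundary_closed[OF \<phi>]
  show "coboundary C D T (Suc n) (coboundary C D T n \<phi>) \<in> cochains (Suc (Suc n))"
    by (intro coboundary_closed d\<phi>)
  show "\<one>\<^bsub>cochain_group C D (Suc (Suc n))\<^esub> \<in> cochains (Suc (Suc n))"
    by (rule N.one_closed)
  fix s assume s: "s \<in> strings C (Suc (Suc n))"
  interpret G: comm_group "D (composite C s)"
    by (rule ab) (simp add: composite_string[OF s])
  let ?y = "\<lambda>i j. coface (Suc n) i (coface n j \<phi>) s"
  let ?G = "D (composite C s)"
  have "(\<Otimes>\<^bsub>?G\<^esub>i\<in>{..Suc (Suc n)}. coface (Suc n) i (coboundary C D T n \<phi>) s [^]\<^bsub>?G\<^esub> ((- 1) ^ i :: int)) =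
    (\<Otimes>\<^bsub>?G\<^esub>i\<in>{..Suc (Suc n)}. (\<Otimes>\<^bsub>?G\<^esub>j\<in>{..Suc n}. ?y i j [^]\<^bsub>?G\<^esub> ((- 1) ^ j :: int))
       [^]\<^bsub>?G\<^esub> ((- 1) ^ i :: int))"
    using coface_closed[OF coface_closed[OF cochain_closed[OF \<phi>]] s]
    by (intro G.finprod_cong') (auto simp: coface_coboundary[OF \<phi> s] intro!: G.finprod_closed)
  also have "\<dots> = \<one>\<^bsub>?G\<^esub>"
    using coface_closed[OF coface_closed[OF cochain_closed[OF \<phi>]] s] coface_coface[OF \<phi> s]
    by (intro G.alternating_double_product) auto
  finally show "coboundary C D T (Suc n) (coboundary C D T n \<phi>) s =
      \<one>\<^bsub>cochain_group C D (Suc (Suc n))\<^esub> s"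
    unfolding coboundary_eq[OF d\<phi> s] using s by (simp add: cochain_group_def)
qed

text \<open>Coboundaries are always cocycles, so exactness makes the two groups equal.\<close>

lemma trivial_cohomology_group:
  assumes exact: "\<And>\<phi>. \<phi> \<in> cocycles C D T (Suc n) \<Longrightarrow> \<exists>\<psi>\<in>cochains n. coboundary C D T n \<psi> = \<phi>"
  shows "trivial_group (cohomology_group C D T (Suc n))"
proof -
  let ?Z = "cocycles C D T (Suc n)" and ?K = "cochain_group C D (Suc n)"
  interpret d: group_hom ?K "cochain_group C D (Suc (Suc n))" "coboundary C D T (Suc n)"
    by (intro group_hom.intro group_hom_axioms.intro group_cochain coboundary_hom)
  have B: "coboundaries C D T (Suc n) = ?Z"
  proof
    show "coboundaries C D T (Suc n) \<subseteq> ?Z"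
      by (auto simp: coboundaries_def cocycles_def kernel_def coboundary_closed coboundary_coboundary)
    show "?Z \<subseteq> coboundaries C D T (Suc n)"
      using exact by (fastforce simp: coboundaries_def)
  qed
  have Z: "subgroup ?Z ?K"
    unfolding cocycles_def by (rule d.subgroup_kernel)
  interpret Z: group "?K\<lparr>carrier := ?Z\<rparr>"
    by (rule group.subgroup_imp_group[OF group_cochain Z])
  have "subgroup ?Z (?K\<lparr>carrier := ?Z\<rparr>)"
    using Z.subgroup_self by simp
  then have n: "?Z \<lhd> ?K\<lparr>carrier := ?Z\<rparr>"
    by (rule Z.normal_invI) (use Z.m_closed Z.inv_closed in simp)
  have "carrier ((?K\<lparr>carrier := ?Z\<rparr>) Mod ?Z) = {?Z}"
    using Z.coset_join2[OF _ \<open>subgroup ?Z (?K\<lparr>carrier := ?Z\<rparr>)\<close>] Z.one_closed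
    by (auto simp: FactGroup_def RCOSETS_def)
  then show ?thesis
    using normal.factorgroup_is_group[OF n]
    by (simp add: trivial_group_def cohomology_group_def B FactGroup_def)
qed

end

section \<open>Normalised cocycles\<close>

text \<open>An alternating product can be computed term by term from the left, by \<open>alt_prod_Suc\<close>.\<close>

definition alt_prod :: "('d, 'm) monoid_scheme \<Rightarrow> nat \<Rightarrow> (nat \<Rightarrow> 'd) \<Rightarrow> 'd" where
  "alt_prod G n c = (\<Otimes>\<^bsub>G\<^esub>i\<in>{..n}. c i [^]\<^bsub>G\<^esub> ((- 1) ^ i :: int))"

context comm_group
begin

lemma mult_inv_mult_inv_cancel:
  assumes "p \<in> carrier G" "x \<in> carrier G"
  shows "p \<otimes> inv (p \<otimes> inv x) = x"
proof -
  have "p \<otimes> inv (p \<otimes> inv x) = p \<otimes> (inv p \<otimes> x)"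
    using assms by (simp add: inv_mult)
  then show ?thesis
    using assms by (simp flip: m_assoc)
qed

lemma alt_prod_closed: "(\<And>i. i \<le> n \<Longrightarrow> c i \<in> carrier G) \<Longrightarrow> alt_prod G n c \<in> carrier G"
  unfolding alt_prod_def by (rule finprod_closed) auto

lemma alt_prod_Suc:
  assumes c: "\<And>i. i \<le> Suc n \<Longrightarrow> c i \<in> carrier G"
  shows "alt_prod G (Suc n) c = c 0 \<otimes> inv (alt_prod G n (\<lambda>i. c (Suc i)))"
proof -
  have "inv (alt_prod G n (\<lambda>i. c (Suc i))) =
      (\<Otimes>i\<in>{..n}. (c (Suc i) [^] ((- 1) ^ i :: int)) [^] (- 1 :: int))"
    using c finprod_int_pow[of "{..n}" "\<lambda>i. c (Suc i) [^] ((- 1) ^ i :: int)" "- 1"]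
    by (simp add: alt_prod_def int_pow_neg finprod_closed)
  also have "\<dots> = (\<Otimes>i\<in>{..n}. c (Suc i) [^] ((- 1) ^ Suc i :: int))"
    using c by (intro finprod_cong') (auto simp: int_pow_pow)
  finally show ?thesis
    using c unfolding alt_prod_def by (subst finprod_Suc2) (auto simp: m_comm finprod_closed)
qed

lemma alt_prod_one: "(\<And>i. i \<le> n \<Longrightarrow> c i = \<one>) \<Longrightarrow> alt_prod G n c = \<one>"
  unfolding alt_prod_def by (rule finprod_one_eqI) simp

lemma alt_prod_cong:
  "(\<And>i. i \<le> n \<Longrightarrow> c i = c' i) \<Longrightarrow> (\<And>i. i \<le> n \<Longrightarrow> c' i \<in> carrier G) \<Longrightarrow>
    alt_prod G n c = alt_prod G n c'"
  unfolding alt_prod_def by (rule finprod_cong') auto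

end

context natural_system_on
begin

lemma coboundary_alt_prod:
  "\<phi> \<in> cochains n \<Longrightarrow> s \<in> strings C (Suc n) \<Longrightarrow>
    coboundary C D T n \<phi> s = alt_prod (D (composite C s)) (Suc n) (\<lambda>i. coface n i \<phi> s)"
  by (simp add: coboundary_eq alt_prod_def)

lemma cocyclesD:
  assumes "\<phi> \<in> cocycles C D T n"
  shows "\<phi> \<in> cochains n"
    and "s \<in> strings C (Suc n) \<Longrightarrow> coboundary C D T n \<phi> s = \<one>\<^bsub>D (composite C s)\<^esub>"
  using assms by (auto simp: cocycles_def kernel_def cochain_group_def)

text \<open>
  The faces beyond the first two leave the first arrow of a string unchanged, so they contribute
  nothing if \<open>\<psi>\<close> vanishes on strings starting with that arrow.
\<close>

lemma coboundary_of_vanishing_on_first: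
  assumes \<psi>: "\<psi> \<in> cochains (Suc n)" and s: "(A, x # a # as) \<in> strings C (Suc (Suc n))"
    and van: "\<And>bs. composable C A (x # bs) \<Longrightarrow> length bs = n \<Longrightarrow>
      \<psi> (A, x # bs) = \<one>\<^bsub>D (composite C (A, x # bs))\<^esub>"
  shows "coboundary C D T (Suc n) \<psi> (A, x # a # as) =
    lact x (composite C (Dom C x, a # as)) (\<psi> (Dom C x, a # as))
    \<otimes>\<^bsub>D (composite C (A, x # a # as))\<^esub> inv\<^bsub>D (composite C (A, x # a # as))\<^esub> \<psi> (A, (x \<cdot> a) # as)"
proof -
  let ?s = "(A, x # a # as)"
  \<comment> \<open>Kept opaque, since simplification would rewrite the composite.\<close>
  define G where "G = D (composite C ?s)"
  interpret G: comm_group G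
    unfolding G_def by (rule ab) (rule composite_string[OF s])
  let ?c = "\<lambda>i. coface (Suc n) i \<psi> ?s"
  have c: "?c i \<in> carrier G" if "i \<le> Suc (Suc n)" for i
    unfolding G_def using coface_closed[OF cochain_closed[OF \<psi>] s that] .
  have "?c (Suc (Suc i)) = \<one>\<^bsub>G\<^esub>" if "i \<le> n" for i
  proof (cases "i = n")
    case True
    note l = drop_last_string[OF s]
    have "drop_last ?s = (A, x # butlast (a # as))"
      by (simp add: drop_last_def)
    then have "\<psi> (drop_last ?s) = \<one>\<^bsub>D (composite C (drop_last ?s))\<^esub>"
      using van[of "butlast (a # as)"] l(1) by (simp only: strings_def mem_Collect_eq prod.case) simp
    then show ?thesis
      unfolding G_def l(4)
      using hom_one[OF ract_hom[OF composite_string[OF l(1)] l(2,3)]] ab l(1-3)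
      by (simp add: coface_def True comm_group_def del: snd_conv composite.simps)
  next
    case False
    then have i: "0 < Suc (Suc i)" "Suc (Suc i) \<le> Suc n"
      using that by simp_all
    note m = merge_string[OF s i]
    have "merge C (Suc (Suc i)) ?s = (A, x # merge_list C (Suc i) (a # as))"
      using i s by (simp add: merge_eq_merge_list strings_def)
    then have "\<psi> (merge C (Suc (Suc i)) ?s) = \<one>\<^bsub>G\<^esub>"
      unfolding G_def using van[of "merge_list C (Suc i) (a # as)"] m
      by (simp only: strings_def mem_Collect_eq prod.case) simp
    then show ?thesis
      using i by (simp add: coface_def)
  qed
  then have "alt_prod G n (\<lambda>i. ?c (Suc (Suc i))) = \<one>\<^bsub>G\<^esub>"
    by (rule G.alt_prod_one)
  then have "alt_prod G (Suc (Suc n)) ?c = ?c 0 \<otimes>\<^bsub>G\<^esub> inv\<^bsub>G\<^esub> (?c 1)"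
    using c by (simp add: G.alt_prod_Suc)
  then show ?thesis
    unfolding coboundary_alt_prod[OF \<psi> s] G_def[symmetric]
    by (simp add: coface_def drop_first_def merge_def)
qed

definition insert_first :: "'o \<times> 'a list \<Rightarrow> 'o \<times> 'a list" where
  "insert_first = (\<lambda>(A, as). (A, Ident C A # as))"

definition insert_second :: "'o \<times> 'a list \<Rightarrow> 'o \<times> 'a list" where
  "insert_second = (\<lambda>(A, as). (A, hd as # Ident C (Dom C (hd as)) # tl as))"

lemma insert_first_string:
  assumes "s \<in> strings C n"
  shows "insert_first s \<in> strings C (Suc n)" "composite C (insert_first s) = composite C s"
proof -
  obtain A as where s: "s = (A, as)" "composable C A as" "length as = n"
    using assms by (rule stringsE)
  moreover have "A \<in> Obj C"
    using s(2) by (cases as) auto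
  ultimately show "insert_first s \<in> strings C (Suc n)" "composite C (insert_first s) = composite C s"
    by (simp_all add: insert_first_def strings_def)
qed

lemma insert_second_string:
  assumes "s \<in> strings C (Suc n)"
  shows "insert_second s \<in> strings C (Suc (Suc n))" "composite C (insert_second s) = composite C s"
  using assms by (auto simp: insert_second_def strings_def length_Suc_conv)

lemma pullback_cochain:
  assumes "\<phi> \<in> cochains n" "\<And>s. s \<in> strings C m \<Longrightarrow> f s \<in> strings C n \<and> composite C (f s) = composite C s"
  shows "(\<lambda>s\<in>strings C m. \<phi> (f s)) \<in> cochains m"
proof -
  have "\<phi> (f s) \<in> carrier (D (composite C s))" if "s \<in> strings C m" for s
    using cochain_closed[OF assms(1), of "f s"] assms(2)[OF that] by simp
  then show ?thesis
    by (simp add: cochain_group_def)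
qed

text \<open>
  Compare the faces of a string with those of the string with an identity inserted. The cocycle
  identity for the longer string has the value at the original string as its first two terms, with
  opposite signs; the remaining terms are the faces of positive index of the inserted cochain. So
  these add up to zero and only the face with index \<open>0\<close> is left.
\<close>

lemma coboundary_insert_first:
  assumes \<phi>: "\<phi> \<in> cocycles C D T (Suc (Suc n))"
    and s: "(A, a # b # as) \<in> strings C (Suc (Suc n))"
  shows "coboundary C D T (Suc n) (\<lambda>s\<in>strings C (Suc n). \<phi> (insert_first s)) (A, a # b # as) =
    lact a (composite C (Dom C a, b # as)) (\<phi> (Dom C a, Ident C (Dom C a) # b # as))"
proof -
  let ?s = "(A, a # b # as)" and ?m = "\<lambda>s\<in>strings C (Suc n). \<phi> (insert_first s)"
  \<comment> \<open>Kept opaque, since simplification would rewrite the composite.\<close>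
  define G where "G = D (composite C ?s)"
  interpret G: comm_group G
    unfolding G_def by (rule ab) (rule composite_string[OF s])
  note \<phi>c = cocyclesD(1)[OF \<phi>]
  have m: "?m \<in> cochains (Suc n)"
    by (rule pullback_cochain[OF \<phi>c]) (simp add: insert_first_string)
  let ?t = "insert_first ?s"
  note t = insert_first_string[OF s]
  let ?c = "\<lambda>i. coface (Suc (Suc n)) i \<phi> ?t" and ?c' = "\<lambda>i. coface (Suc n) i ?m ?s"
  have c: "?c i \<in> carrier G" if "i \<le> Suc (Suc (Suc n))" for i
    unfolding G_def using coface_closed[OF cochain_closed[OF \<phi>c] t(1) that] unfolding t(2) .
  have c': "?c' i \<in> carrier G" if "i \<le> Suc (Suc n)" for i
    unfolding G_def using coface_closed[OF cochain_closed[OF m] s that] .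
  have arr: "a \<in> Arr C" "b \<in> Arr C" "Cod C a = A" "Cod C b = Dom C a" "composable C (Dom C b) as"
    "length as = n" "A \<in> Obj C"
    using s by (auto simp: strings_def)
  have c01: "?c 0 = \<phi> ?s" "?c 1 = \<phi> ?s"
  proof -
    have "\<phi> ?s \<in> carrier (D (composite C ?s))"
      by (rule cochain_closed[OF \<phi>c s])
    then show "?c 0 = \<phi> ?s"
      using lact_ident[of "composite C ?s" "\<phi> ?s"] composite_string[OF s] arr
      by (simp add: coface_def insert_first_def drop_first_def)
    show "?c 1 = \<phi> ?s"
      using arr by (simp add: coface_def insert_first_def merge_def)
  qed
  have cc: "?c (Suc (Suc i)) = ?c' (Suc i)" if "i \<le> Suc n" for i
  proof (cases "i = Suc n")
    case True
    note l = drop_last_string[OF s]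
    have "drop_last ?t = insert_first (drop_last ?s)" "last (snd ?t) = last (snd ?s)"
      by (simp_all add: insert_first_def drop_last_def)
    then show ?thesis
      using l(1) insert_first_string(2)[OF l(1)] by (simp add: coface_def True del: snd_conv)
  next
    case False
    then have i: "0 < Suc i" "Suc i \<le> Suc n"
      using that by simp_all
    note mg = merge_string[OF s i]
    have "merge C (Suc (Suc i)) ?t = insert_first (merge C (Suc i) ?s)"
      using i arr by (simp add: merge_eq_merge_list insert_first_def)
    then show ?thesis
      using i mg by (simp add: coface_def)
  qed
  let ?X = "alt_prod G (Suc n) (\<lambda>i. ?c (Suc (Suc i)))"
  have X: "?X \<in> carrier G"
    using c by (intro G.alt_prod_closed) simp
  have "\<one>\<^bsub>G\<^esub> = alt_prod G (Suc (Suc (Suc n))) ?c"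
    using cocyclesD(2)[OF \<phi> t(1)] coboundary_alt_prod[OF \<phi>c t(1)] unfolding G_def t(2) by metis
  also have "\<dots> = \<phi> ?s \<otimes>\<^bsub>G\<^esub> inv\<^bsub>G\<^esub> (\<phi> ?s \<otimes>\<^bsub>G\<^esub> inv\<^bsub>G\<^esub> ?X)"
    using c c01 by (simp add: G.alt_prod_Suc)
  also have "\<dots> = ?X"
    using X c[of 0] c01(1) by (intro G.mult_inv_mult_inv_cancel) simp_all
  finally have X1: "?X = \<one>\<^bsub>G\<^esub>" ..
  have "coboundary C D T (Suc n) ?m ?s = ?c' 0 \<otimes>\<^bsub>G\<^esub> inv\<^bsub>G\<^esub> (alt_prod G (Suc n) (\<lambda>i. ?c' (Suc i)))"
    unfolding coboundary_alt_prod[OF m s] G_def[symmetric] using c' by (rule G.alt_prod_Suc)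
  also have "alt_prod G (Suc n) (\<lambda>i. ?c' (Suc i)) = ?X"
    using c c' cc by (intro G.alt_prod_cong) simp_all
  finally have "coboundary C D T (Suc n) ?m ?s = ?c' 0"
    using c'[OF le0] by (simp only: X1 G.inv_one G.r_one)
  also have "?c' 0 = lact a (composite C (Dom C a, b # as)) (\<phi> (Dom C a, Ident C (Dom C a) # b # as))"
    using drop_first_string(1)[OF s] by (simp add: coface_def drop_first_def insert_first_def)
  finally show ?thesis .
qed

text \<open>
  The same comparison with an identity after the first arrow. Now the value at the original string
  occurs as the terms with index \<open>1\<close> and \<open>2\<close>, and the term with index \<open>0\<close> survives.
\<close>

lemma coboundary_insert_second:
  assumes \<phi>: "\<phi> \<in> cocycles C D T (Suc (Suc n))"
    and s: "(A, a # b # as) \<in> strings C (Suc (Suc n))"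
  shows "coboundary C D T (Suc n) (\<lambda>s\<in>strings C (Suc n). \<phi> (insert_second s)) (A, a # b # as) =
    lact a (composite C (Dom C a, b # as)) (\<phi> (Dom C a, b # Ident C (Dom C b) # as))
    \<otimes>\<^bsub>D (composite C (A, a # b # as))\<^esub>
      inv\<^bsub>D (composite C (A, a # b # as))\<^esub> \<phi> (A, (a \<cdot> b) # Ident C (Dom C b) # as)
    \<otimes>\<^bsub>D (composite C (A, a # b # as))\<^esub>
      lact a (composite C (Dom C a, b # as)) (\<phi> (Dom C a, Ident C (Dom C a) # b # as))"
proof -
  let ?s = "(A, a # b # as)" and ?m = "\<lambda>s\<in>strings C (Suc n). \<phi> (insert_second s)"
  \<comment> \<open>Kept opaque, since simplification would rewrite the composite.\<close>
  define G where "G = D (composite C ?s)"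
  interpret G: comm_group G
    unfolding G_def by (rule ab) (rule composite_string[OF s])
  note \<phi>c = cocyclesD(1)[OF \<phi>]
  have m: "?m \<in> cochains (Suc n)"
    by (rule pullback_cochain[OF \<phi>c]) (simp add: insert_second_string)
  let ?t = "insert_second ?s"
  note t = insert_second_string[OF s]
  let ?c = "\<lambda>i. coface (Suc (Suc n)) i \<phi> ?t" and ?c' = "\<lambda>i. coface (Suc n) i ?m ?s"
  have c: "?c i \<in> carrier G" if "i \<le> Suc (Suc (Suc n))" for i
    unfolding G_def using coface_closed[OF cochain_closed[OF \<phi>c] t(1) that] unfolding t(2) .
  have c': "?c' i \<in> carrier G" if "i \<le> Suc (Suc n)" for i
    unfolding G_def using coface_closed[OF cochain_closed[OF m] s that] .
  have arr: "a \<in> Arr C" "b \<in> Arr C" "Cod C a = A" "Cod C b = Dom C a" "composable C (Dom C b) as"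
    "length as = n" "A \<in> Obj C"
    using s by (auto simp: strings_def)
  have c12: "?c 1 = \<phi> ?s" "?c 2 = \<phi> ?s"
    using arr by (simp_all add: coface_def insert_second_def merge_def numeral_2_eq_2)
  have c0: "?c 0 = lact a (composite C (Dom C a, b # as)) (\<phi> (Dom C a, Ident C (Dom C a) # b # as))"
    using arr by (simp add: coface_def insert_second_def drop_first_def)
  have cc: "?c (Suc (Suc (Suc i))) = ?c' (Suc (Suc i))" if "i \<le> n" for i
  proof (cases "i = n")
    case True
    note l = drop_last_string[OF s]
    have "drop_last ?t = insert_second (drop_last ?s)" "last (snd ?t) = last (snd ?s)"
      by (simp_all add: insert_second_def drop_last_def)
    then show ?thesis
      using l(1) insert_second_string(2)[OF l(1)] by (simp add: coface_def True del: snd_conv)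
  next
    case False
    then have i: "0 < Suc (Suc i)" "Suc (Suc i) \<le> Suc n"
      using that by simp_all
    note mg = merge_string[OF s i]
    have "merge C (Suc (Suc (Suc i))) ?t = insert_second (merge C (Suc (Suc i)) ?s)"
      using i arr by (simp add: merge_eq_merge_list insert_second_def)
    then show ?thesis
      using i mg by (simp add: coface_def)
  qed
  let ?X = "alt_prod G n (\<lambda>i. ?c (Suc (Suc (Suc i))))"
  have X: "?X \<in> carrier G"
    using c by (intro G.alt_prod_closed) simp
  have "\<one>\<^bsub>G\<^esub> = alt_prod G (Suc (Suc (Suc n))) ?c"
    using cocyclesD(2)[OF \<phi> t(1)] coboundary_alt_prod[OF \<phi>c t(1)] unfolding G_def t(2) by metis
  also have "\<dots> = ?c 0 \<otimes>\<^bsub>G\<^esub> inv\<^bsub>G\<^esub> (\<phi> ?s \<otimes>\<^bsub>G\<^esub> inv\<^bsub>G\<^esub> (\<phi> ?s \<otimes>\<^bsub>G\<^esub> inv\<^bsub>G\<^esub> ?X))"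
    using c c12 by (simp add: G.alt_prod_Suc numeral_2_eq_2)
  also have "\<phi> ?s \<otimes>\<^bsub>G\<^esub> inv\<^bsub>G\<^esub> (\<phi> ?s \<otimes>\<^bsub>G\<^esub> inv\<^bsub>G\<^esub> ?X) = ?X"
    using X c[of 1] c12(1) by (intro G.mult_inv_mult_inv_cancel) simp_all
  finally have X1: "?X = ?c 0"
    using X c[OF le0] G.inv_equality[of "?c 0" "inv\<^bsub>G\<^esub> ?X"] by simp
  have "coboundary C D T (Suc n) ?m ?s =
      ?c' 0 \<otimes>\<^bsub>G\<^esub> inv\<^bsub>G\<^esub> (?c' 1 \<otimes>\<^bsub>G\<^esub> inv\<^bsub>G\<^esub> (alt_prod G n (\<lambda>i. ?c' (Suc (Suc i)))))"
    unfolding coboundary_alt_prod[OF m s] G_def[symmetric] using c' by (simp add: G.alt_prod_Suc)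
  also have "alt_prod G n (\<lambda>i. ?c' (Suc (Suc i))) = ?c 0"
    unfolding X1[symmetric] using c c' cc by (intro G.alt_prod_cong) simp_all
  also have "?c' 0 \<otimes>\<^bsub>G\<^esub> inv\<^bsub>G\<^esub> (?c' 1 \<otimes>\<^bsub>G\<^esub> inv\<^bsub>G\<^esub> ?c 0) =
      ?c' 0 \<otimes>\<^bsub>G\<^esub> inv\<^bsub>G\<^esub> ?c' 1 \<otimes>\<^bsub>G\<^esub> ?c 0"
    using c[of 0] c'[of 0] c'[of 1] by (simp add: G.inv_mult_group G.m_ac)
  also have "?c' 0 = lact a (composite C (Dom C a, b # as)) (\<phi> (Dom C a, b # Ident C (Dom C b) # as))"
    using drop_first_string(1)[OF s] by (simp add: coface_def drop_first_def insert_second_def)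
  also have "?c' 1 = \<phi> (A, (a \<cdot> b) # Ident C (Dom C b) # as)"
    using merge_string(1)[OF s, of 1] arr by (simp add: coface_def merge_def insert_second_def)
  finally show ?thesis
    by (simp only: c0 G_def)
qed

text \<open>
  With \<open>m0\<close> and \<open>m1\<close> the cochains that insert an identity before and after the first arrow, the
  normalised cocycle is, in additive notation, \<open>\<phi> + d m1 - 2 d m0\<close>. Writing \<open>1\<close> for identities,
  the preceding lemmas give \<open>d m0 (1, b, \<dots>) = d m1 (1, b, \<dots>) = \<phi> (1, b, \<dots>)\<close>, and with
  \<open>u = a \<phi> (1, 1, \<dots>)\<close> they give \<open>d m0 (a, 1, \<dots>) = u\<close> and
  \<open>d m1 (a, 1, \<dots>) = 2 u - \<phi> (a, 1, \<dots>)\<close>. The coefficient \<open>2\<close> makes both combinations vanish.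
\<close>

lemma normalise_cocycle:
  assumes \<phi>: "\<phi> \<in> cocycles C D T (Suc (Suc n))"
  obtains \<phi>' \<psi> where "\<psi> \<in> cochains (Suc n)" "\<phi>' \<in> cocycles C D T (Suc (Suc n))"
    "\<phi> = \<phi>' \<otimes>\<^bsub>cochain_group C D (Suc (Suc n))\<^esub> coboundary C D T (Suc n) \<psi>"
    "\<forall>A b as. (A, Ident C A # b # as) \<in> strings C (Suc (Suc n)) \<longrightarrow>
      \<phi>' (A, Ident C A # b # as) = \<one>\<^bsub>D (composite C (A, b # as))\<^esub>"
    "\<forall>A a as. (A, a # Ident C (Dom C a) # as) \<in> strings C (Suc (Suc n)) \<longrightarrow>
      \<phi>' (A, a # Ident C (Dom C a) # as) = \<one>\<^bsub>D (composite C (A, a # as))\<^esub>"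
proof -
  let ?K = "cochain_group C D (Suc (Suc n))" and ?K1 = "cochain_group C D (Suc n)"
  let ?d = "coboundary C D T (Suc n)"
  interpret K: group ?K by (rule group_cochain)
  interpret K1: group ?K1 by (rule group_cochain)
  interpret d: group_hom ?K1 ?K ?d
    by (intro group_hom.intro group_hom_axioms.intro group_cochain coboundary_hom)
  interpret d2: group_hom ?K "cochain_group C D (Suc (Suc (Suc n)))" "coboundary C D T (Suc (Suc n))"
    by (intro group_hom.intro group_hom_axioms.intro group_cochain coboundary_hom)
  note \<phi>c = cocyclesD(1)[OF \<phi>]
  define m0 where "m0 = (\<lambda>s\<in>strings C (Suc n). \<phi> (insert_first s))"
  define m1 where "m1 = (\<lambda>s\<in>strings C (Suc n). \<phi> (insert_second s))"
  have m0: "m0 \<in> cochains (Suc n)" and m1: "m1 \<in> cochains (Suc n)"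
    unfolding m0_def m1_def
    by (rule pullback_cochain[OF \<phi>c]; simp add: insert_first_string insert_second_string)+
  define \<psi> where "\<psi> = m0 \<otimes>\<^bsub>?K1\<^esub> m0 \<otimes>\<^bsub>?K1\<^esub> inv\<^bsub>?K1\<^esub> m1"
  have \<psi>: "\<psi> \<in> cochains (Suc n)"
    using m0 m1 by (simp only: \<psi>_def K1.m_closed K1.inv_closed)
  define \<phi>' where "\<phi>' = \<phi> \<otimes>\<^bsub>?K\<^esub> inv\<^bsub>?K\<^esub> (?d \<psi>)"
  have d\<psi>: "?d \<psi> \<in> cochains (Suc (Suc n))"
    by (rule coboundary_closed[OF \<psi>])
  have "?d \<psi> \<in> cocycles C D T (Suc (Suc n))"
    using d\<psi> coboundary_coboundary[OF \<psi>] by (simp only: cocycles_def kernel_def mem_Collect_eq)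
  then have \<phi>': "\<phi>' \<in> cocycles C D T (Suc (Suc n))"
    using \<phi> d2.subgroup_kernel unfolding \<phi>'_def cocycles_def
    by (intro subgroup.m_closed subgroup.m_inv_closed)
  have "\<phi> = \<phi>' \<otimes>\<^bsub>?K\<^esub> ?d \<psi>"
    unfolding \<phi>'_def using \<phi>c d\<psi> K.m_assoc K.l_inv K.r_one K.inv_closed by metis
  have val: "\<phi>' s = \<phi> s \<otimes>\<^bsub>D (composite C s)\<^esub> inv\<^bsub>D (composite C s)\<^esub>
     (?d m0 s \<otimes>\<^bsub>D (composite C s)\<^esub> ?d m0 s \<otimes>\<^bsub>D (composite C s)\<^esub> inv\<^bsub>D (composite C s)\<^esub> ?d m1 s)"
    if s: "s \<in> strings C (Suc (Suc n))" for s
  proof -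
    have inv: "(inv\<^bsub>?K\<^esub> x) s = inv\<^bsub>D (composite C s)\<^esub> (x s)" if "x \<in> cochains (Suc (Suc n))" for x
      using that s ab unfolding cochain_group_def
      by (subst inv_product_group) (auto simp: comm_group_def)
    have "?d \<psi> = ?d m0 \<otimes>\<^bsub>?K\<^esub> ?d m0 \<otimes>\<^bsub>?K\<^esub> inv\<^bsub>?K\<^esub> ?d m1"
      unfolding \<psi>_def using m0 m1 by (simp only: d.hom_mult d.hom_inv K1.m_closed K1.inv_closed)
    then show ?thesis
      unfolding \<phi>'_def using inv[OF d\<psi>] inv[OF coboundary_closed[OF m1]] s
      by (simp add: cochain_group_def)
  qed
  show ?thesis
  proof (rule that[OF \<psi> \<phi>' \<open>\<phi> = \<phi>' \<otimes>\<^bsub>?K\<^esub> ?d \<psi>\<close>]; intro allI impI)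
    fix A b as assume s: "(A, Ident C A # b # as) \<in> strings C (Suc (Suc n))"
    then have A: "A \<in> Obj C"
      using cod_obj[of "Ident C A"] by (simp add: strings_def)
    then have arr: "A \<in> Obj C" "b \<in> Arr C" "Cod C b = A" "composable C (Dom C b) as" "length as = n"
      using s by (simp_all add: strings_def)
    let ?s = "(A, Ident C A # b # as)"
    let ?x = "composite C (A, b # as)"
    have x: "composite C ?s = ?x" "?x \<in> Arr C" "Cod C ?x = A"
      using arr by simp_all
    interpret G: comm_group "D ?x"
      by (rule ab) (rule x)
    have c1: "\<phi> ?s \<in> carrier (D ?x)"
      using cochain_closed[OF \<phi>c s] x(1) by simp
    have c2: "\<phi> (A, b # Ident C (Dom C b) # as) \<in> carrier (D ?x)"
      using cochain_closed[OF \<phi>c, of "(A, b # Ident C (Dom C b) # as)"] arr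
      by (simp add: strings_def)
    have l: "lact (Ident C A) ?x y = y" if "y \<in> carrier (D ?x)" for y
      using lact_ident[OF x(2) that] x(3) by simp
    have d0: "?d m0 ?s = \<phi> ?s"
      using coboundary_insert_first[OF \<phi> s] arr l[OF c1] by (simp add: m0_def del: composite.simps)
    have d1: "?d m1 ?s = \<phi> ?s"
      using coboundary_insert_second[OF \<phi> s] arr l[OF c1] l[OF c2] c1 c2 x(1)
      by (simp add: m1_def G.r_inv G.l_one del: composite.simps)
    show "\<phi>' ?s = \<one>\<^bsub>D ?x\<^esub>"
    proof -
      have "\<phi> ?s \<otimes>\<^bsub>D ?x\<^esub> \<phi> ?s \<otimes>\<^bsub>D ?x\<^esub> inv\<^bsub>D ?x\<^esub> \<phi> ?s = \<phi> ?s"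
        using c1 by (simp only: G.m_assoc G.r_inv G.r_one G.inv_closed)
      then show ?thesis
        using val[OF s] c1 unfolding d0 d1 x(1) by (simp only: G.r_inv)
    qed
  next
    fix A a as assume s: "(A, a # Ident C (Dom C a) # as) \<in> strings C (Suc (Suc n))"
    then have arr: "a \<in> Arr C" "Cod C a = A" "composable C (Dom C a) as" "length as = n"
      by (auto simp: strings_def)
    let ?s = "(A, a # Ident C (Dom C a) # as)"
    let ?x = "composite C (A, a # as)" and ?y = "composite C (Dom C a, as)"
    have x: "composite C ?s = ?x" "?x \<in> Arr C" "composite C (Dom C a, Ident C (Dom C a) # as) = ?y"
      using arr by simp_all
    interpret G: comm_group "D ?x"
      by (rule ab) (rule x)
    have c1: "\<phi> ?s \<in> carrier (D ?x)"
      using cochain_closed[OF \<phi>c s] x(1) by simp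
    define u where "u = lact a ?y (\<phi> (Dom C a, Ident C (Dom C a) # Ident C (Dom C a) # as))"
    have "\<phi> (Dom C a, Ident C (Dom C a) # Ident C (Dom C a) # as) \<in> carrier (D ?y)"
      using cochain_closed[OF \<phi>c, of "(Dom C a, Ident C (Dom C a) # Ident C (Dom C a) # as)"] arr
      by (simp add: strings_def)
    then have u: "u \<in> carrier (D ?x)"
      unfolding u_def using hom_in_carrier[OF lact_hom[of ?y a]] arr by simp
    have d0: "?d m0 ?s = u"
      using coboundary_insert_first[OF \<phi> s] arr x(3) by (simp add: m0_def u_def del: composite.simps)
    have d1: "?d m1 ?s = u \<otimes>\<^bsub>D ?x\<^esub> inv\<^bsub>D ?x\<^esub> \<phi> ?s \<otimes>\<^bsub>D ?x\<^esub> u"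
      using coboundary_insert_second[OF \<phi> s] arr x(1,3)
      by (simp add: m1_def u_def del: composite.simps)
    show "\<phi>' ?s = \<one>\<^bsub>D ?x\<^esub>"
    proof -
      have "u \<otimes>\<^bsub>D ?x\<^esub> inv\<^bsub>D ?x\<^esub> \<phi> ?s \<otimes>\<^bsub>D ?x\<^esub> u = u \<otimes>\<^bsub>D ?x\<^esub> u \<otimes>\<^bsub>D ?x\<^esub> inv\<^bsub>D ?x\<^esub> \<phi> ?s"
        using c1 u by (simp only: G.m_ac G.inv_closed G.m_closed)
      then have "u \<otimes>\<^bsub>D ?x\<^esub> u \<otimes>\<^bsub>D ?x\<^esub> inv\<^bsub>D ?x\<^esub> (u \<otimes>\<^bsub>D ?x\<^esub> inv\<^bsub>D ?x\<^esub> \<phi> ?s \<otimes>\<^bsub>D ?x\<^esub> u) = \<phi> ?s"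
        using c1 u by (simp only: G.mult_inv_mult_inv_cancel G.m_closed)
      then show ?thesis
        using val[OF s] c1 unfolding d0 d1 x(1) by (simp only: G.r_inv)
    qed
  qed
qed

end

section \<open>Vanishing of the higher cohomology\<close>

locale cartesian_on_free_theory =
  free_theory I F J E \<eta> + natural_system_on F D T
  for I :: "'i set"
    and F :: "('i list, 'a) cat" (structure)
    and J :: "'i list \<times> nat list \<times> 'i list \<Rightarrow> 'a"
    and E :: "'i list \<Rightarrow> 'i \<Rightarrow> 'e set"
    and \<eta> :: "'i list \<Rightarrow> 'i \<Rightarrow> 'e \<Rightarrow> 'a"
    and D :: "'a \<Rightarrow> 'd monoid"
    and T :: "'a \<times> 'a \<times> 'a \<Rightarrow> 'd \<Rightarrow> 'd" +
  assumes cartesian: "cartesian F D T"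
begin

lemma cartesian_iso:
  assumes a: "a \<in> Arr F" "Cod F a = w"
  shows "bij_betw (\<lambda>x. \<lambda>k\<in>{..<length w}. lact (pr w k) a x) (carrier (D a))
    (\<Pi>\<^sub>E k\<in>{..<length w}. carrier (D (pr w k \<cdot> a)))"
proof -
  have w: "w \<in> lists I"
    using a by auto
  let ?ps = "map (pr w) [0..<length w]"
  have "(\<lambda>x. \<lambda>k\<in>{..<length ?ps}. lact (?ps ! k) a x)
      \<in> iso (D a) (product_group {..<length ?ps} (\<lambda>k. D (?ps ! k \<cdot> a)))"
    by (rule cartesian[unfolded cartesian_def, rule_format, OF pr_product[OF w] a])
  then have "bij_betw (\<lambda>x. \<lambda>k\<in>{..<length ?ps}. lact (?ps ! k) a x) (carrier (D a))
      (\<Pi>\<^sub>E k\<in>{..<length ?ps}. carrier (D (?ps ! k \<cdot> a)))"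
    by (simp only: iso_def mem_Collect_eq carrier_product_group)
  moreover have "(\<lambda>x. \<lambda>k\<in>{..<length ?ps}. lact (?ps ! k) a x) =
      (\<lambda>x. \<lambda>k\<in>{..<length w}. lact (pr w k) a x)"
    by (auto intro!: ext restrict_ext)
  moreover have "(\<Pi>\<^sub>E k\<in>{..<length ?ps}. carrier (D (?ps ! k \<cdot> a))) =
      (\<Pi>\<^sub>E k\<in>{..<length w}. carrier (D (pr w k \<cdot> a)))"
    unfolding length_map length_upt diff_zero by (intro PiE_cong) simp
  ultimately show ?thesis
    by metis
qed

lemma cartesian_ex:
  assumes a: "a \<in> Arr F" "Cod F a = w"
    and y: "\<And>k. k < length w \<Longrightarrow> y k \<in> carrier (D (pr w k \<cdot> a))"
  shows "\<exists>x\<in>carrier (D a). \<forall>k<length w. lact (pr w k) a x = y k"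
proof -
  have "restrict y {..<length w} \<in> (\<Pi>\<^sub>E k\<in>{..<length w}. carrier (D (pr w k \<cdot> a)))"
    using y by auto
  then obtain x where x: "x \<in> carrier (D a)"
    "restrict y {..<length w} = (\<lambda>k\<in>{..<length w}. lact (pr w k) a x)"
    using bij_betw_imp_surj_on[OF cartesian_iso[OF a]] by blast
  have "lact (pr w k) a x = y k" if "k < length w" for k
    using fun_cong[OF x(2), of k] that by simp
  then show ?thesis
    using x(1) by blast
qed

lemma cartesian_eqI:
  assumes a: "a \<in> Arr F" "Cod F a = w" and x: "x \<in> carrier (D a)" "y \<in> carrier (D a)"
    and eq: "\<And>k. k < length w \<Longrightarrow> lact (pr w k) a x = lact (pr w k) a y"
  shows "x = y"
proof (rule inj_onD[OF bij_betw_imp_inj_on[OF cartesian_iso[OF a]] _ x])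
  show "(\<lambda>k\<in>{..<length w}. lact (pr w k) a x) = (\<lambda>k\<in>{..<length w}. lact (pr w k) a y)"
    using eq by (intro restrict_ext) simp
qed

lemma lact_one:
  assumes "f \<in> Arr F" "b \<in> Arr F" "Dom F b = Cod F f"
  shows "lact b f \<one>\<^bsub>D f\<^esub> = \<one>\<^bsub>D (b \<cdot> f)\<^esub>"
  using hom_one[OF lact_hom[OF assms]] ab assms by (simp add: comm_group_def)

text \<open>
  The arrows from which all others are built. To solve for a cochain, it is enough to satisfy the
  equations at the strings that start with one of these.
\<close>

definition basic :: "'a \<Rightarrow> bool" where
  "basic x \<longleftrightarrow> generator x \<or> (\<exists>w\<in>lists I. \<exists>k<length w. x = pr w k)"

lemma basic_arr:
  assumes "basic x"
  obtains i where "i \<in> I" "x \<in> Arr F" "Cod F x = [i]"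
  using assms unfolding basic_def
  by (metis generatorE nth_in_lists pr(1,3))

text \<open>
  For a basic arrow \<open>x\<close> the cocycle identity reads \<open>\<chi> (x \<cdot> a, \<dots>) = x \<chi> (a, \<dots>)\<close>, so the vanishing
  propagates from \<open>a\<close> to \<open>x \<cdot> a\<close> and, for projections \<open>x\<close>, from all \<open>x \<cdot> a\<close> back to \<open>a\<close>.
\<close>

lemma cocycle_eq_one_if_basic:
  assumes \<chi>: "\<chi> \<in> cocycles F D T (Suc n)"
    and van: "\<And>x as. basic x \<Longrightarrow> composable F (Dom F x) as \<Longrightarrow> length as = n \<Longrightarrow>
      \<chi> (Cod F x, x # as) = \<one>\<^bsub>D (composite F (Cod F x, x # as))\<^esub>"
  shows "\<chi> = \<one>\<^bsub>cochain_group F D (Suc n)\<^esub>"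
proof -
  note \<chi>c = cocyclesD(1)[OF \<chi>]
  have step: "\<chi> (Cod F x, (x \<cdot> a) # as) =
      lact x (composite F (Dom F x, a # as)) (\<chi> (Dom F x, a # as))"
    if x: "basic x" and a: "a \<in> Arr F" "Cod F a = Dom F x" "composable F (Dom F a) as" "length as = n"
    for x a as
  proof -
    have xa: "x \<in> Arr F"
      using x by (rule basic_arr)
    let ?s = "(Cod F x, x # a # as)"
    have s: "?s \<in> strings F (Suc (Suc n))"
      using xa a by (simp add: strings_def)
    define G where "G = D (composite F ?s)"
    interpret G: comm_group G
      unfolding G_def by (rule ab) (rule composite_string[OF s])
    let ?l = "lact x (composite F (Dom F x, a # as)) (\<chi> (Dom F x, a # as))"
    have "coboundary F D T (Suc n) \<chi> ?s = \<one>\<^bsub>G\<^esub>"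
      unfolding G_def by (rule cocyclesD(2)[OF \<chi> s])
    moreover have "coboundary F D T (Suc n) \<chi> ?s = ?l \<otimes>\<^bsub>G\<^esub> inv\<^bsub>G\<^esub> \<chi> (Cod F x, (x \<cdot> a) # as)"
      unfolding G_def using van[OF x]
      by (intro coboundary_of_vanishing_on_first[OF \<chi>c s]) simp
    moreover have "?l \<in> carrier G"
    proof -
      have "\<chi> (Dom F x, a # as) \<in> carrier (D (composite F (Dom F x, a # as)))"
        using a by (intro cochain_closed[OF \<chi>c]) (simp add: strings_def)
      then show ?thesis
        using hom_in_carrier[OF lact_hom[of "composite F (Dom F x, a # as)" x]] xa a
        by (simp add: G_def)
    qed
    moreover have "\<chi> (Cod F x, (x \<cdot> a) # as) \<in> carrier G"
      using cochain_closed[OF \<chi>c, of "(Cod F x, (x \<cdot> a) # as)"] xa a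
      by (simp add: strings_def G_def)
    ultimately show ?thesis
      using G.inv_equality[of ?l "inv\<^bsub>G\<^esub> \<chi> (Cod F x, (x \<cdot> a) # as)"] by simp
  qed
  have tuple_case: "\<chi> (Cod F a, a # as) = \<one>\<^bsub>D (composite F (Cod F a, a # as))\<^esub>"
    if a: "a \<in> Arr F" "composable F (Dom F a) as" "length as = n"
      and comps: "\<And>k. k < length (Cod F a) \<Longrightarrow> \<chi> ([Cod F a ! k], (pr (Cod F a) k \<cdot> a) # as) =
        \<one>\<^bsub>D (composite F ([Cod F a ! k], (pr (Cod F a) k \<cdot> a) # as))\<^esub>" for a as
  proof -
    let ?c = "composite F (Cod F a, a # as)"
    have c: "?c \<in> Arr F" "Cod F ?c = Cod F a"
      using a by simp_all
    have s: "(Cod F a, a # as) \<in> strings F (Suc n)"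
      using a by (simp add: strings_def)
    interpret G: comm_group "D ?c"
      by (rule ab) (rule c)
    show ?thesis
    proof (rule cartesian_eqI[OF c])
      show "\<chi> (Cod F a, a # as) \<in> carrier (D ?c)"
        by (rule cochain_closed[OF \<chi>c s])
      show "\<one>\<^bsub>D ?c\<^esub> \<in> carrier (D ?c)"
        by (rule G.one_closed)
      fix k assume k: "k < length (Cod F a)"
      let ?p = "pr (Cod F a) k"
      have p: "basic ?p" "?p \<in> Arr F" "Dom F ?p = Cod F a" "Cod F ?p = [Cod F a ! k]"
        using k a unfolding basic_def by auto
      have "lact ?p ?c (\<chi> (Cod F a, a # as)) = \<chi> ([Cod F a ! k], (?p \<cdot> a) # as)"
        using step[OF p(1) a(1) p(3)[symmetric] a(2,3)] unfolding p(3,4) by (rule sym)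
      also have "\<dots> = \<one>\<^bsub>D (?p \<cdot> ?c)\<^esub>"
        using comps[OF k] p a by simp
      also have "\<dots> = lact ?p ?c \<one>\<^bsub>D ?c\<^esub>"
        using lact_one[OF c(1) p(2)] p c by simp
      finally show "lact ?p ?c (\<chi> (Cod F a, a # as)) = lact ?p ?c \<one>\<^bsub>D ?c\<^esub>" .
    qed
  qed
  have single: "\<chi> ([i], f # as) = \<one>\<^bsub>D (composite F ([i], f # as))\<^esub>"
    if "f \<in> Arr F" "Cod F f = [i]" "composable F (Dom F f) as" "length as = n" for f i as
    using that
  proof (induction f arbitrary: i rule: wf_induct_rule[OF wf_subterm_rel])
    case (1 f)
    show ?case
      using 1(2,3)
    proof (cases rule: arrow_cases)
      case (proj w k)
      then have "basic f"
        unfolding basic_def by blast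
      then show ?thesis
        using van[of f as] 1(3-5) by simp
    next
      case (app g t)
      have g: "basic g" "g \<in> Arr F" "Cod F g = [i]"
        using app 1(3) unfolding basic_def by simp_all
      have as: "composable F (Dom F t) as"
        using 1(4) app g by simp
      have "\<chi> (Dom F g, t # as) = \<one>\<^bsub>D (composite F (Dom F g, t # as))\<^esub>"
        unfolding app(3)[symmetric]
      proof (rule tuple_case[OF app(2) as 1(5)])
        fix k assume k: "k < length (Cod F t)"
        show "\<chi> ([Cod F t ! k], (pr (Cod F t) k \<cdot> t) # as) =
          \<one>\<^bsub>D (composite F ([Cod F t ! k], (pr (Cod F t) k \<cdot> t) # as))\<^esub>"
        proof (rule 1(1))
          show "(pr (Cod F t) k \<cdot> t, f) \<in> subterm_rel"
            unfolding app(4) using subterm_relI[OF app(1-3)] k app(3) by simp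
        qed (use k app as 1(5) in simp_all)
      qed
      then show ?thesis
        using step[OF g(1) app(2,3) as 1(5)] lact_one[of "composite F (Dom F g, t # as)" g]
          app g as by simp
    qed
  qed
  show ?thesis
  proof (rule cochain_eqI[OF \<chi>c])
    show "\<one>\<^bsub>cochain_group F D (Suc n)\<^esub> \<in> cochains (Suc n)"
      by (rule monoid.one_closed) (rule group.is_monoid[OF group_cochain])
    fix s assume s: "s \<in> strings F (Suc n)"
    then obtain a as where a: "s = (Cod F a, a # as)" "a \<in> Arr F" "composable F (Dom F a) as" "length as = n"
      by (auto simp: strings_def length_Suc_conv)
    have "\<chi> s = \<one>\<^bsub>D (composite F s)\<^esub>"
      unfolding a(1)
    proof (rule tuple_case[OF a(2-4)])
      fix k assume "k < length (Cod F a)"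
      then show "\<chi> ([Cod F a ! k], (pr (Cod F a) k \<cdot> a) # as) =
          \<one>\<^bsub>D (composite F ([Cod F a ! k], (pr (Cod F a) k \<cdot> a) # as))\<^esub>"
        using a by (intro single) simp_all
    qed
    then show "\<chi> s = \<one>\<^bsub>cochain_group F D (Suc n)\<^esub> s"
      using s by (simp add: cochain_group_def)
  qed
qed

text \<open>
  \<open>V f as\<close> stands for the value of the unknown cochain at the string that starts with the arrow
  \<open>f\<close> into a single sort and continues with \<open>as\<close>. The value at an arbitrary first arrow \<open>a\<close> is the
  element whose \<open>k\<close>-th component is prescribed by the equation at \<open>(pr k, a, \<dots>)\<close>. It exists by
  cartesianness, once the values \<open>V\<close> lie in the right groups.
\<close>

definition tuple_value :: "('i list \<times> 'a list \<Rightarrow> 'd) \<Rightarrow> ('a \<Rightarrow> 'a list \<Rightarrow> 'd) \<Rightarrow> 'a \<Rightarrow> 'a list \<Rightarrow> 'd"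
  where
  "tuple_value \<phi> V a as = (let w = Cod F a; c = composite F (w, a # as) in
     SOME x. x \<in> carrier (D c) \<and> (\<forall>k<length w. lact (pr w k) c x =
       V (pr w k \<cdot> a) as \<otimes>\<^bsub>D (pr w k \<cdot> c)\<^esub> \<phi> ([w ! k], pr w k # a # as)))"

text \<open>
  At \<open>g \<cdot> t\<close> the value is prescribed by the equation at \<open>(g, t, \<dots>)\<close>; at a projection it is the
  neutral element. The description operator only names the unique decomposition.
\<close>

definition value_step :: "('i list \<times> 'a list \<Rightarrow> 'd) \<Rightarrow> ('a \<Rightarrow> 'a list \<Rightarrow> 'd) \<Rightarrow> 'a \<Rightarrow> 'a list \<Rightarrow> 'd"
  where
  "value_step \<phi> V f as =
     (if \<exists>g t. generator g \<and> t \<in> Arr F \<and> Cod F t = Dom F g \<and> f = g \<cdot> t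
      then let (g, t) = SOME (g, t). generator g \<and> t \<in> Arr F \<and> Cod F t = Dom F g \<and> f = g \<cdot> t;
               c = composite F (Dom F g, t # as)
           in lact g c (tuple_value \<phi> V t as)
              \<otimes>\<^bsub>D (g \<cdot> c)\<^esub> inv\<^bsub>D (g \<cdot> c)\<^esub> \<phi> (Cod F g, g # t # as)
      else \<one>\<^bsub>D (composite F (Cod F f, f # as))\<^esub>)"

definition "value_of \<phi> = wfrec subterm_rel (value_step \<phi>)"

lemma tuple_value_cong:
  assumes "\<And>k. k < length (Cod F a) \<Longrightarrow> V (pr (Cod F a) k \<cdot> a) = V' (pr (Cod F a) k \<cdot> a)"
  shows "tuple_value \<phi> V a as = tuple_value \<phi> V' a as"
  using assms unfolding tuple_value_def Let_def by (intro arg_cong[of _ _ Eps] ext) auto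

lemma value_step_app:
  assumes "generator g" "t \<in> Arr F" "Cod F t = Dom F g"
  shows "value_step \<phi> V (g \<cdot> t) as = (let c = composite F (Dom F g, t # as)
    in lact g c (tuple_value \<phi> V t as) \<otimes>\<^bsub>D (g \<cdot> c)\<^esub> inv\<^bsub>D (g \<cdot> c)\<^esub> \<phi> (Cod F g, g # t # as))"
proof -
  let ?P = "\<lambda>(g', t'). generator g' \<and> t' \<in> Arr F \<and> Cod F t' = Dom F g' \<and> g \<cdot> t = g' \<cdot> t'"
  have "?P (g, t)"
    using assms by simp
  moreover have "p = (g, t)" if "?P p" for p
  proof -
    obtain g' t' where p: "p = (g', t')"
      by force
    then have *: "generator g'" "t' \<in> Arr F" "Cod F t' = Dom F g'" "g \<cdot> t = g' \<cdot> t'"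
      using that by simp_all
    show ?thesis
      using app_unique[OF assms(1) *(1) assms(2,3) *(2-4)] p by blast
  qed
  ultimately have "(SOME p. ?P p) = (g, t)"
    by (rule some_equality)
  moreover have "\<exists>g' t'. generator g' \<and> t' \<in> Arr F \<and> Cod F t' = Dom F g' \<and> g \<cdot> t = g' \<cdot> t'"
    using assms by blast
  ultimately show ?thesis
    unfolding value_step_def by (simp only: if_True Let_def prod.case)
qed

lemma value_of_app:
  assumes gt: "generator g" "t \<in> Arr F" "Cod F t = Dom F g"
  shows "value_of \<phi> (g \<cdot> t) as = (let c = composite F (Dom F g, t # as)
    in lact g c (tuple_value \<phi> (value_of \<phi>) t as)
       \<otimes>\<^bsub>D (g \<cdot> c)\<^esub> inv\<^bsub>D (g \<cdot> c)\<^esub> \<phi> (Cod F g, g # t # as))"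
proof -
  have "value_of \<phi> (g \<cdot> t) = value_step \<phi> (cut (value_of \<phi>) subterm_rel (g \<cdot> t)) (g \<cdot> t)"
    unfolding value_of_def by (rule wfrec[OF wf_subterm_rel])
  moreover have "tuple_value \<phi> (cut (value_of \<phi>) subterm_rel (g \<cdot> t)) t as =
      tuple_value \<phi> (value_of \<phi>) t as"
    using subterm_relI[OF gt] gt(3) by (intro tuple_value_cong cut_apply) simp
  ultimately show ?thesis
    by (simp only: value_step_app[OF gt])
qed

lemma value_of_pr:
  assumes w: "w \<in> lists I" "k < length w"
  shows "value_of \<phi> (pr w k) as = \<one>\<^bsub>D (composite F ([w ! k], pr w k # as))\<^esub>"
proof -
  have "value_of \<phi> (pr w k) = value_step \<phi> (cut (value_of \<phi>) subterm_rel (pr w k)) (pr w k)"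
    unfolding value_of_def by (rule wfrec[OF wf_subterm_rel])
  moreover have "\<not> (\<exists>g t. generator g \<and> t \<in> Arr F \<and> Cod F t = Dom F g \<and> pr w k = g \<cdot> t)"
    using app_neq_pr[OF _ _ _ w] by metis
  ultimately show ?thesis
    using w unfolding value_step_def by (simp only: if_False pr(3))
qed

context
  fixes \<phi> n
  assumes \<phi>: "\<phi> \<in> cochains (Suc (Suc n))"
    and \<phi>1: "\<And>A b as. (A, Ident F A # b # as) \<in> strings F (Suc (Suc n)) \<Longrightarrow>
      \<phi> (A, Ident F A # b # as) = \<one>\<^bsub>D (composite F (A, b # as))\<^esub>"
    and \<phi>2: "\<And>A a as. (A, a # Ident F (Dom F a) # as) \<in> strings F (Suc (Suc n)) \<Longrightarrow>
      \<phi> (A, a # Ident F (Dom F a) # as) = \<one>\<^bsub>D (composite F (A, a # as))\<^esub>"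
begin

text \<open>
  In this context \<open>\<phi>\<close> is normalised: it vanishes on strings whose first or second arrow is an
  identity.
\<close>

abbreviation "V \<equiv> value_of \<phi>"
abbreviation "W \<equiv> tuple_value \<phi> V"

lemma W_if_components:
  assumes a: "a \<in> Arr F" "composable F (Dom F a) as" "length as = n"
    and V: "\<And>k. k < length (Cod F a) \<Longrightarrow>
      V (pr (Cod F a) k \<cdot> a) as \<in> carrier (D (pr (Cod F a) k \<cdot> composite F (Cod F a, a # as)))"
  shows "W a as \<in> carrier (D (composite F (Cod F a, a # as)))"
    and "k < length (Cod F a) \<Longrightarrow> lact (pr (Cod F a) k) (composite F (Cod F a, a # as)) (W a as) =
      V (pr (Cod F a) k \<cdot> a) as
      \<otimes>\<^bsub>D (pr (Cod F a) k \<cdot> composite F (Cod F a, a # as))\<^esub> \<phi> ([Cod F a ! k], pr (Cod F a) k # a # as)"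
proof -
  let ?w = "Cod F a"
  let ?c = "composite F (?w, a # as)"
  have c: "?c \<in> Arr F" "Cod F ?c = ?w"
    using a by simp_all
  have "V (pr ?w k \<cdot> a) as \<otimes>\<^bsub>D (pr ?w k \<cdot> ?c)\<^esub> \<phi> ([?w ! k], pr ?w k # a # as)
      \<in> carrier (D (pr ?w k \<cdot> ?c))" if k: "k < length ?w" for k
  proof -
    interpret G: comm_group "D (pr ?w k \<cdot> ?c)"
      using k c a by (intro ab) simp
    have "([?w ! k], pr ?w k # a # as) \<in> strings F (Suc (Suc n))"
      using k a by (simp add: strings_def)
    from cochain_closed[OF \<phi> this]
    have "\<phi> ([?w ! k], pr ?w k # a # as) \<in> carrier (D (pr ?w k \<cdot> ?c))"
      using k a by simp
    with V[OF k] show ?thesis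
      by (rule G.m_closed)
  qed
  from cartesian_ex[OF c this]
  have "\<exists>x. x \<in> carrier (D ?c) \<and> (\<forall>k<length ?w. lact (pr ?w k) ?c x =
       V (pr ?w k \<cdot> a) as \<otimes>\<^bsub>D (pr ?w k \<cdot> ?c)\<^esub> \<phi> ([?w ! k], pr ?w k # a # as))"
    by blast
  from someI_ex[OF this]
  show "W a as \<in> carrier (D ?c)" and "k < length ?w \<Longrightarrow> lact (pr ?w k) ?c (W a as) =
      V (pr ?w k \<cdot> a) as \<otimes>\<^bsub>D (pr ?w k \<cdot> ?c)\<^esub> \<phi> ([?w ! k], pr ?w k # a # as)"
    unfolding tuple_value_def Let_def by blast+
qed

text \<open>
  The values lie in the right groups, by induction along the recursion; by \<open>W_if_components\<close> they
  then satisfy the equations at the projections.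
\<close>

lemma V_closed:
  assumes "f \<in> Arr F" "Cod F f = [i]" "composable F (Dom F f) as" "length as = n"
  shows "V f as \<in> carrier (D (composite F ([i], f # as)))"
  using assms
proof (induction f arbitrary: i rule: wf_induct_rule[OF wf_subterm_rel])
  case (1 f)
  interpret G: comm_group "D (composite F ([i], f # as))"
    using 1(2-5) by (intro ab) simp
  show ?case
    using 1(2,3)
  proof (cases rule: arrow_cases)
    case (proj w k)
    then show ?thesis
      using value_of_pr[of w k \<phi> as] G.one_closed by simp
  next
    case (app g t)
    have g: "g \<in> Arr F" "Cod F g = [i]" "Dom F f = Dom F t"
      using app 1(3) by simp_all
    have as: "composable F (Dom F t) as"
      using 1(4) g by simp
    have "W t as \<in> carrier (D (composite F (Cod F t, t # as)))"
    proof (rule W_if_components(1)[OF app(2) as 1(5)])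
      fix k assume k: "k < length (Cod F t)"
      have "V (pr (Cod F t) k \<cdot> t) as \<in>
          carrier (D (composite F ([Cod F t ! k], (pr (Cod F t) k \<cdot> t) # as)))"
      proof (rule 1(1))
        show "(pr (Cod F t) k \<cdot> t, f) \<in> subterm_rel"
          unfolding app(4) using subterm_relI[OF app(1-3)] k app(3) by simp
      qed (use k app as 1(5) in simp_all)
      then show "V (pr (Cod F t) k \<cdot> t) as \<in>
          carrier (D (pr (Cod F t) k \<cdot> composite F (Cod F t, t # as)))"
        using k app(2) as by simp
    qed
    then have "lact g (composite F (Dom F g, t # as)) (W t as) \<in> carrier (D (composite F ([i], f # as)))"
      using hom_in_carrier[OF lact_hom[of "composite F (Dom F g, t # as)" g]] app g as by simp
    moreover have "\<phi> (Cod F g, g # t # as) \<in> carrier (D (composite F ([i], f # as)))"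
      using cochain_closed[OF \<phi>, of "(Cod F g, g # t # as)"] app g as 1(5)
      by (simp add: strings_def)
    moreover have "g \<cdot> composite F (Dom F g, t # as) = composite F ([i], f # as)"
      using app g as by simp
    ultimately show ?thesis
      using value_of_app[OF app(1-3), of \<phi> as] G.m_closed G.inv_closed
      by (simp only: app(4) Let_def)
  qed
qed

lemma W:
  assumes a: "a \<in> Arr F" "composable F (Dom F a) as" "length as = n"
  shows "W a as \<in> carrier (D (composite F (Cod F a, a # as)))"
    and "k < length (Cod F a) \<Longrightarrow> lact (pr (Cod F a) k) (composite F (Cod F a, a # as)) (W a as) =
      V (pr (Cod F a) k \<cdot> a) as
      \<otimes>\<^bsub>D (pr (Cod F a) k \<cdot> composite F (Cod F a, a # as))\<^esub> \<phi> ([Cod F a ! k], pr (Cod F a) k # a # as)"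
proof -
  have "V (pr (Cod F a) k \<cdot> a) as \<in> carrier (D (pr (Cod F a) k \<cdot> composite F (Cod F a, a # as)))"
    if "k < length (Cod F a)" for k
    using V_closed[of "pr (Cod F a) k \<cdot> a" "Cod F a ! k" as] that a by simp
  from W_if_components[OF a this]
  show "W a as \<in> carrier (D (composite F (Cod F a, a # as)))"
    and "k < length (Cod F a) \<Longrightarrow> lact (pr (Cod F a) k) (composite F (Cod F a, a # as)) (W a as) =
      V (pr (Cod F a) k \<cdot> a) as
      \<otimes>\<^bsub>D (pr (Cod F a) k \<cdot> composite F (Cod F a, a # as))\<^esub> \<phi> ([Cod F a ! k], pr (Cod F a) k # a # as)"
    by blast+
qed

text \<open>
  An arrow into a single sort is also a tuple with one component, the projection being an identity.
  The two prescriptions agree as \<open>\<phi>\<close> vanishes on strings starting with an identity.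
\<close>

lemma W_single:
  assumes f: "f \<in> Arr F" "Cod F f = [i]" "composable F (Dom F f) as" "length as = n"
  shows "W f as = V f as"
proof -
  let ?c = "composite F ([i], f # as)"
  have i: "i \<in> I"
    using cod_in_lists[OF f(1)] f(2) by simp
  have c: "?c \<in> Arr F" "Cod F ?c = [i]"
    using f by simp_all
  interpret G: comm_group "D ?c"
    by (rule ab) (rule c)
  have "\<phi> ([i], Ident F [i] # f # as) = \<one>\<^bsub>D ?c\<^esub>"
    using f i by (intro \<phi>1) (simp add: strings_def)
  moreover have "V f as \<in> carrier (D ?c)"
    by (rule V_closed[OF f])
  moreover have "W f as \<in> carrier (D ?c)"
    using W(1)[OF f(1,3,4)] unfolding f(2) .
  moreover have "Ident F [i] \<cdot> ?c = ?c" "Ident F [i] \<cdot> f = f"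
    using c f by simp_all
  ultimately show ?thesis
    using W(2)[OF f(1,3,4), of 0] lact_ident[OF c(1), of "W f as"] G.r_one
    unfolding c(2) f(2) by (simp add: pr_single[OF i] del: composite.simps)
qed

lemma W_ident:
  assumes w: "w \<in> lists I" and as: "composable F w as" "length as = n"
  shows "W (Ident F w) as = \<one>\<^bsub>D (composite F (w, as))\<^esub>"
proof -
  let ?c = "composite F (w, as)"
  have c: "?c \<in> Arr F" "Cod F ?c = w" "composite F (w, Ident F w # as) = ?c"
    using as w by simp_all
  interpret G: comm_group "D ?c"
    by (rule ab) (rule c)
  have i: "Ident F w \<in> Arr F" "Cod F (Ident F w) = w" "composable F (Dom F (Ident F w)) as"
    using w as by simp_all
  note Wi = W[OF i(1,3) as(2), unfolded i(2) c(3)]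
  show ?thesis
  proof (rule cartesian_eqI[OF c(1,2) Wi(1) G.one_closed])
    fix k assume k: "k < length w"
    let ?p = "pr w k"
    have p: "?p \<in> Arr F" "Dom F ?p = w" "Cod F ?p = [w ! k]" "?p \<cdot> Ident F w = ?p"
      using k w by simp_all
    interpret P: comm_group "D (?p \<cdot> ?c)"
      using p c by (intro ab) simp
    have "\<phi> ([w ! k], ?p # Ident F (Dom F ?p) # as) = \<one>\<^bsub>D (composite F ([w ! k], ?p # as))\<^esub>"
      using p w as i(3) by (intro \<phi>2) (simp add: strings_def)
    then have "\<phi> ([w ! k], ?p # Ident F w # as) = \<one>\<^bsub>D (?p \<cdot> ?c)\<^esub>"
      using p by simp
    moreover have "V ?p as = \<one>\<^bsub>D (?p \<cdot> ?c)\<^esub>"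
      using value_of_pr[OF w k, of \<phi> as] p by simp
    ultimately have "lact ?p ?c (W (Ident F w) as) = \<one>\<^bsub>D (?p \<cdot> ?c)\<^esub>"
      using Wi(2)[OF k] P.r_one P.one_closed unfolding p(4) by simp
    then show "lact ?p ?c (W (Ident F w) as) = lact ?p ?c \<one>\<^bsub>D ?c\<^esub>"
      using lact_one[OF c(1) p(1)] p(2) c(2) by simp
  qed
qed

text \<open>
  The recursion treats a generator \<open>g\<close> as \<open>g \<cdot> 1\<close>. That \<open>\<phi>\<close> vanishes if the second arrow is an
  identity gives the neutral value, first at identities (\<open>W_ident\<close>) and then at generators.
\<close>

lemma V_generator:
  assumes g: "generator g" and as: "composable F (Dom F g) as" "length as = n"
  shows "V g as = \<one>\<^bsub>D (composite F (Cod F g, g # as))\<^esub>"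
proof -
  let ?u = "Dom F g"
  let ?c = "composite F (?u, as)"
  have u: "?u \<in> lists I" "g \<in> Arr F"
    using g by simp_all
  have c: "?c \<in> Arr F" "Cod F ?c = ?u" "composite F (?u, Ident F ?u # as) = ?c"
    using as u by simp_all
  interpret P: comm_group "D (g \<cdot> ?c)"
    using u c by (intro ab) simp
  have "V (g \<cdot> Ident F ?u) as = lact g ?c (W (Ident F ?u) as)
      \<otimes>\<^bsub>D (g \<cdot> ?c)\<^esub> inv\<^bsub>D (g \<cdot> ?c)\<^esub> \<phi> (Cod F g, g # Ident F ?u # as)"
    using value_of_app[OF g, of "Ident F ?u" \<phi> as] u(1) unfolding Let_def c(3) by simp
  moreover have "lact g ?c (W (Ident F ?u) as) = \<one>\<^bsub>D (g \<cdot> ?c)\<^esub>"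
    using W_ident[OF u(1) as] lact_one[OF c(1) u(2)] c(2) by simp
  moreover have "\<phi> (Cod F g, g # Ident F ?u # as) = \<one>\<^bsub>D (composite F (Cod F g, g # as))\<^esub>"
    using u as by (intro \<phi>2) (simp add: strings_def)
  moreover have "composite F (Cod F g, g # as) = g \<cdot> ?c"
    by simp
  moreover have "g \<cdot> Ident F ?u = g"
    using u by simp
  ultimately show ?thesis
    by (simp only: P.inv_one P.r_one P.one_closed)
qed

lemma W_basic:
  assumes x: "basic x" and as: "composable F (Dom F x) as" "length as = n"
  shows "W x as = \<one>\<^bsub>D (composite F (Cod F x, x # as))\<^esub>"
proof -
  obtain i where i: "x \<in> Arr F" "Cod F x = [i]"
    using x by (rule basic_arr)
  have "V x as = \<one>\<^bsub>D (composite F (Cod F x, x # as))\<^esub>"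
    using x V_generator as value_of_pr i unfolding basic_def by (auto simp del: composite.simps)
  then show ?thesis
    using W_single[OF i as] by simp
qed

lemma ex_solution_on_basic:
  obtains \<psi> where "\<psi> \<in> cochains (Suc n)"
    "\<And>x as. basic x \<Longrightarrow> composable F (Dom F x) as \<Longrightarrow> length as = Suc n \<Longrightarrow>
      coboundary F D T (Suc n) \<psi> (Cod F x, x # as) = \<phi> (Cod F x, x # as)"
proof
  define \<psi> where "\<psi> = (\<lambda>s\<in>strings F (Suc n). W (hd (snd s)) (tl (snd s)))"
  have \<psi>_val: "\<psi> (A, a # as) = W a as"
    if "a \<in> Arr F" "Cod F a = A" "composable F (Dom F a) as" "length as = n" for A a as
    using that by (simp add: \<psi>_def strings_def)
  show \<psi>: "\<psi> \<in> cochains (Suc n)"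
  proof -
    have "W (hd (snd s)) (tl (snd s)) \<in> carrier (D (composite F s))" if "s \<in> strings F (Suc n)" for s
      using that W(1) by (auto simp: strings_def length_Suc_conv simp del: composite.simps)
    then show ?thesis
      by (simp add: \<psi>_def cochain_group_def)
  qed
  fix x as'
  assume x: "basic x" and "composable F (Dom F x) as'" "length as' = Suc n"
  then obtain a as where as': "as' = a # as" and a: "a \<in> Arr F" "Cod F a = Dom F x"
    "composable F (Dom F a) as" "length as = n"
    by (auto simp: length_Suc_conv)
  obtain i where xa: "x \<in> Arr F" "Cod F x = [i]"
    using x by (rule basic_arr)
  let ?s = "([i], x # a # as)" and ?c = "composite F (Dom F x, a # as)"
  have s: "?s \<in> strings F (Suc (Suc n))"
    using xa a by (simp add: strings_def)
  define G where "G = D (composite F ?s)"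
  interpret G: comm_group G
    unfolding G_def by (rule ab) (rule composite_string[OF s])
  have G: "G = D (x \<cdot> ?c)"
    by (simp add: G_def)
  have c: "?c \<in> Arr F" "Cod F ?c = Dom F x"
    using a by simp_all
  have l: "lact x ?c (W a as) \<in> carrier G"
    using hom_in_carrier[OF lact_hom[OF c(1) xa(1)]] W(1)[OF a(1,3,4)] c(2) a(2)
    unfolding G by metis
  have \<phi>s: "\<phi> ?s \<in> carrier G"
    unfolding G_def by (rule cochain_closed[OF \<phi> s])
  have "coboundary F D T (Suc n) \<psi> ?s = lact x ?c (\<psi> (Dom F x, a # as)) \<otimes>\<^bsub>G\<^esub> inv\<^bsub>G\<^esub> \<psi> ([i], (x \<cdot> a) # as)"
    unfolding G_def
  proof (rule coboundary_of_vanishing_on_first[OF \<psi> s])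
    fix bs assume bs: "composable F [i] (x # bs)" "length bs = n"
    then show "\<psi> ([i], x # bs) = \<one>\<^bsub>D (composite F ([i], x # bs))\<^esub>"
      using W_basic[OF x, of bs] \<psi>_val[of x "[i]" bs] xa by simp
  qed
  also have "\<psi> (Dom F x, a # as) = W a as"
    using a by (intro \<psi>_val) simp_all
  also have "\<psi> ([i], (x \<cdot> a) # as) = V (x \<cdot> a) as"
    using a xa \<psi>_val[of "x \<cdot> a" "[i]" as] W_single[of "x \<cdot> a" i as] by simp
  also have "lact x ?c (W a as) \<otimes>\<^bsub>G\<^esub> inv\<^bsub>G\<^esub> V (x \<cdot> a) as = \<phi> ?s"
    using x unfolding basic_def
  proof
    assume g: "generator x"
    have "V (x \<cdot> a) as = lact x ?c (W a as) \<otimes>\<^bsub>G\<^esub> inv\<^bsub>G\<^esub> \<phi> ?s"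
      using value_of_app[OF g a(1,2), of \<phi> as] unfolding Let_def G xa(2) .
    then show ?thesis
      using l \<phi>s by (simp only: G.mult_inv_mult_inv_cancel)
  next
    assume "\<exists>w\<in>lists I. \<exists>k<length w. x = pr w k"
    then obtain w k where wk: "w \<in> lists I" "k < length w" "x = pr w k"
      by blast
    have wi: "Dom F x = w" "w ! k = i"
      using wk xa(2) by simp_all
    have V: "V (x \<cdot> a) as \<in> carrier G"
      using V_closed[of "x \<cdot> a" i as] xa a by (simp add: G_def)
    have "lact x ?c (W a as) = V (x \<cdot> a) as \<otimes>\<^bsub>G\<^esub> \<phi> ?s"
      using W(2)[OF a(1,3,4), of k] wk wi unfolding a(2) G by simp
    also have "\<dots> = \<phi> ?s \<otimes>\<^bsub>G\<^esub> V (x \<cdot> a) as"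
      using V \<phi>s by (rule G.m_comm)
    finally show ?thesis
      using V \<phi>s by (simp only: G.m_assoc G.r_inv G.r_one G.inv_closed)
  qed
  finally show "coboundary F D T (Suc n) \<psi> (Cod F x, x # as') = \<phi> (Cod F x, x # as')"
    unfolding as' xa(2) .
qed

end

lemma cocycle_is_coboundary:
  assumes \<phi>: "\<phi> \<in> cocycles F D T (Suc (Suc n))"
  shows "\<exists>\<psi>\<in>cochains (Suc n). coboundary F D T (Suc n) \<psi> = \<phi>"
proof -
  let ?K = "cochain_group F D (Suc (Suc n))" and ?K1 = "cochain_group F D (Suc n)"
  let ?d = "coboundary F D T (Suc n)"
  interpret K: group ?K by (rule group_cochain)
  interpret K1: group ?K1 by (rule group_cochain)
  interpret d: group_hom ?K1 ?K ?d
    by (intro group_hom.intro group_hom_axioms.intro group_cochain coboundary_hom)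
  interpret d2: group_hom ?K "cochain_group F D (Suc (Suc (Suc n)))" "coboundary F D T (Suc (Suc n))"
    by (intro group_hom.intro group_hom_axioms.intro group_cochain coboundary_hom)
  obtain \<phi>' \<psi>\<^sub>0 where \<psi>0: "\<psi>\<^sub>0 \<in> cochains (Suc n)"
    and \<phi>': "\<phi>' \<in> cocycles F D T (Suc (Suc n))" and \<phi>_eq: "\<phi> = \<phi>' \<otimes>\<^bsub>?K\<^esub> ?d \<psi>\<^sub>0"
    and n1: "\<forall>A b as. (A, Ident F A # b # as) \<in> strings F (Suc (Suc n)) \<longrightarrow>
      \<phi>' (A, Ident F A # b # as) = \<one>\<^bsub>D (composite F (A, b # as))\<^esub>"
    and n2: "\<forall>A a as. (A, a # Ident F (Dom F a) # as) \<in> strings F (Suc (Suc n)) \<longrightarrow>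
      \<phi>' (A, a # Ident F (Dom F a) # as) = \<one>\<^bsub>D (composite F (A, a # as))\<^esub>"
    using \<phi> by (rule normalise_cocycle)
  note \<phi>'c = cocyclesD(1)[OF \<phi>']
  obtain \<psi> where \<psi>: "\<psi> \<in> cochains (Suc n)"
    and \<psi>\<phi>: "\<And>x as. basic x \<Longrightarrow> composable F (Dom F x) as \<Longrightarrow> length as = Suc n \<Longrightarrow>
      ?d \<psi> (Cod F x, x # as) = \<phi>' (Cod F x, x # as)"
    using ex_solution_on_basic[OF \<phi>'c n1[rule_format] n2[rule_format]] by metis
  have d\<psi>: "?d \<psi> \<in> cochains (Suc (Suc n))"
    by (rule coboundary_closed[OF \<psi>])
  define \<chi> where "\<chi> = \<phi>' \<otimes>\<^bsub>?K\<^esub> inv\<^bsub>?K\<^esub> (?d \<psi>)"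
  have "?d \<psi> \<in> cocycles F D T (Suc (Suc n))"
    using d\<psi> coboundary_coboundary[OF \<psi>] by (simp only: cocycles_def kernel_def mem_Collect_eq)
  then have \<chi>: "\<chi> \<in> cocycles F D T (Suc (Suc n))"
    using \<phi>' d2.subgroup_kernel unfolding \<chi>_def cocycles_def
    by (intro subgroup.m_closed subgroup.m_inv_closed)
  have "\<chi> = \<one>\<^bsub>?K\<^esub>"
  proof (rule cocycle_eq_one_if_basic[OF \<chi>])
    fix x as assume x: "basic x" and as: "composable F (Dom F x) as" "length as = Suc n"
    have "x \<in> Arr F"
      using x by (rule basic_arr)
    let ?s = "(Cod F x, x # as)"
    have s: "?s \<in> strings F (Suc (Suc n))"
      using \<open>x \<in> Arr F\<close> as by (simp add: strings_def)
    interpret G: comm_group "D (composite F ?s)"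
      by (rule ab) (rule composite_string[OF s])
    have "\<chi> ?s = \<phi>' ?s \<otimes>\<^bsub>D (composite F ?s)\<^esub> (inv\<^bsub>?K\<^esub> (?d \<psi>)) ?s"
      using s by (simp add: \<chi>_def cochain_group_def del: composite.simps)
    also have "(inv\<^bsub>?K\<^esub> (?d \<psi>)) ?s = inv\<^bsub>D (composite F ?s)\<^esub> (?d \<psi> ?s)"
      using d\<psi> s ab unfolding cochain_group_def
      by (subst inv_product_group) (auto simp: comm_group_def)
    finally show "\<chi> ?s = \<one>\<^bsub>D (composite F ?s)\<^esub>"
      using \<psi>\<phi>[OF x as] cochain_closed[OF \<phi>'c s] by (simp only: G.r_inv)
  qed
  then have "\<phi>' = ?d \<psi>"
    unfolding \<chi>_def using K.inv_equality[of \<phi>' "inv\<^bsub>?K\<^esub> ?d \<psi>"] \<phi>'c d\<psi> K.inv_inv K.inv_closed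
    by metis
  then have "?d (\<psi> \<otimes>\<^bsub>?K1\<^esub> \<psi>\<^sub>0) = \<phi>"
    unfolding \<phi>_eq using d.hom_mult[OF \<psi> \<psi>0] by (simp only:)
  then show ?thesis
    using K1.m_closed[OF \<psi> \<psi>0] by blast
qed

end

theorem corollary5p2p2:
  fixes I :: "'i set"
    and F :: "('i list, 'a) cat"
    and J :: "'i list \<times> nat list \<times> 'i list \<Rightarrow> 'a"
    and E :: "'i list \<Rightarrow> 'i \<Rightarrow> 'e set"
    and \<eta> :: "'i list \<Rightarrow> 'i \<Rightarrow> 'e \<Rightarrow> 'a"
    and D :: "'a \<Rightarrow> 'd monoid"
    and T :: "'a \<times> 'a \<times> 'a \<Rightarrow> 'd \<Rightarrow> 'd"
    and i :: nat
  assumes "free_sorted_theory I F J E \<eta>"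
    and "natural_system F D T"
    and "cartesian F D T"
    and "i > 1"
  shows "trivial_group (cohomology_group F D T i)"
proof -
  interpret free_theory I F J E \<eta>
    by (rule free_theory.intro) (rule assms(1))
  interpret cartesian_on_free_theory I F J E \<eta> D T
    by unfold_locales (rule assms(2), rule assms(3))
  obtain n where i: "i = Suc (Suc n)"
    using le_Suc_ex[of 2 i] assms(4) by auto
  show ?thesis
    unfolding i by (rule trivial_cohomology_group) (rule cocycle_is_coboundary)
qed

end
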